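(* Let $T$ be a Calderón--Zygmund operator on $\mathbb{R}^n$, let $\Phi=\{\phi_\alpha\}_{\alpha\in\mathcal{I}}$ be a family of real-valued measurable functions indexed by an arbitrary set $\mathcal{I}$, and let $T^\Phi$ be the associated maximally modulated Calderón--Zygmund operator $T^{\Phi}f(x)=\sup_{\alpha\in\mathcal{I}}|T(e^{2\pi i\phi_\alpha}f)(x)|$. Assume that for some $r_0>1$ the operator $T^\Phi$ satisfies the a priori weak-type unweighted inequalities $$\|T^{\Phi}f\|_{L^{r,\infty}(\mathbb{R}^n)}\lesssim\psi(r)\|f\|_{L^r(\mathbb{R}^n)},\qquad 1<r\le r_0,$$ where $\psi(r)$ is a function that captures the dependence of the operator norm on $r$. Then for any $1<p<\infty$ there is a constant $C<\infty$, independent of $f$ and $w$, such that for any weight $w$ $$\int_{\mathbb{R}^n}|T^{\Phi}f(x)|^p\,w(x)\,dx\le C\int_{\mathbb{R}^n}|f(x)|^p\,M^{\lfloor p\rfloor+1}w(x)\,dx .$$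
   Context: A weight is a non-negative locally integrable function. $X\lesssim Y$ means $X\le cY$ for a constant $c$ that is, in particular, independent of the function $f$. $M$ is the Hardy--Littlewood maximal operator on $\mathbb{R}^n$; $M^k$ is the $k$-fold composition of $M$, and $\lfloor p\rfloor$ is the integer part of $p$. A Calderón--Zygmund operator $T$ on $\mathbb{R}^n$ is an $L^2$-bounded linear operator represented as $Tf(x)=\int_{\mathbb{R}^n}K(x,y)f(y)\,dy$ for $x\notin\operatorname{supp}f$, where the kernel $K$ satisfies, for some constant $c_K$: (i) $|K(x,y)|\le c_K|x-y|^{-n}$ for all $x\ne y$; (ii) $|K(x,y)-K(x',y)|+|K(y,x)-K(y,x')|\le c_K\frac{|x-x'|^\delta}{|x-y|^{n+\delta}}$ for some $0<\delta\le1$ when $|x-x'|<|x-y|/2$. *)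

theory Defs
  imports "HOL-Analysis.Analysis"
begin

section \<open>Extended-real powers, integrals and norms\<close>

text \<open>Only used with a positive exponent.\<close>
definition ennreal_pow :: "ennreal \<Rightarrow> real \<Rightarrow> ennreal" where
  "ennreal_pow x a = (if x = \<infinity> then \<infinity> else ennreal (enn2real x powr a))"

text \<open>
  A supremum over an arbitrary (possibly uncountable) index set need not be measurable. On
  non-measurable arguments \<^const>\<open>nn_integral\<close> is a lower integral and \<^const>\<open>emeasure\<close> is 0, so
  sizes of such suprema are measured by the upper integral and by the outer measure.
  On measurable arguments these are the ordinary integral and measure; see
  \<open>upper_nn_integral_eq\<close> and \<open>outer_measure_of_eq\<close>.
\<close>
definition upper_nn_integral :: "'a measure \<Rightarrow> ('a \<Rightarrow> ennreal) \<Rightarrow> ennreal" where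
  "upper_nn_integral M h =
     (INF g\<in>{g \<in> borel_measurable M. \<forall>x\<in>space M. h x \<le> g x}. \<integral>\<^sup>+x. g x \<partial>M)"

lemma upper_nn_integral_eq:
  assumes "h \<in> borel_measurable M"
  shows "upper_nn_integral M h = (\<integral>\<^sup>+x. h x \<partial>M)"
  unfolding upper_nn_integral_def
  by (rule antisym) (auto intro!: INF_lower2[of h] INF_greatest nn_integral_mono simp: assms)

definition Lp_norm :: "real \<Rightarrow> ((real^'n) \<Rightarrow> complex) \<Rightarrow> ennreal" where
  "Lp_norm p f = ennreal_pow (\<integral>\<^sup>+x. ennreal (cmod (f x) powr p) \<partial>lebesgue) (1 / p)"

definition Lp :: "real \<Rightarrow> ((real^'n) \<Rightarrow> complex) set" where
  "Lp p = {f \<in> borel_measurable lebesgue. Lp_norm p f < \<infinity>}"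

definition weak_Lp_norm :: "real \<Rightarrow> ((real^'n) \<Rightarrow> ennreal) \<Rightarrow> ennreal" where
  "weak_Lp_norm p g =
     (SUP t\<in>{0::real<..}. ennreal t * ennreal_pow (outer_measure_of lebesgue {x. ennreal t < g x}) (1 / p))"

section \<open>Weights and the Hardy--Littlewood maximal operator\<close>

definition weight :: "((real^'n) \<Rightarrow> real) \<Rightarrow> bool" where
  "weight w \<longleftrightarrow> (\<forall>x. 0 \<le> w x) \<and> (\<forall>K. compact K \<longrightarrow> w absolutely_integrable_on K)"

text \<open>
  The uncentred maximal operator over balls, acting on non-negative functions. It is
  extended-real valued because iterates of it on a weight may be infinite.
\<close>
definition maximal_op :: "((real^'n) \<Rightarrow> ennreal) \<Rightarrow> (real^'n) \<Rightarrow> ennreal" where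
  "maximal_op g x =
     (SUP (z, \<rho>)\<in>{(z, \<rho>). 0 < \<rho> \<and> x \<in> ball z \<rho>}.
        (\<integral>\<^sup>+y\<in>ball z \<rho>. g y \<partial>lebesgue) / emeasure lebesgue (ball z \<rho>))"

section \<open>Calderon--Zygmund operators\<close>

definition cz_kernel :: "real \<Rightarrow> real \<Rightarrow> ((real^'n) \<Rightarrow> (real^'n) \<Rightarrow> complex) \<Rightarrow> bool" where
  "cz_kernel c \<delta> K \<longleftrightarrow>
     (\<forall>x y. x \<noteq> y \<longrightarrow> cmod (K x y) \<le> c / norm (x - y) ^ CARD('n)) \<and>
     (\<forall>x x' y. norm (x - x') < norm (x - y) / 2 \<longrightarrow>
        cmod (K x y - K x' y) + cmod (K y x - K y x')
          \<le> c * (norm (x - x') powr \<delta> / norm (x - y) powr (real CARD('n) + \<delta>)))"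

text \<open>
  The operator is a map on functions (not on classes modulo null sets), linear on \<open>L\<^sup>2\<close>, and given
  by the kernel at every point off the support. Thus \<open>T f x\<close> has a meaning for each \<open>x\<close>, which a
  pointwise supremum over an uncountable index set requires. Values of \<open>T\<close> off \<open>L\<^sup>2\<close> are
  irrelevant.
\<close>
definition calderon_zygmund :: "(((real^'n) \<Rightarrow> complex) \<Rightarrow> (real^'n) \<Rightarrow> complex) \<Rightarrow> bool" where
  "calderon_zygmund T \<longleftrightarrow>
     (\<forall>f\<in>Lp 2. \<forall>g\<in>Lp 2. \<forall>a b.
        T (\<lambda>x. a * f x + b * g x) = (\<lambda>x. a * T f x + b * T g x)) \<and>
     (\<exists>B::real. \<forall>f\<in>Lp 2. T f \<in> Lp 2 \<and> Lp_norm 2 (T f) \<le> ennreal B * Lp_norm 2 f) \<and>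
     (\<exists>c \<delta> K. 0 < \<delta> \<and> \<delta> \<le> 1 \<and> cz_kernel c \<delta> K \<and>
        (\<forall>f\<in>Lp 2. \<forall>x. x \<notin> closure {y. f y \<noteq> 0} \<longrightarrow> T f x = (\<integral>y. K x y * f y \<partial>lebesgue)))"

definition max_modulated ::
  "(((real^'n) \<Rightarrow> complex) \<Rightarrow> (real^'n) \<Rightarrow> complex) \<Rightarrow> 'i set \<Rightarrow> ('i \<Rightarrow> (real^'n) \<Rightarrow> real)
     \<Rightarrow> ((real^'n) \<Rightarrow> complex) \<Rightarrow> (real^'n) \<Rightarrow> ennreal" where
  "max_modulated T I \<phi> f x =
     (SUP \<alpha>\<in>I. ennreal (cmod (T (\<lambda>y. exp (2 * pi * \<i> * \<phi> \<alpha> y) * f y) x)))"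

end

theory Submission
  imports Defs
begin

text \<open>
  Only one exponent \<open>r\<close> with \<open>1 < r < min p (min r\<^sub>0 2)\<close> is needed, so the size of \<open>\<psi>\<close> plays no role. By the
  smoothness of the kernel, the oscillation over a cube of the operator applied to the part of \<open>f\<close>
  off a concentric dilate is at most a multiple of the maximal function of \<open>f\<close>. Combined with the
  weak type \<open>(r,r)\<close> bound and a Calderon--Zygmund stopping time, this gives a pointwise bound of the
  localized operator by a sum of the \<open>L\<^sup>r\<close> averages \<open>a\<^sub>Q\<close> of \<open>f\<close> over (dilates of) a sparse tree of
  cubes \<open>Q\<close>.

  For the weighted estimate of such a sum let \<open>N\<^sub>Q\<close> count the cubes of the tree inside \<open>Q\<close> that
  contain a given point, and let \<open>k = \<lfloor>p\<rfloor>\<close>. As \<open>k > p - 1\<close>, Holder's inequality along the chain of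
  cubes containing a point gives \<open>(\<Sum> a\<^sub>Q 1\<^sub>Q)\<^sup>p \<le> C \<Sum> a\<^sub>Q\<^sup>p N\<^sub>Q\<^sup>k 1\<^sub>Q\<close>, and sparseness gives
  \<open>\<integral> N\<^sub>Q\<^sup>k w \<le> C \<integral>\<^sub>Q M\<^sup>k w\<close>. Hence the sum is controlled by \<open>C \<Sum> |Q| a\<^sub>Q\<^sup>p inf\<^sub>Q M\<^sup>k\<^sup>+\<^sup>1 w\<close>, which by sparseness
  once more is at most \<open>C \<integral> (M (|f|\<^sup>r v\<^bsup>r/p\<^esup>))\<^bsup>p/r\<^esup>\<close> with \<open>v = M\<^sup>k\<^sup>+\<^sup>1 w\<close>, and \<open>M\<close> is bounded on \<open>L\<^bsup>p/r\<^esup>\<close>.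
\<close>

section \<open>Sparse trees\<close>

text \<open>The supremum over \<open>I\<close> need not be measurable, and this shapes the selection
  of cubes: bad sets are bounded in outer measure and enclosed in open sets, on which the stopping
  time runs. Openness makes every bad point stop, so the points left over by the children are good
  without any differentiation of integrals. For the same reason the weighted estimate produces a
  measurable majorant.

  The bound \<open>r < p\<close> gives \<open>p / r > 1\<close>, where \<open>M\<close> is bounded;
  \<open>r \<le> 2\<close> puts local pieces of an \<open>L^2\<close> function into
  \<open>L^r\<close>, so that the weak-type hypothesis applies to them. The number \<open>k\<close>
  is the least integer above \<open>p - 1\<close>: the Hoelder weights \<open>i^(-k/(p-1))\<close>
  must be summable. Each of the \<open>k\<close> powers of the count costs one \<open>M\<close>, and
  averaging over the dilated cube costs the last one.

  All of this is local to one cube. The global bound uses cubes growing to the whole space: the part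
  of \<open>f\<close> off the dilate has a uniformly small image on the cube, as the kernel decays
  and \<open>f\<close> is in \<open>L^2\<close>, and local integrability of \<open>w\<close> makes
  the error vanish in the limit.\<close>

lemma ennreal_pow_ennreal: "0 \<le> u \<Longrightarrow> ennreal_pow (ennreal u) a = ennreal (u powr a)"
  by (simp add: ennreal_pow_def)

lemma ennreal_pow_top [simp]: "ennreal_pow top a = top"
  by (simp add: ennreal_pow_def)

lemma ennreal_pow_zero [simp]: "ennreal_pow 0 a = 0"
  by (simp add: ennreal_pow_def)

lemma ennreal_pow_eq_top_iff [simp]: "ennreal_pow x a = top \<longleftrightarrow> x = top"
  by (simp add: ennreal_pow_def)

lemma ennreal_pow_mono:
  assumes "x \<le> y" "0 < a"
  shows "ennreal_pow x a \<le> ennreal_pow y a"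
proof (cases "y = top")
  case False
  then have "x \<noteq> top" using assms by (auto simp: top_unique)
  with False assms show ?thesis
    by (auto simp: ennreal_pow_def less_top intro!: ennreal_leI powr_mono2 enn2real_mono)
qed simp

lemma ennreal_pow_mult:
  assumes "0 < a"
  shows "ennreal_pow (x * y) a = ennreal_pow x a * ennreal_pow y a"
proof (cases x; cases y)
  fix u v assume "0 \<le> u" "x = ennreal u" "0 \<le> v" "y = ennreal v"
  then show ?thesis
    by (simp add: ennreal_pow_ennreal powr_mult flip: ennreal_mult)
next
  fix u assume *: "0 \<le> u" "x = ennreal u" "y = top"
  then show ?thesis
    using assms by (cases "u = 0") (auto simp: ennreal_mult_top ennreal_pow_ennreal)
next
  fix u assume *: "0 \<le> u" "y = ennreal u" "x = top"
  then show ?thesis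
    using assms by (cases "u = 0") (auto simp: ennreal_top_mult ennreal_pow_ennreal)
qed (simp add: ennreal_top_mult)

lemma ennreal_pow_pow: "ennreal_pow (ennreal_pow x a) b = ennreal_pow x (a * b)"
  by (cases x) (simp_all add: ennreal_pow_ennreal powr_powr)

lemma ennreal_pow_one [simp]: "ennreal_pow x 1 = x"
  by (cases x) (simp_all add: ennreal_pow_ennreal)

lemma borel_measurable_ennreal_pow [measurable]:
  assumes [measurable]: "f \<in> borel_measurable M"
  shows "(\<lambda>x. ennreal_pow (f x) a) \<in> borel_measurable M"
  unfolding ennreal_pow_def by measurable

lemma ennreal_pow_add_le:
  assumes "0 < a"
  shows "ennreal_pow (x + y) a \<le> ennreal (2 powr a) * (ennreal_pow x a + ennreal_pow y a)"
proof -
  have "ennreal_pow (x + y) a \<le> ennreal_pow (2 * max x y) a"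
    by (intro ennreal_pow_mono assms) (metis add_mono max.cobounded1 max.cobounded2 mult_2)
  also have "\<dots> = ennreal (2 powr a) * ennreal_pow (max x y) a"
    using ennreal_pow_ennreal[of 2 a] by (simp add: ennreal_pow_mult assms)
  also have "\<dots> \<le> ennreal (2 powr a) * (ennreal_pow x a + ennreal_pow y a)"
    by (intro mult_left_mono) (auto simp: max_def)
  finally show ?thesis .
qed

lemma ennreal_divide_le_iff:
  fixes a b c :: ennreal
  assumes "b \<noteq> 0" "b \<noteq> top"
  shows "a / b \<le> c \<longleftrightarrow> a \<le> c * b"
proof
  assume "a / b \<le> c"
  then have "a / b * b \<le> c * b" by (rule mult_right_mono) simp
  moreover have "a / b * b = a"
    using assms by (simp add: ennreal_divide_times less_top)
  ultimately show "a \<le> c * b" by simp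
next
  assume "a \<le> c * b"
  then have "a / b \<le> c * b / b" by (rule divide_right_mono_ennreal)
  then show "a / b \<le> c" using assms by (simp add: mult_divide_eq_ennreal)
qed

text \<open>Convexity of \<open>x powr p\<close> at the points \<open>a / s\<close> and
  \<open>b / t\<close> with weights \<open>s / (s + t)\<close> and \<open>t / (s + t)\<close>:
  Hoelder's inequality for two terms, in a form that can be iterated along a chain.\<close>

lemma powr_add_le_weighted:
  fixes a b s t p :: real
  assumes "1 \<le> p" "0 \<le> a" "0 \<le> b" "0 < s" "0 < t"
  shows "(a + b) powr p \<le> (s + t) powr (p - 1) * (a powr p * s powr (1 - p) + b powr p * t powr (1 - p))"
proof -
  have le: "c powr p \<le> (u + v) powr (p - 1) * (c powr p * v powr (1 - p))"
    if "0 < u" "0 < v" for c u v :: real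
  proof -
    have "1 \<le> ((u + v) / v) powr (p - 1)"
      using that assms by (intro ge_one_powr_ge_zero) auto
    also have "\<dots> = (u + v) powr (p - 1) * v powr (1 - p)"
      using that powr_minus_divide[of v "p - 1"] by (simp add: powr_divide)
    finally have "c powr p * 1 \<le> c powr p * ((u + v) powr (p - 1) * v powr (1 - p))"
      by (intro mult_left_mono) auto
    then show ?thesis by (simp add: mult_ac)
  qed
  \<comment> \<open>Convexity is applied at positive points; if \<open>a\<close> or \<open>b\<close>
    vanishes, \<open>le\<close> gives the bound directly.\<close>
  consider "a = 0" | "b = 0" | "0 < a" "0 < b" using assms by force
  then show ?thesis
  proof cases
    case 1
    then show ?thesis using le[of s t b] assms by simp
  next
    case 2
    then show ?thesis using le[of t s a] assms by (simp add: add.commute)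
  next
    case 3
    have conv: "convex_on {0<..} (\<lambda>x::real. x powr p)"
      using assms(1) by (rule powr_convex)
    define l where "l = t / (s + t)"
    have l: "0 \<le> l" "l \<le> 1" "1 - l = s / (s + t)" using assms by (auto simp: l_def field_simps)
    have eq: "(1 - l) * (a / s) + l * (b / t) = (a + b) / (s + t)"
      using assms unfolding l(3) by (simp add: l_def add_divide_distrib)
    have "((1 - l) *\<^sub>R (a / s) + l *\<^sub>R (b / t)) powr p \<le> (1 - l) * (a / s) powr p + l * (b / t) powr p"
      using assms l 3 by (intro convex_onD[OF conv]) auto
    then have "((a + b) / (s + t)) powr p \<le> (1 - l) * (a / s) powr p + l * (b / t) powr p"
      by (simp only: eq real_scaleR_def)
    then have "(a + b) powr p \<le> (s + t) powr p * ((1 - l) * (a / s) powr p + l * (b / t) powr p)"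
      using assms by (simp add: powr_divide field_simps)
    also have "(s + t) powr p * ((1 - l) * (a / s) powr p + l * (b / t) powr p)
        = (s + t) powr p / (s + t) * (s * (a / s) powr p + t * (b / t) powr p)"
      unfolding l(3) by (simp add: l_def algebra_simps)
    also have "\<dots> = (s + t) powr (p - 1) * (a powr p * s powr (1 - p) + b powr p * t powr (1 - p))"
      using assms by (simp add: powr_divide powr_diff mult.commute)
    finally show ?thesis .
  qed
qed

text \<open>Sum of the Hoelder weights for a chain of \<open>n\<close> cubes. The term
  \<open>i = 0\<close> vanishes since \<open>0 powr x = 0\<close>; the leading \<open>1\<close>
  keeps the sum positive for the empty chain.\<close>

definition powr_sum :: "real \<Rightarrow> nat \<Rightarrow> real" where
  "powr_sum \<theta> n = 1 + (\<Sum>i\<le>n. real i powr (-\<theta>))"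

text \<open>The first factor bounds the Hoelder constants of chains of any length,
  \<open>fact k * 2 ^ k\<close> comes from the \<open>k\<close>-th power of the counting function,
  and the final \<open>2\<close> from sparseness.\<close>

definition sparse_const :: "real \<Rightarrow> nat \<Rightarrow> real" where
  "sparse_const p k = (1 + (\<Sum>i. real i powr (-(real k / (p - 1))))) powr (p - 1) * (fact k * 2 ^ k * 2)"

lemma powr_sum_ge_1: "1 \<le> powr_sum \<theta> n"
  unfolding powr_sum_def by (simp add: sum_nonneg)

lemma powr_sum_le: "1 < \<theta> \<Longrightarrow> powr_sum \<theta> n \<le> 1 + (\<Sum>i. real i powr (-\<theta>))"
  unfolding powr_sum_def by (intro add_left_mono sum_le_suminf) (auto simp: summable_real_powr_iff)

text \<open>Hoelder along a chain, extended by one cube at its large end: \<open>a\<close> is the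
  value on the new cube, whose count is \<open>Suc n\<close>, and it gets the weight
  \<open>\<tau> = Suc n powr (-\<theta>)\<close>. The choice \<open>\<theta> = k / (p - 1)\<close>
  makes \<open>\<tau> powr (1 - p)\<close> equal to \<open>Suc n ^ k\<close>, the wanted power of
  the count.\<close>

lemma ennreal_pow_add_step:
  assumes p: "1 < p" and \<theta>: "\<theta> = real k / (p - 1)"
    and s: "ennreal_pow s p \<le> ennreal (powr_sum \<theta> n powr (p - 1)) * R"
  shows "ennreal_pow (a + s) p
    \<le> ennreal (powr_sum \<theta> (Suc n) powr (p - 1)) * (ennreal_pow a p * of_nat (Suc n) ^ k + R)"
proof (cases "a = top \<or> R = top")
  case True
  then have eq: "ennreal_pow a p * of_nat (Suc n) ^ k + R = top"
    by (auto simp: ennreal_top_mult simp del: of_nat_Suc)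
  show ?thesis
    unfolding eq using powr_sum_ge_1[of \<theta> "Suc n"] by (simp add: ennreal_mult_top)
next
  case False
  then obtain a' R' where a': "a = ennreal a'" "0 \<le> a'" and R': "R = ennreal R'" "0 \<le> R'"
    by (cases a; cases R) auto
  then have "ennreal_pow s p \<noteq> top"
    using s by (auto simp: ennreal_mult_eq_top_iff top_unique)
  then obtain s' where s': "s = ennreal s'" "0 \<le> s'" by (cases s) auto
  define \<sigma> where "\<sigma> = powr_sum \<theta> n"
  define \<tau> where "\<tau> = real (Suc n) powr (-\<theta>)"
  have pos: "0 < \<sigma>" "0 < \<tau>" using powr_sum_ge_1[of \<theta> n] by (auto simp: \<sigma>_def \<tau>_def)
  have sum: "powr_sum \<theta> (Suc n) = \<tau> + \<sigma>" by (simp add: powr_sum_def \<sigma>_def \<tau>_def)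
  have "\<tau> powr (1 - p) = real (Suc n) powr (real k)"
  proof -
    have "-\<theta> * (1 - p) = real k" using p by (simp add: \<theta> field_simps)
    then show ?thesis by (simp only: \<tau>_def powr_powr)
  qed
  then have \<tau>: "\<tau> powr (1 - p) = real (Suc n) ^ k" by (simp add: powr_realpow)
  have "s' powr p \<le> \<sigma> powr (p - 1) * R'"
    using s s' R' by (simp add: \<sigma>_def ennreal_pow_ennreal flip: ennreal_mult)
  then have "s' powr p * \<sigma> powr (1 - p) \<le> \<sigma> powr (p - 1) * R' * \<sigma> powr (1 - p)"
    by (rule mult_right_mono) simp
  also have "\<dots> = R'"
    using pos by (simp flip: powr_add)
  finally have \<sigma>: "s' powr p * \<sigma> powr (1 - p) \<le> R'" .
  have "(a' + s') powr p
      \<le> (\<tau> + \<sigma>) powr (p - 1) * (a' powr p * \<tau> powr (1 - p) + s' powr p * \<sigma> powr (1 - p))"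
    using p a' s' pos by (intro powr_add_le_weighted) auto
  also have "\<dots> \<le> (\<tau> + \<sigma>) powr (p - 1) * (a' powr p * real (Suc n) ^ k + R')"
    using \<sigma> \<tau> by (intro mult_left_mono) auto
  finally have "ennreal ((a' + s') powr p) \<le> ennreal ((\<tau> + \<sigma>) powr (p - 1) * (a' powr p * real (Suc n) ^ k + R'))"
    by (rule ennreal_leI)
  moreover have "ennreal_pow a p * of_nat (Suc n) ^ k + R = ennreal (a' powr p * real (Suc n) ^ k + R')"
    using a' R'
    by (simp add: ennreal_pow_ennreal ennreal_of_nat_eq_real_of_nat ennreal_power
        flip: ennreal_mult ennreal_plus del: of_nat_Suc)
  moreover have "a + s = ennreal (a' + s')" using a' s' by simp
  ultimately show ?thesis
    using a' s' R' by (simp add: sum ennreal_pow_ennreal ennreal_mult del: of_nat_Suc ennreal_plus)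
qed

text \<open>The mean value bound for the difference of \<open>(1 + c) ^ Suc j\<close> and
  \<open>c ^ Suc j\<close>, written without subtraction because \<open>c\<close> may be
  infinite.\<close>

lemma one_plus_power_le:
  fixes c :: ennreal
  shows "(1 + c) ^ Suc j \<le> of_nat (Suc j) * (1 + c) ^ j + c ^ Suc j"
proof (induction j)
  case (Suc j)
  have "(1 + c) ^ Suc (Suc j) = (1 + c) ^ Suc j + c * (1 + c) ^ Suc j"
    by (simp add: algebra_simps)
  also have "\<dots> \<le> (1 + c) ^ Suc j + c * (of_nat (Suc j) * (1 + c) ^ j + c ^ Suc j)"
    by (intro add_left_mono mult_left_mono Suc) auto
  also have "\<dots> = (1 + c) ^ Suc j + of_nat (Suc j) * (c * (1 + c) ^ j) + c ^ Suc (Suc j)"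
    by (simp add: algebra_simps)
  also have "\<dots> \<le> (1 + c) ^ Suc j + of_nat (Suc j) * ((1 + c) * (1 + c) ^ j) + c ^ Suc (Suc j)"
    by (intro add_mono mult_left_mono mult_right_mono order_refl) auto
  also have "\<dots> = of_nat (Suc (Suc j)) * (1 + c) ^ Suc j + c ^ Suc (Suc j)"
    by (simp add: algebra_simps)
  finally show ?case .
qed simp

text \<open>Nodes are labels and \<open>S\<close> gives their sets, so that empty sets can pad the
  families of children. By \<open>kid_half\<close> the part of \<open>S q\<close> off its children
  keeps at least half of the measure, and this part pays for the node in every estimate of a
  sum.\<close>

locale sparse_tree =
  fixes M :: "'a measure" and S :: "'q \<Rightarrow> 'a set" and kid :: "'q \<Rightarrow> nat \<Rightarrow> 'q"
  assumes S_sets [measurable]: "S q \<in> sets M"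
    and S_finite: "emeasure M (S q) < \<infinity>"
    and kid_subset: "S (kid q i) \<subseteq> S q"
    and kid_disjoint: "disjoint_family (\<lambda>i. S (kid q i))"
    and kid_half: "2 * emeasure M (\<Union>i. S (kid q i)) \<le> emeasure M (S q)"
begin

text \<open>The first argument of \<open>F\<close> is the number of generations still to be summed.\<close>

fun tree_sum :: "(nat \<Rightarrow> 'q \<Rightarrow> 'a \<Rightarrow> ennreal) \<Rightarrow> nat \<Rightarrow> 'q \<Rightarrow> 'a \<Rightarrow> ennreal" where
  "tree_sum F 0 q x = 0"
| "tree_sum F (Suc N) q x = F (Suc N) q x * indicator (S q) x + (\<Sum>i. tree_sum F N (kid q i) x)"

fun layer :: "nat \<Rightarrow> 'q \<Rightarrow> 'a set" where
  "layer 0 q = S q"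
| "layer (Suc N) q = (\<Union>i. layer N (kid q i))"

text \<open>The counting function \<open>N\<^sub>Q\<close> of the overview, cut off after
  \<open>N\<close> generations.\<close>

abbreviation cnt :: "nat \<Rightarrow> 'q \<Rightarrow> 'a \<Rightarrow> ennreal" where
  "cnt \<equiv> tree_sum (\<lambda>_ _ _. 1)"

lemma tree_sum_measurable [measurable]:
  assumes "\<And>N q. F N q \<in> borel_measurable M"
  shows "tree_sum F N q \<in> borel_measurable M"
proof (induction N arbitrary: q)
  case (Suc N)
  note Suc[measurable] assms[measurable]
  have "tree_sum F (Suc N) q = (\<lambda>x. F (Suc N) q x * indicator (S q) x + (\<Sum>i. tree_sum F N (kid q i) x))"
    by (rule ext) simp
  then show ?case by simp
next
  case 0
  have "tree_sum F 0 q = (\<lambda>_. 0)" by (rule ext) simp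
  then show ?case by simp
qed

lemma tree_sum_outside: "x \<notin> S q \<Longrightarrow> tree_sum F N q x = 0"
proof (induction N arbitrary: q)
  case (Suc N)
  then have "x \<notin> S (kid q i)" for i using kid_subset[of q i] by auto
  with Suc show ?case by simp
qed simp

lemma tree_sum_leaf:
  assumes "x \<in> S q" "\<And>i. x \<notin> S (kid q i)"
  shows "tree_sum F (Suc N) q x = F (Suc N) q x"
  using assms by (simp add: tree_sum_outside)

text \<open>The children are disjoint, so at each point only one branch of the tree survives.
  Estimates of tree sums thereby become inductions along the chain of nodes containing the
  point.\<close>

lemma tree_sum_kid:
  assumes "x \<in> S (kid q i)"
  shows "tree_sum F (Suc N) q x = F (Suc N) q x + tree_sum F N (kid q i) x"
proof -
  have "tree_sum F N (kid q j) x = 0" if "j \<noteq> i" for j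
    using assms that kid_disjoint[of q] by (intro tree_sum_outside) (auto simp: disjoint_family_on_def)
  then have "(\<Sum>j. tree_sum F N (kid q j) x) = tree_sum F N (kid q i) x"
    by (subst suminf_finite[of "{i}"]) auto
  moreover have "x \<in> S q" using assms kid_subset by auto
  ultimately show ?thesis by simp
qed

lemma tree_sum_mono_N:
  assumes "\<And>N q x. F N q x \<le> F (Suc N) q x"
  shows "tree_sum F N q x \<le> tree_sum F (Suc N) q x"
proof (induction N arbitrary: q)
  case (Suc N)
  show ?case
    unfolding tree_sum.simps(2)[of F "Suc N"] tree_sum.simps(2)[of F N q]
    by (intro add_mono mult_right_mono suminf_le Suc assms) auto
qed simp

lemma layer_sets [measurable]: "layer N q \<in> sets M"
  by (induction N arbitrary: q) auto

lemma emeasure_layer_le: "2 ^ N * emeasure M (layer N q) \<le> emeasure M (S q)"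
proof (induction N arbitrary: q)
  case (Suc N)
  have "2 ^ Suc N * emeasure M (layer (Suc N) q) \<le> 2 ^ Suc N * (\<Sum>i. emeasure M (layer N (kid q i)))"
    by (intro mult_left_mono) (auto intro!: emeasure_subadditive_countably)
  also have "\<dots> = 2 * (\<Sum>i. 2 ^ N * emeasure M (layer N (kid q i)))"
    by (simp add: mult.assoc ennreal_suminf_cmult)
  also have "\<dots> \<le> 2 * (\<Sum>i. emeasure M (S (kid q i)))"
    by (intro mult_left_mono suminf_le Suc) auto
  also have "\<dots> = 2 * emeasure M (\<Union>i. S (kid q i))"
    using kid_disjoint by (subst suminf_emeasure) auto
  finally show ?case using kid_half order_trans by blast
qed simp

text \<open>Each generation at least halves the measure, so the points lying in all layers are
  negligible. Every other point has a finite chain of nodes, which a truncated tree sum captures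
  completely.\<close>

lemma null_layers: "(\<Inter>N. layer N q) \<in> null_sets M"
proof -
  obtain m where m: "emeasure M (S q) = ennreal m" "0 \<le> m"
    using S_finite[of q] by (cases "emeasure M (S q)") auto
  obtain l where l: "emeasure M (\<Inter>N. layer N q) = ennreal l" "0 \<le> l"
    using emeasure_mono[OF INT_lower[of 0 UNIV "\<lambda>N. layer N q"], of M] m
    by (cases "emeasure M (\<Inter>N. layer N q)") (auto simp: top_unique)
  have "l \<le> m / 2 ^ N" for N
  proof -
    have "2 ^ N * emeasure M (\<Inter>N. layer N q) \<le> emeasure M (S q)"
      by (rule order_trans[OF mult_left_mono[OF emeasure_mono] emeasure_layer_le[of N]]) auto
    then have "ennreal (2 ^ N * l) \<le> ennreal m"
      by (simp add: m l ennreal_mult flip: ennreal_power)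
    then show ?thesis using m by (simp add: field_simps)
  qed
  moreover have "(\<lambda>N. m / 2 ^ N) \<longlonglongrightarrow> 0"
    by (intro tendsto_divide_0[OF tendsto_const])
       (simp add: filterlim_realpow_sequentially_gt1 filterlim_at_top_imp_at_infinity)
  ultimately have "l \<le> 0"
    by (intro LIMSEQ_le_const[of "\<lambda>N. m / 2 ^ N" 0]) auto
  then show ?thesis using l by (auto simp: null_sets_def)
qed

section \<open>Integrals of tree sums and of powers of the count\<close>

lemma nn_integral_split:
  assumes [measurable]: "G \<in> borel_measurable M"
  shows "(\<integral>\<^sup>+x\<in>S q. G x \<partial>M)
    = (\<integral>\<^sup>+x\<in>S q - (\<Union>i. S (kid q i)). G x \<partial>M) + (\<Sum>i. \<integral>\<^sup>+x\<in>S (kid q i). G x \<partial>M)"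
proof -
  have "indicator (S q) x = indicator (S q - (\<Union>i. S (kid q i))) x + (\<Sum>i. indicator (S (kid q i)) x :: ennreal)" for x
  proof -
    have "(\<Sum>i. indicator (S (kid q i)) x :: ennreal) = indicator (\<Union>i. S (kid q i)) x"
      by (rule suminf_indicator[OF kid_disjoint])
    then show ?thesis using kid_subset[of q] by (auto simp: indicator_def)
  qed
  then have "(\<integral>\<^sup>+x\<in>S q. G x \<partial>M) = (\<integral>\<^sup>+x. G x * indicator (S q - (\<Union>i. S (kid q i))) x
       + (\<Sum>i. G x * indicator (S (kid q i)) x) \<partial>M)"
    by (intro nn_integral_cong) (simp add: distrib_left)
  then show ?thesis by (simp add: nn_integral_add nn_integral_suminf del: ennreal_suminf_cmult)
qed

text \<open>The pointwise bound puts \<open>D\<close>, divided by the measure of \<open>S q\<close>,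
  below \<open>G\<close> on all of \<open>S q\<close>. Integrating over the part off the children,
  which has at least half of the measure, gives the factor \<open>2\<close>. For empty
  \<open>S q\<close> the pointwise bound is vacuous, whence the last assumption.\<close>

lemma sparse_average_le:
  assumes [measurable]: "G \<in> borel_measurable M"
    and "\<And>x. x \<in> S q \<Longrightarrow> D \<le> emeasure M (S q) * G x" and "S q = {} \<Longrightarrow> D = 0"
  shows "D \<le> 2 * (\<integral>\<^sup>+x\<in>S q - (\<Union>i. S (kid q i)). G x \<partial>M)"
proof (cases "emeasure M (S q) = 0")
  case True
  then have "D = 0" using assms(2,3) by fastforce
  then show ?thesis by simp
next
  case False
  define E where "E = S q - (\<Union>i. S (kid q i))"
  have [measurable]: "E \<in> sets M" by (simp add: E_def)
  obtain m where m: "emeasure M (S q) = ennreal m" "0 < m"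
    using S_finite[of q] False by (cases "emeasure M (S q)") (auto simp: less_le)
  have U: "emeasure M (\<Union>i. S (kid q i)) < \<infinity>"
    using kid_subset by (intro le_less_trans[OF emeasure_mono S_finite[of q]]) auto
  have "emeasure M E = emeasure M (S q) - emeasure M (\<Union>i. S (kid q i))"
    unfolding E_def using kid_subset U by (intro emeasure_Diff) auto
  then have half: "emeasure M (S q) \<le> 2 * emeasure M E"
    using kid_half[of q] U m
    by (cases "emeasure M (\<Union>i. S (kid q i))")
       (auto simp: ennreal_minus ennreal_le_iff simp flip: ennreal_numeral ennreal_mult)
  have "D / m * emeasure M E = (\<integral>\<^sup>+x\<in>E. (D / m) \<partial>M)"
    by (simp add: nn_integral_cmult_indicator)
  also have "\<dots> \<le> (\<integral>\<^sup>+x\<in>E. G x \<partial>M)"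
    using assms(2) m
    by (intro nn_integral_mono)
       (auto simp: E_def indicator_def ennreal_divide_le_iff mult.commute)
  finally have le: "D / m * emeasure M E \<le> (\<integral>\<^sup>+x\<in>E. G x \<partial>M)" .
  have "D = D / m * emeasure M (S q)"
    using m by (simp add: ennreal_divide_times ennreal_mult_divide_eq)
  also have "\<dots> \<le> D / m * (2 * emeasure M E)"
    by (intro mult_left_mono half) simp
  also have "\<dots> \<le> 2 * (\<integral>\<^sup>+x\<in>E. G x \<partial>M)"
    using mult_left_mono[OF le, of 2] by (simp add: mult_ac)
  finally show ?thesis by (simp add: E_def)
qed

text \<open>Sparseness turns a sum over nodes into one integral: each node is paid for by the
  integral of \<open>G\<close> over its part off the children, and these parts are disjoint pieces
  of \<open>S q\<close>.\<close>

lemma nn_integral_tree_sum_le: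
  assumes [measurable]: "\<And>N q. F N q \<in> borel_measurable M" "u \<in> borel_measurable M" "G \<in> borel_measurable M"
    and F: "\<And>N q x. x \<in> S q \<Longrightarrow> (\<integral>\<^sup>+y\<in>S q. F N q y * u y \<partial>M) \<le> emeasure M (S q) * G x"
  shows "(\<integral>\<^sup>+y. tree_sum F N q y * u y \<partial>M) \<le> 2 * (\<integral>\<^sup>+y\<in>S q. G y \<partial>M)"
proof (induction N arbitrary: q)
  case (Suc N)
  let ?E = "S q - (\<Union>i. S (kid q i))"
  have "(\<integral>\<^sup>+y. tree_sum F (Suc N) q y * u y \<partial>M)
      = (\<integral>\<^sup>+y. F (Suc N) q y * u y * indicator (S q) y + (\<Sum>i. tree_sum F N (kid q i) y * u y) \<partial>M)"
    by (intro nn_integral_cong) (simp add: distrib_right distrib_left mult_ac flip: ennreal_suminf_multc)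
  also have "\<dots> = (\<integral>\<^sup>+y\<in>S q. F (Suc N) q y * u y \<partial>M) + (\<Sum>i. \<integral>\<^sup>+y. tree_sum F N (kid q i) y * u y \<partial>M)"
    by (simp add: nn_integral_add nn_integral_suminf del: ennreal_suminf_multc)
  also have "\<dots> \<le> 2 * (\<integral>\<^sup>+y\<in>?E. G y \<partial>M) + (\<Sum>i. 2 * (\<integral>\<^sup>+y\<in>S (kid q i). G y \<partial>M))"
    by (intro add_mono suminf_le Suc sparse_average_le F) auto
  also have "\<dots> = 2 * (\<integral>\<^sup>+y\<in>S q. G y \<partial>M)"
    by (simp add: nn_integral_split[of G q] ennreal_suminf_cmult distrib_left)
  finally show ?case .
qed simp

text \<open>Summation along a chain: \<open>n^(j+1)\<close> is at most the sum of
  \<open>(j + 1) m^j\<close> over \<open>1 \<le> m \<le> n\<close>, since the count grows by one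
  from a node to its parent.\<close>

lemma cnt_power_le:
  "cnt N q x ^ Suc j \<le> tree_sum (\<lambda>N q x. of_nat (Suc j) * cnt N q x ^ j) N q x"
proof (induction N arbitrary: q)
  case (Suc N)
  let ?F = "\<lambda>N q x. of_nat (Suc j) * cnt N q x ^ j"
  consider "x \<notin> S q" | "x \<in> S q" "\<And>i. x \<notin> S (kid q i)" | i where "x \<in> S (kid q i)" by auto
  then show ?case
  proof cases
    case 1
    then show ?thesis unfolding tree_sum_outside[OF 1] by simp
  next
    case 2
    show ?thesis unfolding tree_sum_leaf[OF 2] by (simp add: order_trans[OF _ le_add_same_cancel1[THEN iffD2]])
  next
    case (3 i)
    show ?thesis
      unfolding tree_sum_kid[OF 3, of ?F]
      unfolding tree_sum_kid[OF 3, of "\<lambda>_ _ _. 1"]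
      by (rule order_trans[OF one_plus_power_le add_left_mono[OF Suc]])
  qed
qed simp

text \<open>
  This replaces the usual \<open>L (log L)\<^sup>k\<close> bump, which corresponds to the \<open>k\<close>-fold maximal function.
\<close>

lemma nn_integral_cnt_power_le:
  assumes [measurable]: "\<And>j. W j \<in> borel_measurable M"
    and W: "\<And>j q x. x \<in> S q \<Longrightarrow> (\<integral>\<^sup>+y\<in>S q. W j y \<partial>M) \<le> emeasure M (S q) * W (Suc j) x"
  shows "(\<integral>\<^sup>+y\<in>S q. cnt N q y ^ j * W 0 y \<partial>M) \<le> fact j * 2 ^ j * (\<integral>\<^sup>+y\<in>S q. W j y \<partial>M)"
proof (induction j arbitrary: N q)
  case (Suc j)
  let ?C = "of_nat (Suc j) * (fact j * 2 ^ j) :: ennreal"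
  have "(\<integral>\<^sup>+y\<in>S q. cnt N q y ^ Suc j * W 0 y \<partial>M)
      \<le> (\<integral>\<^sup>+y. tree_sum (\<lambda>N q x. of_nat (Suc j) * cnt N q x ^ j) N q y * W 0 y \<partial>M)"
    by (intro nn_integral_mono)
       (auto simp: indicator_def simp del: power_Suc of_nat_Suc intro!: mult_right_mono cnt_power_le)
  \<comment> \<open>One power of the count has been traded for a sum over nodes. Inside each node
    the induction hypothesis treats the other powers, and sparseness turns the sum into an integral;
    the price is a factor \<open>2 * Suc j\<close> and one more step in the sequence
    \<open>W\<close>.\<close>
  also have "\<dots> \<le> 2 * (\<integral>\<^sup>+y\<in>S q. ?C * W (Suc j) y \<partial>M)"
  proof (rule nn_integral_tree_sum_le)
    fix N q x assume x: "x \<in> S q"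
    have "(\<integral>\<^sup>+y\<in>S q. of_nat (Suc j) * cnt N q y ^ j * W 0 y \<partial>M)
        = of_nat (Suc j) * (\<integral>\<^sup>+y\<in>S q. cnt N q y ^ j * W 0 y \<partial>M)"
      by (subst nn_integral_cmult[symmetric]) (auto simp: mult_ac)
    also have "\<dots> \<le> of_nat (Suc j) * (fact j * 2 ^ j * (emeasure M (S q) * W (Suc j) x))"
      by (intro mult_left_mono order_trans[OF Suc] W x) auto
    finally show "(\<integral>\<^sup>+y\<in>S q. of_nat (Suc j) * cnt N q y ^ j * W 0 y \<partial>M) \<le> emeasure M (S q) * (?C * W (Suc j) x)"
      by (simp add: mult_ac)
  qed auto
  also have "\<dots> = 2 * (?C * (\<integral>\<^sup>+y\<in>S q. W (Suc j) y \<partial>M))"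
    by (subst nn_integral_cmult[symmetric]) (auto simp: mult_ac)
  also have "\<dots> = fact (Suc j) * 2 ^ Suc j * (\<integral>\<^sup>+y\<in>S q. W (Suc j) y \<partial>M)"
    by (simp add: mult_ac)
  finally show ?case .
qed simp

text \<open>Hoelder along the chain of nodes containing \<open>x\<close>, indexed by their counts.
  The finite count \<open>n\<close> is part of the induction claim because the constant grows with
  it; \<open>p - 1 < k\<close> makes the series of weights converge, which leaves a bound free of
  \<open>n\<close>.\<close>

lemma tree_sum_powr_le:
  assumes p: "1 < p" "p - 1 < real k"
  shows "ennreal_pow (tree_sum (\<lambda>_ q _. a q) N q x) p
    \<le> ennreal ((1 + (\<Sum>i. real i powr (-(real k / (p - 1))))) powr (p - 1))
      * tree_sum (\<lambda>N q x. ennreal_pow (a q) p * cnt N q x ^ k) N q x"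
proof -
  define \<theta> where "\<theta> = real k / (p - 1)"
  let ?A = "tree_sum (\<lambda>_ q _. a q)"
  let ?R = "tree_sum (\<lambda>N q x. ennreal_pow (a q) p * cnt N q x ^ k)"
  have "\<exists>n. cnt N q x = of_nat n \<and> ennreal_pow (?A N q x) p \<le> ennreal (powr_sum \<theta> n powr (p - 1)) * ?R N q x"
  proof (induction N arbitrary: q)
    case (Suc N)
    consider "x \<notin> S q" | "x \<in> S q" "\<And>i. x \<notin> S (kid q i)" | i where "x \<in> S (kid q i)" by auto
    then show ?case
    proof cases
      case 1
      show ?thesis unfolding tree_sum_outside[OF 1] by (auto intro: exI[of _ 0])
    next
      case 2
      \<comment> \<open>A chain of one node extends the empty chain, which has sum \<open>0\<close>
        and count \<open>0\<close>.\<close>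
      show ?thesis
        unfolding tree_sum_leaf[OF 2]
        using ennreal_pow_add_step[OF p(1) \<theta>_def, of 0 0 0 "a q"]
        by (intro exI[of _ 1]) simp
    next
      case (3 i)
      from Suc[of "kid q i"] obtain n where
        n: "cnt N (kid q i) x = of_nat n"
          "ennreal_pow (?A N (kid q i) x) p \<le> ennreal (powr_sum \<theta> n powr (p - 1)) * ?R N (kid q i) x"
        by blast
      have c: "cnt (Suc N) q x = of_nat (Suc n)"
        unfolding tree_sum_kid[OF 3] n(1) by simp
      show ?thesis
        using ennreal_pow_add_step[OF p(1) \<theta>_def n(2), of "a q"]
        unfolding tree_sum_kid[OF 3, of "\<lambda>_ q _. a q"] tree_sum_kid[OF 3, of "\<lambda>N q x. ennreal_pow (a q) p * cnt N q x ^ k"] c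
        by blast
    qed
  qed (auto intro: exI[of _ 0])
  then obtain n where n: "ennreal_pow (?A N q x) p \<le> ennreal (powr_sum \<theta> n powr (p - 1)) * ?R N q x"
    by blast
  have "powr_sum \<theta> n powr (p - 1) \<le> (1 + (\<Sum>i. real i powr (-\<theta>))) powr (p - 1)"
    using p powr_sum_ge_1[of \<theta> n] by (intro powr_mono2 powr_sum_le) (auto simp: \<theta>_def field_simps)
  then have "ennreal (powr_sum \<theta> n powr (p - 1)) * ?R N q x
      \<le> ennreal ((1 + (\<Sum>i. real i powr (-\<theta>))) powr (p - 1)) * ?R N q x"
    by (intro mult_right_mono ennreal_leI) auto
  with n show ?thesis unfolding \<theta>_def by (rule order_trans)
qed

text \<open>In its use \<open>W j\<close> is a multiple of the \<open>j\<close>-fold maximal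
  function of the weight and \<open>a\<close> is a multiple of the averages of \<open>f\<close>.
  Hoelder leaves the \<open>k\<close>-th power of the count in each node, the counting estimate
  moves it to \<open>W k\<close>, and the assumption on \<open>G\<close> puts the resulting terms
  into the form that sparseness can sum.\<close>

lemma nn_integral_tree_sum_powr_le:
  assumes p: "1 < p" "p - 1 < real k"
    and [measurable]: "\<And>j. W j \<in> borel_measurable M" "G \<in> borel_measurable M"
    and W: "\<And>j q x. x \<in> S q \<Longrightarrow> (\<integral>\<^sup>+y\<in>S q. W j y \<partial>M) \<le> emeasure M (S q) * W (Suc j) x"
    and G: "\<And>q x. x \<in> S q \<Longrightarrow> ennreal_pow (a q) p * (\<integral>\<^sup>+y\<in>S q. W k y \<partial>M) \<le> emeasure M (S q) * G x"
  shows "(\<integral>\<^sup>+y. ennreal_pow (tree_sum (\<lambda>_ q _. a q) N q y) p * W 0 y \<partial>M)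
    \<le> ennreal (sparse_const p k) * (\<integral>\<^sup>+y\<in>S q. G y \<partial>M)"
proof -
  let ?R = "tree_sum (\<lambda>N q x. ennreal_pow (a q) p * cnt N q x ^ k)"
  let ?C = "(1 + (\<Sum>i. real i powr (-(real k / (p - 1))))) powr (p - 1)"
  have "(\<integral>\<^sup>+y. ennreal_pow (tree_sum (\<lambda>_ q _. a q) N q y) p * W 0 y \<partial>M)
      \<le> (\<integral>\<^sup>+y. ennreal ?C * (?R N q y * W 0 y) \<partial>M)"
    unfolding mult.assoc[symmetric] by (intro nn_integral_mono mult_right_mono tree_sum_powr_le p) auto
  also have "\<dots> = ennreal ?C * (\<integral>\<^sup>+y. ?R N q y * W 0 y \<partial>M)"
    by (intro nn_integral_cmult) auto
  also have "(\<integral>\<^sup>+y. ?R N q y * W 0 y \<partial>M) \<le> 2 * (\<integral>\<^sup>+y\<in>S q. fact k * 2 ^ k * G y \<partial>M)"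
  proof (rule nn_integral_tree_sum_le)
    fix N q x assume x: "x \<in> S q"
    have "(\<integral>\<^sup>+y\<in>S q. ennreal_pow (a q) p * cnt N q y ^ k * W 0 y \<partial>M)
        = ennreal_pow (a q) p * (\<integral>\<^sup>+y\<in>S q. cnt N q y ^ k * W 0 y \<partial>M)"
      by (subst nn_integral_cmult[symmetric]) (auto simp: mult_ac)
    also have "\<dots> \<le> ennreal_pow (a q) p * (fact k * 2 ^ k * (\<integral>\<^sup>+y\<in>S q. W k y \<partial>M))"
      by (intro mult_left_mono nn_integral_cnt_power_le W) auto
    also have "\<dots> = fact k * 2 ^ k * (ennreal_pow (a q) p * (\<integral>\<^sup>+y\<in>S q. W k y \<partial>M))"
      by (simp add: mult_ac)
    also have "\<dots> \<le> fact k * 2 ^ k * (emeasure M (S q) * G x)"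
      by (intro mult_left_mono G x) auto
    finally show "(\<integral>\<^sup>+y\<in>S q. ennreal_pow (a q) p * cnt N q y ^ k * W 0 y \<partial>M)
        \<le> emeasure M (S q) * (fact k * 2 ^ k * G x)"
      by (simp add: mult_ac)
  qed auto
  also have "(\<integral>\<^sup>+y\<in>S q. fact k * 2 ^ k * G y \<partial>M) = fact k * 2 ^ k * (\<integral>\<^sup>+y\<in>S q. G y \<partial>M)"
    by (subst nn_integral_cmult[symmetric]) (auto simp: mult_ac)
  finally have "(\<integral>\<^sup>+y. ennreal_pow (tree_sum (\<lambda>_ q _. a q) N q y) p * W 0 y \<partial>M)
      \<le> ennreal ?C * (2 * (fact k * 2 ^ k * (\<integral>\<^sup>+y\<in>S q. G y \<partial>M)))"
    by (simp add: mult_left_mono)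
  moreover have "(fact k :: ennreal) = ennreal (fact k)"
    by (metis ennreal_of_nat_eq_real_of_nat of_nat_fact)
  ultimately show ?thesis
    by (simp add: sparse_const_def ennreal_mult mult_ac flip: ennreal_power)
qed

text \<open>When the inequality for children is unwound along a finite chain, each
  \<open>a q\<close> occurs at most once as parent and once as child, whence the factor
  \<open>2\<close>. The extra \<open>a q\<close> on the left is what closes the induction.\<close>

lemma tree_sum_dominates:
  assumes leaf: "\<And>q x. x \<in> S q \<Longrightarrow> (\<And>i. x \<notin> S (kid q i)) \<Longrightarrow> h q x \<le> a q"
    and kid: "\<And>q i x. x \<in> S (kid q i) \<Longrightarrow> h q x \<le> a q + a (kid q i) + h (kid q i) x"
  shows "x \<in> S q - layer N q \<Longrightarrow> h q x + a q \<le> 2 * tree_sum (\<lambda>_ q _. a q) N q x"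
proof (induction N arbitrary: q)
  case (Suc N)
  consider "\<And>i. x \<notin> S (kid q i)" | i where "x \<in> S (kid q i)" by auto
  then show ?case
  proof cases
    case 1
    with Suc have x: "x \<in> S q" by simp
    show ?thesis
      unfolding tree_sum_leaf[OF x 1] mult_2 by (intro add_mono leaf x 1) auto
  next
    case (2 i)
    with Suc.prems have "x \<in> S (kid q i) - layer N (kid q i)" by simp
    have "h q x + a q \<le> (a q + a (kid q i) + h (kid q i) x) + a q"
      by (intro add_right_mono kid 2)
    also have "\<dots> = 2 * a q + (h (kid q i) x + a (kid q i))"
      by (simp add: mult_2 add_ac)
    also have "\<dots> \<le> 2 * a q + 2 * tree_sum (\<lambda>_ q _. a q) N (kid q i) x"
      by (intro add_left_mono Suc.IH \<open>x \<in> S (kid q i) - layer N (kid q i)\<close>)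
    also have "\<dots> = 2 * tree_sum (\<lambda>_ q _. a q) (Suc N) q x"
      unfolding tree_sum_kid[OF 2] by (simp add: distrib_left)
    finally show ?thesis .
  qed
qed simp

text \<open>\<open>h\<close> need not be measurable, so it is replaced by a majorant
  \<open>g\<close>, the supremum of the powers of the truncated tree sums; these increase with the
  truncation, and monotone convergence applies. \<open>Z\<close> collects the points lying in all
  layers.\<close>

theorem dominated_integral_le:
  assumes p: "1 < p" "p - 1 < real k"
    and [measurable]: "\<And>j. W j \<in> borel_measurable M" "G \<in> borel_measurable M"
    and W: "\<And>j q x. x \<in> S q \<Longrightarrow> (\<integral>\<^sup>+y\<in>S q. W j y \<partial>M) \<le> emeasure M (S q) * W (Suc j) x"
    and G: "\<And>q x. x \<in> S q \<Longrightarrow> ennreal_pow (a q) p * (\<integral>\<^sup>+y\<in>S q. W k y \<partial>M) \<le> emeasure M (S q) * G x"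
    and leaf: "\<And>q x. x \<in> S q \<Longrightarrow> (\<And>i. x \<notin> S (kid q i)) \<Longrightarrow> h q x \<le> a q"
    and kid: "\<And>q i x. x \<in> S (kid q i) \<Longrightarrow> h q x \<le> a q + a (kid q i) + h (kid q i) x"
  obtains g Z where "g \<in> borel_measurable M" "Z \<in> null_sets M"
    "\<And>x. x \<in> S q - Z \<Longrightarrow> ennreal_pow (h q x) p \<le> g x"
    "(\<integral>\<^sup>+x. g x * W 0 x \<partial>M) \<le> ennreal (2 powr p * sparse_const p k) * (\<integral>\<^sup>+x\<in>S q. G x \<partial>M)"
proof
  let ?A = "\<lambda>N. tree_sum (\<lambda>_ q _. a q) N q"
  let ?g = "\<lambda>x. SUP N. ennreal (2 powr p) * ennreal_pow (?A N x) p"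
  show "?g \<in> borel_measurable M" by measurable
  show "(\<Inter>N. layer N q) \<in> null_sets M" by (rule null_layers)
  fix x assume "x \<in> S q - (\<Inter>N. layer N q)"
  then obtain N where "x \<in> S q - layer N q" by auto
  then have "h q x + a q \<le> 2 * ?A N x"
    by (intro tree_sum_dominates[where h = h] leaf kid)
  then have "h q x \<le> 2 * ?A N x" by (rule order_trans[rotated]) simp
  then have "ennreal_pow (h q x) p \<le> ennreal_pow (2 * ?A N x) p"
    using p by (intro ennreal_pow_mono) auto
  also have "\<dots> = ennreal (2 powr p) * ennreal_pow (?A N x) p"
    using p ennreal_pow_ennreal[of 2 p] by (simp add: ennreal_pow_mult)
  also have "\<dots> \<le> ?g x" by (intro SUP_upper) auto
  finally show "ennreal_pow (h q x) p \<le> ?g x" .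
next
  let ?A = "\<lambda>N. tree_sum (\<lambda>_ q _. a q) N q"
  have "(\<integral>\<^sup>+x. (SUP N. ennreal (2 powr p) * ennreal_pow (?A N x) p) * W 0 x \<partial>M)
      = (\<integral>\<^sup>+x. (SUP N. ennreal (2 powr p) * (ennreal_pow (?A N x) p * W 0 x)) \<partial>M)"
    by (simp add: SUP_mult_right_ennreal mult.assoc)
  also have "\<dots> = (SUP N. \<integral>\<^sup>+x. ennreal (2 powr p) * (ennreal_pow (?A N x) p * W 0 x) \<partial>M)"
    using p
    by (intro nn_integral_monotone_convergence_SUP incseq_SucI)
       (auto simp: le_fun_def simp del: tree_sum.simps intro!: mult_left_mono mult_right_mono ennreal_pow_mono tree_sum_mono_N)
  also have "\<dots> = (SUP N. ennreal (2 powr p) * (\<integral>\<^sup>+x. ennreal_pow (?A N x) p * W 0 x \<partial>M))"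
    by (simp add: nn_integral_cmult)
  also have "\<dots> \<le> ennreal (2 powr p) * (ennreal (sparse_const p k) * (\<integral>\<^sup>+x\<in>S q. G x \<partial>M))"
    by (intro SUP_least mult_left_mono nn_integral_tree_sum_powr_le p W G) auto
  finally show "(\<integral>\<^sup>+x. (SUP N. ennreal (2 powr p) * ennreal_pow (?A N x) p) * W 0 x \<partial>M)
      \<le> ennreal (2 powr p * sparse_const p k) * (\<integral>\<^sup>+x\<in>S q. G x \<partial>M)"
    by (simp add: ennreal_mult' mult.assoc)
qed

end

section \<open>The Hardy--Littlewood maximal operator\<close>

declare emeasure_completion [simp del]

lemma ball_in_sets_lebesgue [measurable, simp]: "ball z \<rho> \<in> sets lebesgue"
  by (simp add: sets_completionI_sets)

text \<open>The balls are open and uncentred, so a ball whose average exceeds \<open>t\<close> lies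
  entirely in the superlevel set. Measurability of \<open>maximal_op g\<close> rests on
  this.\<close>

lemma open_maximal_op_greater: "open {x. t < maximal_op g x}"
proof -
  let ?avg = "\<lambda>z \<rho>. (\<integral>\<^sup>+y\<in>ball z \<rho>. g y \<partial>lebesgue) / emeasure lebesgue (ball z \<rho>)"
  have "{x. t < maximal_op g x} = (\<Union>(z, \<rho>)\<in>{(z, \<rho>). 0 < \<rho> \<and> t < ?avg z \<rho>}. ball z \<rho>)"
    unfolding maximal_op_def by (auto simp: less_SUP_iff) blast+
  then show ?thesis by auto
qed

lemma borel_measurable_maximal_op [measurable]: "maximal_op g \<in> borel_measurable lebesgue"
  by (rule borel_measurableI_greater) (auto intro!: borel_open open_maximal_op_greater sets_completionI_sets)

lemma emeasure_lebesgue_ball_pos: "0 < \<rho> \<Longrightarrow> emeasure lebesgue (ball z \<rho>) \<noteq> 0"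
  using content_ball_pos[of \<rho> z] by (auto simp: measure_def emeasure_completion)

lemma emeasure_lebesgue_ball_finite: "emeasure lebesgue (ball z \<rho>) \<noteq> top"
  using emeasure_lborel_ball_finite[of z \<rho>] by (auto simp: emeasure_completion)

lemma nn_integral_ball_le_maximal_op:
  assumes "0 < \<rho>" "x \<in> ball z \<rho>"
  shows "(\<integral>\<^sup>+y\<in>ball z \<rho>. g y \<partial>lebesgue) \<le> emeasure lebesgue (ball z \<rho>) * maximal_op g x"
proof -
  have "(\<integral>\<^sup>+y\<in>ball z \<rho>. g y \<partial>lebesgue) / emeasure lebesgue (ball z \<rho>) \<le> maximal_op g x"
    unfolding maximal_op_def using assms by (intro SUP_upper2[of "(z, \<rho>)"]) auto
  then show ?thesis
    using assms by (simp add: ennreal_divide_le_iff emeasure_lebesgue_ball_pos emeasure_lebesgue_ball_finite mult.commute)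
qed

lemma maximal_op_leI:
  assumes "\<And>z \<rho>. 0 < \<rho> \<Longrightarrow> x \<in> ball z \<rho> \<Longrightarrow> (\<integral>\<^sup>+y\<in>ball z \<rho>. g y \<partial>lebesgue) \<le> c * emeasure lebesgue (ball z \<rho>)"
  shows "maximal_op g x \<le> c"
  unfolding maximal_op_def using assms
  by (intro SUP_least) (auto simp: ennreal_divide_le_iff emeasure_lebesgue_ball_pos emeasure_lebesgue_ball_finite)

text \<open>Vitali covering: there are disjoint balls with average above \<open>t\<close> whose
  fivefold dilates cover the superlevel set. The dilation costs \<open>5 ^ CARD('n)\<close>, and the
  integrals over the disjoint balls add up to at most the integral of \<open>g\<close>.\<close>

lemma maximal_op_weak_type:
  fixes g :: "real^'n \<Rightarrow> ennreal"
  assumes [measurable]: "g \<in> borel_measurable lebesgue" and t: "0 < t"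
  shows "ennreal t * emeasure lebesgue {x. ennreal t < maximal_op g x} \<le> 5 ^ CARD('n) * (\<integral>\<^sup>+x. g x \<partial>lebesgue)"
proof (cases "(\<integral>\<^sup>+x. g x \<partial>lebesgue) = top")
  case False
  then obtain J where J: "(\<integral>\<^sup>+x. g x \<partial>lebesgue) = ennreal J" "0 \<le> J"
    by (cases "\<integral>\<^sup>+x. g x \<partial>lebesgue") auto
  let ?m = "\<lambda>z \<rho>. emeasure lebesgue (ball z \<rho> :: (real^'n) set)"
  define u where "u = measure lebesgue (ball (0::real^'n) 1)"
  have u: "0 < u" "?m 0 1 = ennreal u"
    unfolding u_def using content_ball_pos[of 1 "0::real^'n"] emeasure_lebesgue_ball_finite[of "0::real^'n" 1]
    by (auto simp: emeasure_eq_ennreal_measure)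
  have m: "?m z \<rho> = ennreal (\<rho> ^ CARD('n) * u)" if "0 \<le> \<rho>" for z \<rho>
    using emeasure_lebesgue_ball_conv_unit_ball[OF that, of z] that u by (simp add: ennreal_mult)
  define K where "K = {(z::real^'n, \<rho>). 0 < \<rho> \<and> ennreal t * ?m z \<rho> < (\<integral>\<^sup>+y\<in>ball z \<rho>. g y \<partial>lebesgue)}"
  have "{x. ennreal t < maximal_op g x} \<subseteq> (\<Union>i\<in>K. ball (fst i) (snd i))"
  proof
    fix x assume "x \<in> {x. ennreal t < maximal_op g x}"
    then obtain z \<rho> where "0 < \<rho>" "x \<in> ball z \<rho>" "\<not> (\<integral>\<^sup>+y\<in>ball z \<rho>. g y \<partial>lebesgue) / ?m z \<rho> \<le> ennreal t"
      unfolding maximal_op_def by (auto simp: less_SUP_iff not_le)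
    then show "x \<in> (\<Union>i\<in>K. ball (fst i) (snd i))"
      unfolding K_def
      by (intro UN_I[of "(z, \<rho>)"]) (auto simp: ennreal_divide_le_iff emeasure_lebesgue_ball_pos emeasure_lebesgue_ball_finite not_le)
  qed
  \<comment> \<open>The covering lemma needs bounded radii. The volume of a ball in \<open>K\<close>
    is below \<open>J / t\<close>, which bounds \<open>\<rho> ^ CARD('n)\<close>; the
    \<open>1\<close> takes care of \<open>\<rho> < 1\<close>, where \<open>\<rho>\<close> may exceed
    its power.\<close>
  moreover have "0 < snd i \<and> snd i \<le> max 1 (J / (t * u))" if "i \<in> K" for i
  proof -
    obtain z \<rho> where i: "i = (z, \<rho>)" by force
    with that have \<rho>: "0 < \<rho>" "ennreal t * ?m z \<rho> < (\<integral>\<^sup>+y\<in>ball z \<rho>. g y \<partial>lebesgue)" by (auto simp: K_def)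
    note \<rho>(2)
    also have "(\<integral>\<^sup>+y\<in>ball z \<rho>. g y \<partial>lebesgue) \<le> ennreal J"
      unfolding J(1)[symmetric] by (intro nn_integral_mono) (auto simp: indicator_def)
    finally have "t * (\<rho> ^ CARD('n) * u) < J"
      using \<rho> t u J by (simp add: m ennreal_less_iff flip: ennreal_mult)
    then have *: "\<rho> ^ CARD('n) < J / (t * u)" using t u by (simp add: field_simps)
    have "\<rho> \<le> max 1 (J / (t * u))"
    proof (cases "1 \<le> \<rho>")
      case True
      then have "\<rho> ^ 1 \<le> \<rho> ^ CARD('n)" by (intro power_increasing) (auto simp: Suc_le_eq)
      with * show ?thesis by simp
    qed auto
    with \<rho> i show ?thesis by simp
  qed
  ultimately obtain C where C: "countable C" "C \<subseteq> K"
     "pairwise (\<lambda>i j. disjnt (ball (fst i) (snd i)) (ball (fst j) (snd j))) C"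
     "{x. ennreal t < maximal_op g x} \<subseteq> (\<Union>i\<in>C. ball (fst i) (5 * snd i))"
    by (rule Vitali_covering_lemma_balls)
  have "ennreal t * emeasure lebesgue {x. ennreal t < maximal_op g x}
      \<le> ennreal t * emeasure lebesgue (\<Union>i\<in>C. ball (fst i) (5 * snd i))"
    using C(1,4) by (intro mult_left_mono emeasure_mono) auto
  also have "\<dots> \<le> ennreal t * (\<integral>\<^sup>+i. ?m (fst i) (5 * snd i) \<partial>count_space C)"
  proof (rule mult_left_mono)
    have "emeasure lebesgue (\<Union>i\<in>C. ball (fst i) (5 * snd i))
        = (\<integral>\<^sup>+x. indicator (\<Union>i\<in>C. ball (fst i) (5 * snd i)) x \<partial>lebesgue)"
      using C(1) by (intro nn_integral_indicator[symmetric]) auto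
    also have "\<dots> \<le> (\<integral>\<^sup>+x. \<integral>\<^sup>+i. indicator (ball (fst i) (5 * snd i)) x \<partial>count_space C \<partial>lebesgue)"
    proof (rule nn_integral_mono)
      fix x :: "real^'n"
      show "indicator (\<Union>i\<in>C. ball (fst i) (5 * snd i)) x
          \<le> (\<integral>\<^sup>+i. indicator (ball (fst i) (5 * snd i)) x \<partial>count_space C)"
      proof (cases "x \<in> (\<Union>i\<in>C. ball (fst i) (5 * snd i))")
        case True
        then obtain i where "i \<in> C" "x \<in> ball (fst i) (5 * snd i)" by blast
        with True show ?thesis
          using nn_integral_ge_point[of i C "\<lambda>i. indicator (ball (fst i) (5 * snd i)) x"] by simp
      qed simp
    qed
    also have "\<dots> = (\<integral>\<^sup>+i. \<integral>\<^sup>+x. indicator (ball (fst i) (5 * snd i)) x \<partial>lebesgue \<partial>count_space C)"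
      using C(1) by (rule nn_integral_count_space_nn_integral) auto
    finally show "emeasure lebesgue (\<Union>i\<in>C. ball (fst i) (5 * snd i)) \<le> (\<integral>\<^sup>+i. ?m (fst i) (5 * snd i) \<partial>count_space C)"
      by simp
  qed simp
  also have "\<dots> = (\<integral>\<^sup>+i. ennreal t * ?m (fst i) (5 * snd i) \<partial>count_space C)"
    by (simp add: nn_integral_cmult)
  also have "\<dots> \<le> (\<integral>\<^sup>+i. 5 ^ CARD('n) * (\<integral>\<^sup>+y\<in>ball (fst i) (snd i). g y \<partial>lebesgue) \<partial>count_space C)"
  proof (intro nn_integral_mono)
    fix i assume "i \<in> space (count_space C)"
    with C have i: "0 < snd i" "ennreal t * ?m (fst i) (snd i) \<le> (\<integral>\<^sup>+y\<in>ball (fst i) (snd i). g y \<partial>lebesgue)"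
      by (auto simp: K_def less_imp_le)
    have "ennreal t * ?m (fst i) (5 * snd i) = 5 ^ CARD('n) * (ennreal t * ?m (fst i) (snd i))"
      using i t u by (simp add: m power_mult_distrib ennreal_mult mult_ac flip: ennreal_power)
    also have "\<dots> \<le> 5 ^ CARD('n) * (\<integral>\<^sup>+y\<in>ball (fst i) (snd i). g y \<partial>lebesgue)"
      using i by (intro mult_left_mono) auto
    finally show "ennreal t * ?m (fst i) (5 * snd i) \<le> 5 ^ CARD('n) * (\<integral>\<^sup>+y\<in>ball (fst i) (snd i). g y \<partial>lebesgue)" .
  qed
  also have "\<dots> = 5 ^ CARD('n) * (\<integral>\<^sup>+i. (\<integral>\<^sup>+y\<in>ball (fst i) (snd i). g y \<partial>lebesgue) \<partial>count_space C)"
    by (simp add: nn_integral_cmult)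
  \<comment> \<open>Summing the integrals over disjoint balls becomes countable additivity of the
    measure with density \<open>g\<close>.\<close>
  also have "(\<integral>\<^sup>+i. (\<integral>\<^sup>+y\<in>ball (fst i) (snd i). g y \<partial>lebesgue) \<partial>count_space C)
      = (\<integral>\<^sup>+i. emeasure (density lebesgue g) (ball (fst i) (snd i)) \<partial>count_space C)"
    by (intro nn_integral_cong) (simp add: emeasure_density)
  also have "\<dots> = emeasure (density lebesgue g) (\<Union>i\<in>C. ball (fst i) (snd i))"
    using C by (intro emeasure_UN_countable[symmetric])
      (auto simp: pairwise_def disjnt_def disjoint_family_on_def)
  also have "\<dots> \<le> emeasure (density lebesgue g) (space (density lebesgue g))"
    by (rule emeasure_space)
  also have "\<dots> = (\<integral>\<^sup>+x. g x \<partial>lebesgue)"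
    by (simp add: emeasure_density)
  finally show ?thesis by (simp add: mult_left_mono)
qed (simp add: ennreal_mult_top)

section \<open>From weak type to strong type bounds\<close>

interpretation lebesgue: sigma_finite_measure lebesgue
proof
  obtain A :: "'a set set" where A: "countable A" "A \<subseteq> sets lborel" "\<Union> A = space lborel"
    "\<forall>a\<in>A. emeasure lborel a \<noteq> \<infinity>"
    using lborel.sigma_finite_countable by blast
  have "A \<subseteq> sets lebesgue" using A(2) sets_completionI_sets by blast
  moreover have "\<forall>a\<in>A. emeasure lebesgue a \<noteq> \<infinity>" using A by (auto simp: emeasure_completion)
  ultimately show "\<exists>A. countable A \<and> A \<subseteq> sets lebesgue \<and> \<Union> A = space lebesgue
      \<and> (\<forall>a\<in>A. emeasure (lebesgue :: 'a measure) a \<noteq> \<infinity>)"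
    using A by (intro exI[of _ A]) auto
qed

text \<open>The part of \<open>g\<close> at height at most \<open>t / 2\<close> contributes at most
  \<open>t / 2\<close> to the maximal function, so only the part above \<open>t / 2\<close> can lift
  it beyond \<open>t\<close>. The weak type bound at height \<open>t / 2\<close> applies to that
  part.\<close>

lemma maximal_op_truncated:
  fixes g :: "real^'n \<Rightarrow> ennreal"
  assumes [measurable]: "g \<in> borel_measurable lebesgue" and t: "0 < t"
  shows "ennreal t * emeasure lebesgue {x. ennreal t < maximal_op g x}
    \<le> 2 * 5 ^ CARD('n) * (\<integral>\<^sup>+x. g x * (if ennreal t < 2 * g x then 1 else 0) \<partial>lebesgue)"
proof -
  define g1 where "g1 = (\<lambda>x. g x * (if ennreal t < 2 * g x then 1 else 0))"
  have [measurable]: "g1 \<in> borel_measurable lebesgue" unfolding g1_def by measurable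
  have half: "ennreal (t/2) + ennreal (t/2) = ennreal t" using t by (simp flip: ennreal_plus)
  have le: "maximal_op g x \<le> maximal_op g1 x + ennreal (t / 2)" for x
  proof (rule maximal_op_leI)
    fix z \<rho> assume z: "0 < \<rho>" "x \<in> ball z \<rho>"
    have "(\<integral>\<^sup>+y\<in>ball z \<rho>. g y \<partial>lebesgue) \<le> (\<integral>\<^sup>+y. g1 y * indicator (ball z \<rho>) y + ennreal (t/2) * indicator (ball z \<rho>) y \<partial>lebesgue)"
    proof (intro nn_integral_mono)
      fix y
      have "g y \<le> ennreal (t / 2)" if "\<not> ennreal t < 2 * g y"
        using that t by (cases "g y") (auto simp: not_less ennreal_mult_top simp flip: ennreal_numeral ennreal_mult)
      then show "g y * indicator (ball z \<rho>) y \<le> g1 y * indicator (ball z \<rho>) y + ennreal (t/2) * indicator (ball z \<rho>) y"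
        by (auto simp: g1_def indicator_def)
    qed
    also have "\<dots> = (\<integral>\<^sup>+y\<in>ball z \<rho>. g1 y \<partial>lebesgue) + ennreal (t/2) * emeasure lebesgue (ball z \<rho>)"
      by (subst nn_integral_add) (auto simp: nn_integral_cmult)
    also have "\<dots> \<le> (maximal_op g1 x + ennreal (t/2)) * emeasure lebesgue (ball z \<rho>)"
      using nn_integral_ball_le_maximal_op[OF z, of g1] by (simp add: distrib_right distrib_left mult.commute add_right_mono)
    finally show "(\<integral>\<^sup>+y\<in>ball z \<rho>. g y \<partial>lebesgue) \<le> (maximal_op g1 x + ennreal (t/2)) * emeasure lebesgue (ball z \<rho>)" .
  qed
  have "{x. ennreal t < maximal_op g x} \<subseteq> {x. ennreal (t/2) < maximal_op g1 x}"
  proof safe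
    fix x assume "ennreal t < maximal_op g x"
    with le[of x] have "ennreal (t/2) + ennreal (t/2) < maximal_op g1 x + ennreal (t/2)"
      unfolding half by (rule less_le_trans[rotated])
    then show "ennreal (t/2) < maximal_op g1 x"
      by (meson add_right_mono leD leI)
  qed
  then have "emeasure lebesgue {x. ennreal t < maximal_op g x} \<le> emeasure lebesgue {x. ennreal (t/2) < maximal_op g1 x}"
    by (intro emeasure_mono) (auto intro!: borel_open open_maximal_op_greater sets_completionI_sets)
  then have "ennreal t * emeasure lebesgue {x. ennreal t < maximal_op g x}
      \<le> 2 * (ennreal (t/2) * emeasure lebesgue {x. ennreal (t/2) < maximal_op g1 x})"
    unfolding mult.assoc[symmetric] using t
    by (intro mult_mono) (auto simp flip: ennreal_numeral ennreal_mult)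
  also have "\<dots> \<le> 2 * (5 ^ CARD('n) * (\<integral>\<^sup>+x. g1 x \<partial>lebesgue))"
    using t by (intro mult_left_mono maximal_op_weak_type) auto
  finally show ?thesis by (simp add: g1_def mult.assoc)
qed

lemma nn_integral_powr_Ioo:
  assumes "-1 < a" "0 \<le> b"
  shows "(\<integral>\<^sup>+t. ennreal (t powr a) * (if 0 < t \<and> t < b then 1 else 0) \<partial>lborel) = ennreal (b powr (a + 1) / (a + 1))"
proof -
  have "(\<integral>\<^sup>+t. ennreal (t powr a) * (if 0 < t \<and> t < b then 1 else 0) \<partial>lborel)
      = (\<integral>\<^sup>+t. ennreal (t powr a) * indicator {0..b} t \<partial>lborel)"
    using AE_lborel_singleton[of 0] AE_lborel_singleton[of b]
    by (intro nn_integral_cong_AE) (auto simp: indicator_def elim: eventually_elim2)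
  also have "\<dots> = ennreal (b powr (a + 1) / (a + 1))"
    using assms by (intro nn_integral_has_integral_lebesgue' has_integral_powr_from_0) auto
  finally show ?thesis .
qed

lemma ennreal_pow_layer_cake:
  assumes q: "1 \<le> q"
  shows "ennreal_pow X q \<le> (\<integral>\<^sup>+t. ennreal (q * t powr (q - 1)) * (if 0 < t \<and> ennreal t < X then 1 else 0) \<partial>lborel)"
    (is "_ \<le> ?I X")
proof -
  have fin: "?I (ennreal b) = ennreal (b powr q)" if "0 \<le> b" for b
  proof -
    have "?I (ennreal b) = (\<integral>\<^sup>+t. ennreal q * (ennreal (t powr (q - 1)) * (if 0 < t \<and> t < b then 1 else 0)) \<partial>lborel)"
      using q by (intro nn_integral_cong) (auto simp: ennreal_mult ennreal_less_iff)
    also have "\<dots> = ennreal q * ennreal (b powr (q - 1 + 1) / (q - 1 + 1))"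
      using q that by (subst nn_integral_cmult) (auto simp: nn_integral_powr_Ioo)
    also have "\<dots> = ennreal (b powr q)" using q by (simp flip: ennreal_mult)
    finally show ?thesis .
  qed
  show ?thesis
  proof (cases X)
    case (real b)
    then show ?thesis using fin by (simp add: ennreal_pow_ennreal)
  next
    case top
    \<comment> \<open>For infinite \<open>X\<close> the integral dominates \<open>n powr q\<close>,
      which is at least \<open>n\<close>, for every \<open>n \<ge> 1\<close>.\<close>
    have "of_nat n \<le> ?I X" for n
    proof (cases "n = 0")
      case False
      have "real n powr 1 \<le> real n powr q" using q False by (intro powr_mono) auto
      then have "of_nat n \<le> ennreal (real n powr q)"
        by (simp add: ennreal_of_nat_eq_real_of_nat ennreal_leI)
      also have "\<dots> = ?I (ennreal (real n))" by (simp add: fin)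
      also have "\<dots> \<le> ?I X" using top by (intro nn_integral_mono mult_left_mono) auto
      finally show ?thesis .
    qed simp
    then have "?I X = top" by (meson ennreal_Ex_less_of_nat leD less_top)
    then show ?thesis by simp
  qed
qed

text \<open>Marcinkiewicz interpolation: layer cake formula, truncated weak type bound at each
  height \<open>t\<close>, Fubini. The inner integral of \<open>t powr (q - 2)\<close> up to
  \<open>2 * g x\<close> converges because \<open>q > 1\<close>; it produces the factor
  \<open>2 powr (q - 1) / (q - 1)\<close>.\<close>

lemma maximal_op_strong_type:
  fixes g :: "real^'n \<Rightarrow> ennreal"
  assumes q: "1 < q" and [measurable]: "g \<in> borel_measurable lebesgue"
  shows "(\<integral>\<^sup>+x. ennreal_pow (maximal_op g x) q \<partial>lebesgue)
    \<le> ennreal (2 * 5 ^ CARD('n) * (q / (q - 1) * 2 powr (q - 1))) * (\<integral>\<^sup>+x. ennreal_pow (g x) q \<partial>lebesgue)"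
proof -
  interpret pair_sigma_finite lborel lebesgue ..
  let ?k = "\<lambda>t. ennreal (q * t powr (q - 1))"
  let ?l = "\<lambda>t. ennreal (q * t powr (q - 2))"
  have [measurable]: "(\<lambda>p. maximal_op g (snd p)) \<in> borel_measurable (lborel \<Otimes>\<^sub>M lebesgue)"
    by measurable
  have [measurable]: "(\<lambda>p. g (snd p)) \<in> borel_measurable (lborel \<Otimes>\<^sub>M lebesgue)"
    by measurable
  have "(\<integral>\<^sup>+x. ennreal_pow (maximal_op g x) q \<partial>lebesgue)
      \<le> (\<integral>\<^sup>+x. \<integral>\<^sup>+t. ?k t * (if 0 < t \<and> ennreal t < maximal_op g x then 1 else 0) \<partial>lborel \<partial>lebesgue)"
    using q by (intro nn_integral_mono) (rule ennreal_pow_layer_cake, simp)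
  also have "\<dots> = (\<integral>\<^sup>+t. \<integral>\<^sup>+x. ?k t * (if 0 < t \<and> ennreal t < maximal_op g x then 1 else 0) \<partial>lebesgue \<partial>lborel)"
    by (rule Fubini') measurable
  also have "\<dots> \<le> (\<integral>\<^sup>+t. \<integral>\<^sup>+x. 2 * 5 ^ CARD('n) * ?l t * (g x * (if 0 < t \<and> ennreal t < 2 * g x then 1 else 0)) \<partial>lebesgue \<partial>lborel)"
  proof (rule nn_integral_mono)
    fix t :: real
    show "(\<integral>\<^sup>+x. ?k t * (if 0 < t \<and> ennreal t < maximal_op g x then 1 else 0) \<partial>lebesgue)
       \<le> (\<integral>\<^sup>+x. 2 * 5 ^ CARD('n) * ?l t * (g x * (if 0 < t \<and> ennreal t < 2 * g x then 1 else 0)) \<partial>lebesgue)"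
    proof (cases "0 < t")
      case True
      have kl: "?k t = ?l t * ennreal t"
        using True q by (simp add: powr_diff power2_eq_square flip: ennreal_mult)
      have "(\<integral>\<^sup>+x. ?k t * (if 0 < t \<and> ennreal t < maximal_op g x then 1 else 0) \<partial>lebesgue)
          = (\<integral>\<^sup>+x. ?k t * indicator {x. ennreal t < maximal_op g x} x \<partial>lebesgue)"
        using True by (intro nn_integral_cong) (auto simp: indicator_def)
      also have "\<dots> = ?l t * (ennreal t * emeasure lebesgue {x. ennreal t < maximal_op g x})"
        by (subst nn_integral_cmult_indicator)
           (auto simp: kl mult.assoc intro!: borel_open open_maximal_op_greater sets_completionI_sets)
      also have "\<dots> \<le> ?l t * (2 * 5 ^ CARD('n) * (\<integral>\<^sup>+x. g x * (if ennreal t < 2 * g x then 1 else 0) \<partial>lebesgue))"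
        using True by (intro mult_left_mono maximal_op_truncated) auto
      also have "\<dots> = (\<integral>\<^sup>+x. 2 * 5 ^ CARD('n) * ?l t * (g x * (if 0 < t \<and> ennreal t < 2 * g x then 1 else 0)) \<partial>lebesgue)"
        using True by (subst nn_integral_cmult) (auto simp: mult_ac)
      finally show ?thesis .
    qed simp
  qed
  also have "\<dots> = (\<integral>\<^sup>+x. \<integral>\<^sup>+t. 2 * 5 ^ CARD('n) * ?l t * (g x * (if 0 < t \<and> ennreal t < 2 * g x then 1 else 0)) \<partial>lborel \<partial>lebesgue)"
    by (rule Fubini'[symmetric]) measurable
  also have "\<dots> \<le> (\<integral>\<^sup>+x. ennreal (2 * 5 ^ CARD('n) * (q / (q - 1) * 2 powr (q - 1))) * ennreal_pow (g x) q \<partial>lebesgue)"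
  proof (rule nn_integral_mono)
    fix x
    show "(\<integral>\<^sup>+t. 2 * 5 ^ CARD('n) * ?l t * (g x * (if 0 < t \<and> ennreal t < 2 * g x then 1 else 0)) \<partial>lborel)
        \<le> ennreal (2 * 5 ^ CARD('n) * (q / (q - 1) * 2 powr (q - 1))) * ennreal_pow (g x) q"
    proof (cases "g x")
      case (real b)
      have "(\<integral>\<^sup>+t. 2 * 5 ^ CARD('n) * ?l t * (g x * (if 0 < t \<and> ennreal t < 2 * g x then 1 else 0)) \<partial>lborel)
          = (\<integral>\<^sup>+t. ennreal (2 * 5 ^ CARD('n) * q * b) * (ennreal (t powr (q - 2)) * (if 0 < t \<and> t < 2 * b then 1 else 0)) \<partial>lborel)"
      proof (intro nn_integral_cong)
        fix t :: real
        have "2 * g x = ennreal (2 * b)" using real by (simp add: ennreal_mult)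
        then have "ennreal t < 2 * g x \<longleftrightarrow> t < 2 * b" if "0 < t"
          using that by (simp add: ennreal_less_iff)
        moreover have "2 * 5 ^ CARD('n) * ?l t * ennreal b
            = ennreal (2 * 5 ^ CARD('n) * q * b) * ennreal (t powr (q - 2))"
          using q real by (simp add: ennreal_mult mult_ac flip: ennreal_power)
        ultimately show "2 * 5 ^ CARD('n) * ?l t * (g x * (if 0 < t \<and> ennreal t < 2 * g x then 1 else 0))
            = ennreal (2 * 5 ^ CARD('n) * q * b) * (ennreal (t powr (q - 2)) * (if 0 < t \<and> t < 2 * b then 1 else 0))"
          using real by (cases "0 < t \<and> t < 2 * b") auto
      qed
      also have "\<dots> = ennreal (2 * 5 ^ CARD('n) * q * b)
          * (\<integral>\<^sup>+t. ennreal (t powr (q - 2)) * (if 0 < t \<and> t < 2 * b then 1 else 0) \<partial>lborel)"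
        by (rule nn_integral_cmult) measurable
      also have "\<dots> = ennreal (2 * 5 ^ CARD('n) * q * b) * ennreal ((2 * b) powr (q - 2 + 1) / (q - 2 + 1))"
        using q real by (subst nn_integral_powr_Ioo) auto
      also have "\<dots> = ennreal (2 * 5 ^ CARD('n) * q * b * ((2 * b) powr (q - 2 + 1) / (q - 2 + 1)))"
        using q real by (intro ennreal_mult[symmetric]) auto
      also have "2 * 5 ^ CARD('n) * q * b * ((2 * b) powr (q - 2 + 1) / (q - 2 + 1))
          = 2 * 5 ^ CARD('n) * (q / (q - 1) * 2 powr (q - 1)) * (b * b powr (q - 1))"
        using q real by (simp add: powr_mult)
      also have "b * b powr (q - 1) = b powr q"
        using real q by (cases "b = 0") (auto simp: powr_diff)
      finally show ?thesis using real q by (simp add: ennreal_pow_ennreal flip: ennreal_mult)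
    next
      case top
      then show ?thesis using q by (simp add: ennreal_mult_top)
    qed
  qed
  also have "\<dots> = ennreal (2 * 5 ^ CARD('n) * (q / (q - 1) * 2 powr (q - 1))) * (\<integral>\<^sup>+x. ennreal_pow (g x) q \<partial>lebesgue)"
    by (intro nn_integral_cmult) measurable
  finally show ?thesis .
qed

section \<open>The Calderon--Zygmund selection of cubes\<close>

text \<open>A cube is given by its corner and side. Side \<open>0\<close> gives the empty set, which pads families of children.\<close>

definition cube :: "(real^'n) \<times> real \<Rightarrow> (real^'n) set" where
  "cube q = {x. \<forall>i. fst q $ i \<le> x $ i \<and> x $ i < fst q $ i + snd q}"

lemma cube_empty: "snd q \<le> 0 \<Longrightarrow> cube q = {}"
  by (fastforce simp: cube_def)

lemma corner_in_cube: "0 < snd q \<Longrightarrow> fst q \<in> cube q"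
  by (simp add: cube_def)

lemma cube_sets_borel: "cube q \<in> sets borel"
proof -
  have "cube q = (\<Inter>i. {x. fst q $ i \<le> x $ i} \<inter> {x. x $ i < fst q $ i + snd q})"
    by (auto simp: cube_def)
  moreover have "closed {x. fst q $ i \<le> x $ i}" "open {x. x $ i < fst q $ i + snd q}" for i
    by (auto intro!: closed_Collect_le open_Collect_less continuous_intros)
  ultimately show ?thesis by auto
qed

lemma cube_sets_lebesgue [measurable, simp]: "cube q \<in> sets lebesgue"
  by (intro sets_completionI_sets) (simp add: cube_sets_borel)

lemma emeasure_cube:
  fixes q :: "(real^'n) \<times> real"
  assumes "0 \<le> snd q"
  shows "emeasure lebesgue (cube q) = ennreal (snd q ^ CARD('n))"
proof -
  define d where "d = fst q + (\<chi> i. snd q)"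
  have le: "fst q \<bullet> b \<le> d \<bullet> b" "(d - fst q) \<bullet> b = snd q" if "b \<in> Basis" for b
    using that assms by (auto simp: d_def Basis_vec_def inner_axis inner_add_left)
  have "emeasure lborel (box (fst q) d) = ennreal (\<Prod>b\<in>Basis. (d - fst q) \<bullet> b)"
    using le by (intro emeasure_lborel_box) auto
  also have "(\<Prod>b\<in>Basis. (d - fst q) \<bullet> b) = snd q ^ CARD('n)"
    using le by simp
  finally have b: "emeasure lborel (box (fst q) d) = ennreal (snd q ^ CARD('n))" .
  have "emeasure lborel (cbox (fst q) d) = ennreal (\<Prod>b\<in>Basis. (d - fst q) \<bullet> b)"
    using le by (intro emeasure_lborel_cbox) auto
  also have "(\<Prod>b\<in>Basis. (d - fst q) \<bullet> b) = snd q ^ CARD('n)"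
    using le by simp
  finally have cb: "emeasure lborel (cbox (fst q) d) = ennreal (snd q ^ CARD('n))" .
  have "box (fst q) d \<subseteq> cube q" "cube q \<subseteq> cbox (fst q) d"
    by (auto simp: cube_def d_def mem_box_cart less_imp_le)
  then have "emeasure lborel (cube q) = ennreal (snd q ^ CARD('n))"
    using b cb cube_sets_borel[of q]
      emeasure_mono[of "box (fst q) d" "cube q" lborel] emeasure_mono[of "cube q" "cbox (fst q) d" lborel]
    by auto
  then show ?thesis using cube_sets_borel[of q] by (simp add: emeasure_completion)
qed

lemma emeasure_cube_finite: "emeasure lebesgue (cube q) < top"
  using emeasure_cube[of q] cube_empty[of q] by (cases "0 \<le> snd q") auto

text \<open>Comparison with the \<open>l1\<close> norm yields the dimension as diameter constant;
  the radius of \<open>sball\<close> below is scaled to it.\<close>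

lemma cube_norm_diff_le:
  fixes x y :: "real^'n" and q :: "(real^'n) \<times> real"
  assumes "x \<in> cube q" "y \<in> cube q"
  shows "norm (x - y) < CARD('n) * snd q"
proof -
  have "norm (x - y) \<le> (\<Sum>i\<in>UNIV. \<bar>(x - y) $ i\<bar>)" by (rule norm_le_l1_cart)
  also have "(\<Sum>i\<in>UNIV. \<bar>(x - y) $ i\<bar>) < (\<Sum>i\<in>(UNIV::'n set). (snd q :: real))"
  proof (rule sum_strict_mono)
    fix i :: 'n
    show "\<bar>(x - y) $ i\<bar> < snd q" using assms by (simp add: cube_def abs_less_iff) (smt (verit))
  qed auto
  finally show ?thesis by simp
qed

text \<open>Integer coordinates of the dyadic cell of generation \<open>m\<close> containing
  \<open>x\<close>, in the grid generated by \<open>q\<close>. Nestedness and disjointness of dyadic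
  cubes thus become statements about equality of integer vectors.\<close>

definition idx :: "(real^'n) \<times> real \<Rightarrow> nat \<Rightarrow> real^'n \<Rightarrow> 'n \<Rightarrow> int" where
  "idx q m x = (\<lambda>i. \<lfloor>2 ^ m * ((x $ i - fst q $ i) / snd q)\<rfloor>)"

definition cell :: "(real^'n) \<times> real \<Rightarrow> nat \<Rightarrow> ('n \<Rightarrow> int) \<Rightarrow> (real^'n) \<times> real" where
  "cell q m k = (fst q + (\<chi> i. snd q / 2 ^ m * of_int (k i)), snd q / 2 ^ m)"

lemma mem_cell_iff: "0 < snd q \<Longrightarrow> x \<in> cube (cell q m k) \<longleftrightarrow> idx q m x = k"
  unfolding cube_def idx_def cell_def fun_eq_iff mem_Collect_eq
  by (intro all_cong1) (simp add: floor_eq_iff field_simps)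

lemma idx_Suc_eq: "idx q (Suc m) x = idx q (Suc m) y \<Longrightarrow> idx q m x = idx q m y"
proof -
  have *: "idx q m z i = idx q (Suc m) z i div 2" for z i
    using floor_divide_real_eq_div[of 2 "2 ^ Suc m * ((z $ i - fst q $ i) / snd q)"]
    by (simp add: idx_def)
  show "idx q (Suc m) x = idx q (Suc m) y \<Longrightarrow> idx q m x = idx q m y"
    by (rule ext) (simp add: *)
qed

lemma idx_eq_mono: "l \<le> m \<Longrightarrow> idx q m x = idx q m y \<Longrightarrow> idx q l x = idx q l y"
  by (induction m rule: dec_induct) (auto dest: idx_Suc_eq)

lemma cell_0: "cell q 0 (\<lambda>_. 0) = q"
  by (simp add: cell_def prod_eq_iff vec_eq_iff)

text \<open>A stopping time on the density of \<open>U\<close>: a cell is bad if \<open>U\<close>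
  fills more than \<open>2^(-n-1)\<close> of it, with \<open>n\<close> the dimension. The root is
  not bad by \<open>small\<close>. A point of \<open>U\<close> stops at its first bad cell, whose
  parent is not bad, so that \<open>U\<close> fills at most half of the stopped cell. Badness bounds
  the total volume of the stopped cells by \<open>2^(n+1)\<close> times that of \<open>U\<close> in
  \<open>q\<close>, hence by half of \<open>q\<close>.\<close>

lemma calderon_zygmund_selection:
  fixes q :: "(real^'n) \<times> real"
  assumes s: "0 < snd q" and U: "open U"
    and small: "2 ^ (CARD('n) + 2) * emeasure lebesgue (U \<inter> cube q) \<le> emeasure lebesgue (cube q)"
  obtains kid :: "nat \<Rightarrow> (real^'n) \<times> real" where
    "\<And>i. snd (kid i) = 0 \<or> 0 < snd (kid i) \<and> 2 * snd (kid i) \<le> snd q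
      \<and> 2 * emeasure lebesgue (U \<inter> cube (kid i)) \<le> emeasure lebesgue (cube (kid i))"
    "\<And>i. cube (kid i) \<subseteq> cube q"
    "disjoint_family (\<lambda>i. cube (kid i))"
    "U \<inter> cube q \<subseteq> (\<Union>i. cube (kid i))"
    "2 * emeasure lebesgue (\<Union>i. cube (kid i)) \<le> emeasure lebesgue (cube q)"
proof -
  let ?e = "emeasure lebesgue"
  let ?n = "CARD('n)"
  have [measurable, simp]: "U \<in> sets lebesgue" using U by (simp add: borel_open sets_completionI_sets)
  define bad where "bad m x \<longleftrightarrow> ?e (cube (cell q m (idx q m x))) < 2 ^ (?n + 1) * ?e (U \<inter> cube (cell q m (idx q m x)))" for m x
  define lev where "lev x = (LEAST m. bad m x)" for x
  define Sel where "Sel = {(m, k). \<exists>x\<in>cube q. bad m x \<and> m = lev x \<and> k = idx q m x}"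
  \<comment> \<open>The selected cells are enumerated through the countability of the index type.
    The condition \<open>to_nat (m, k) = i\<close> lists each of them only once; all other positions
    hold an empty cube.\<close>
  define kid where "kid i = (case from_nat i of (m, k) \<Rightarrow>
    if (m, k) \<in> Sel \<and> to_nat (m, k) = i then cell q m k else (fst q, 0))" for i
  have ecell: "?e (cube (cell q m k)) = ennreal ((snd q / 2 ^ m) ^ ?n)" for m k
    using s by (subst emeasure_cube) (auto simp: cell_def)
  have idx0: "x \<in> cube q \<longleftrightarrow> idx q 0 x = (\<lambda>_. 0)" for x
    using mem_cell_iff[OF s, of x 0 "\<lambda>_. 0"] by (simp add: cell_0)
  have cong: "bad l x \<longleftrightarrow> bad l y" if "idx q m x = idx q m y" "l \<le> m" for l m x y
    using idx_eq_mono[OF that(2,1)] by (simp add: bad_def)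
  \<comment> \<open>Badness up to level \<open>m\<close> depends only on the cell of generation
    \<open>m\<close>, so all points of a selected cell stop at this same cell. Disjointness
    follows.\<close>
  have sel: "z \<in> cube q \<and> bad m z \<and> lev z = m \<and> idx q m z = k" if "(m, k) \<in> Sel" "z \<in> cube (cell q m k)" for m k z
  proof -
    from that obtain x where x: "x \<in> cube q" "bad m x" "m = lev x" "k = idx q m x" by (auto simp: Sel_def)
    have eq: "idx q m z = idx q m x" using that x mem_cell_iff[OF s] by blast
    have "lev z = m" unfolding lev_def
    proof (rule Least_equality)
      show "bad m z" using cong[OF eq] x by blast
      fix l assume "bad l z"
      show "m \<le> l"
      proof (rule ccontr)
        assume "\<not> m \<le> l"
        then have "bad l x" using cong[OF eq, of l] \<open>bad l z\<close> by simp
        then show False using x \<open>\<not> m \<le> l\<close> unfolding lev_def by (metis Least_le)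
      qed
    qed
    moreover have "z \<in> cube q" using idx_eq_mono[OF _ eq, of 0] x idx0 by simp
    moreover have "bad m z" using cong[OF eq] x by blast
    ultimately show ?thesis using eq x by simp
  qed
  have kid_cases: "kid i = (fst q, 0) \<or> (\<exists>m k. (m, k) \<in> Sel \<and> to_nat (m, k) = i \<and> kid i = cell q m k)" for i
    unfolding kid_def by (auto split: prod.split)
  have empty: "cube (fst q, 0) = {}" by (simp add: cube_empty)
  have not_bad_0: "\<not> bad 0 x" if "x \<in> cube q" for x
  proof
    assume "bad 0 x"
    then have "?e (cube q) < 2 ^ (?n + 1) * ?e (U \<inter> cube q)"
      using that by (simp add: bad_def idx0 cell_0)
    also have "\<dots> \<le> 2 * (2 ^ (?n + 1) * ?e (U \<inter> cube q))"
      by (simp add: mult_2)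
    also have "\<dots> \<le> ?e (cube q)" using small by (simp add: mult.assoc)
    finally show False by simp
  qed
  have disj: "disjoint_family (\<lambda>i. cube (kid i))"
  proof -
    have "cube (kid i) \<inter> cube (kid j) = {}" if "i \<noteq> j" for i j
    proof (rule ccontr)
      assume "cube (kid i) \<inter> cube (kid j) \<noteq> {}"
      then obtain z where z: "z \<in> cube (kid i)" "z \<in> cube (kid j)" by blast
      then obtain m k m' k' where
        "(m, k) \<in> Sel" "to_nat (m, k) = i" "kid i = cell q m k"
        "(m', k') \<in> Sel" "to_nat (m', k') = j" "kid j = cell q m' k'"
        using kid_cases[of i] kid_cases[of j] empty by (metis empty_iff)
      moreover from this z sel have "m = m'" "k = k'" by metis+
      ultimately show False using that by simp
    qed
    then show ?thesis by (simp add: disjoint_family_on_def)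
  qed
  show thesis
  proof
    fix i
    show "cube (kid i) \<subseteq> cube q" using kid_cases[of i] sel empty by auto
    show "snd (kid i) = 0 \<or> 0 < snd (kid i) \<and> 2 * snd (kid i) \<le> snd q
      \<and> 2 * ?e (U \<inter> cube (kid i)) \<le> ?e (cube (kid i))"
    proof (cases "kid i = (fst q, 0)")
      case False
      then obtain m k where mk: "(m, k) \<in> Sel" "kid i = cell q m k" using kid_cases[of i] by blast
      then obtain x where x: "x \<in> cube q" "bad m x" "m = lev x" "k = idx q m x" by (auto simp: Sel_def)
      then obtain l where l: "m = Suc l" using not_bad_0[OF x(1)] by (metis not0_implies_Suc)
      \<comment> \<open>Minimality of the stopping level makes the parent good, and passing to the
        child loses \<open>2 ^ ?n\<close> in volume: the density bound \<open>2^(-n-1)\<close>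
        becomes \<open>1/2\<close>.\<close>
      have "\<not> bad l x" using x l unfolding lev_def by (metis lessI not_less_Least)
      then have parent: "2 ^ (?n + 1) * ?e (U \<inter> cube (cell q l (idx q l x))) \<le> ?e (cube (cell q l (idx q l x)))"
        by (simp add: bad_def not_less)
      have "cube (cell q m k) \<subseteq> cube (cell q l (idx q l x))"
        using x(4) by (auto simp: mem_cell_iff[OF s] l intro: idx_Suc_eq)
      then have sub: "?e (U \<inter> cube (cell q m k)) \<le> ?e (U \<inter> cube (cell q l (idx q l x)))"
        by (intro emeasure_mono) auto
      have "2 ^ ?n * (2 * ?e (U \<inter> cube (cell q m k))) = 2 ^ (?n + 1) * ?e (U \<inter> cube (cell q m k))"
        by (simp add: mult_ac)
      also have "\<dots> \<le> 2 ^ (?n + 1) * ?e (U \<inter> cube (cell q l (idx q l x)))"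
        by (intro mult_left_mono sub) simp
      also note parent
      also have "?e (cube (cell q l (idx q l x))) = 2 ^ ?n * ?e (cube (cell q m k))"
      proof -
        have "(snd q / 2 ^ l) ^ ?n = 2 ^ ?n * (snd q / 2 ^ Suc l) ^ ?n"
          by (simp add: power_divide power_mult_distrib)
        then show ?thesis unfolding ecell l using s by (simp add: ennreal_mult flip: ennreal_power)
      qed
      finally have "2 ^ ?n * (2 * ?e (U \<inter> cube (cell q m k))) \<le> 2 ^ ?n * ?e (cube (cell q m k))" .
      then have "2 * ?e (U \<inter> cube (cell q m k)) \<le> ?e (cube (cell q m k))"
        by (subst (asm) ennreal_mult_le_mult_iff) (auto simp: power_eq_top_ennreal)
      moreover have "2 * snd (kid i) \<le> snd q" "0 < snd (kid i)"
        using s unfolding mk l by (auto simp: cell_def field_simps)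
      ultimately show ?thesis using mk by simp
    qed simp
  next
    show "disjoint_family (\<lambda>i. cube (kid i))" by (rule disj)
  next
    show "U \<inter> cube q \<subseteq> (\<Union>i. cube (kid i))"
    proof
      fix x assume x: "x \<in> U \<inter> cube q"
      then obtain \<epsilon> where \<epsilon>: "0 < \<epsilon>" "ball x \<epsilon> \<subseteq> U" using U openE by blast
      \<comment> \<open>Since \<open>U\<close> is open, a small enough cell around \<open>x\<close>
        lies inside \<open>U\<close>, and a cell filled by \<open>U\<close> is bad.\<close>
      obtain m where m: "?n * snd q / \<epsilon> < 2 ^ m" using real_arch_pow[of 2] by auto
      have "cube (cell q m (idx q m x)) \<subseteq> ball x \<epsilon>"
      proof
        fix y assume "y \<in> cube (cell q m (idx q m x))"
        then have "norm (x - y) < ?n * (snd q / 2 ^ m)"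
          using cube_norm_diff_le[of x "cell q m (idx q m x)" y] mem_cell_iff[OF s] by (simp add: cell_def)
        also have "\<dots> < \<epsilon>" using m \<epsilon> by (simp add: field_simps)
        finally show "y \<in> ball x \<epsilon>" by (simp add: dist_norm)
      qed
      then have "U \<inter> cube (cell q m (idx q m x)) = cube (cell q m (idx q m x))" using \<epsilon> by blast
      moreover have "ennreal ((snd q / 2 ^ m) ^ ?n) < 2 ^ (?n + 1) * ennreal ((snd q / 2 ^ m) ^ ?n)"
      proof -
        have "(snd q / 2 ^ m) ^ ?n * 1 < (snd q / 2 ^ m) ^ ?n * 2 ^ (?n + 1)"
          using s by (intro mult_strict_left_mono one_less_power) auto
        then have "ennreal ((snd q / 2 ^ m) ^ ?n) < ennreal (2 ^ (?n + 1) * (snd q / 2 ^ m) ^ ?n)"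
          using s by (intro ennreal_lessI) (auto simp: mult.commute)
        also have "\<dots> = 2 ^ (?n + 1) * ennreal ((snd q / 2 ^ m) ^ ?n)"
          using s by (subst ennreal_mult) (auto simp flip: ennreal_power simp del: power_Suc)
        finally show ?thesis .
      qed
      ultimately have "bad m x" by (simp add: bad_def ecell)
      then have "bad (lev x) x" unfolding lev_def by (rule LeastI)
      then have in_Sel: "(lev x, idx q (lev x) x) \<in> Sel" using x by (auto simp: Sel_def)
      then have "kid (to_nat (lev x, idx q (lev x) x)) = cell q (lev x) (idx q (lev x) x)"
        by (simp add: kid_def)
      moreover have "x \<in> cube (cell q (lev x) (idx q (lev x) x))" by (simp add: mem_cell_iff[OF s])
      ultimately show "x \<in> (\<Union>i. cube (kid i))" by (metis UN_I UNIV_I)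
    qed
  next
    have "?e (cube (kid i)) \<le> 2 ^ (?n + 1) * ?e (U \<inter> cube (kid i))" for i
    proof (cases "kid i = (fst q, 0)")
      case False
      then obtain m k where mk: "(m, k) \<in> Sel" "kid i = cell q m k" using kid_cases[of i] by blast
      then obtain x where x: "x \<in> cube q" "bad m x" "m = lev x" "k = idx q m x" by (auto simp: Sel_def)
      then show ?thesis using mk by (simp add: bad_def less_imp_le)
    qed (simp add: empty)
    then have "2 * (\<Sum>i. ?e (cube (kid i))) \<le> 2 * (\<Sum>i. 2 ^ (?n + 1) * ?e (U \<inter> cube (kid i)))"
      by (intro mult_left_mono suminf_le) auto
    also have "\<dots> = 2 ^ (?n + 2) * (\<Sum>i. ?e (U \<inter> cube (kid i)))"
      by (simp add: mult.assoc)
    also have "(\<Sum>i. ?e (U \<inter> cube (kid i))) = ?e (\<Union>i. U \<inter> cube (kid i))"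
      using disj by (intro suminf_emeasure) (auto simp: disjoint_family_on_def)
    also have "\<dots> \<le> ?e (U \<inter> cube q)"
      using kid_cases sel empty by (intro emeasure_mono) (auto, metis empty_iff)
    also have "2 ^ (?n + 2) * ?e (U \<inter> cube q) \<le> ?e (cube q)" by (rule small)
    finally have "2 * (\<Sum>i. ?e (cube (kid i))) \<le> ?e (cube q)" by (simp add: mult_left_mono)
    then show "2 * ?e (\<Union>i. cube (kid i)) \<le> ?e (cube q)"
      using disj by (subst (asm) suminf_emeasure) auto
  qed
qed

section \<open>Kernel tails\<close>

abbreviation unit_ball_volume :: "'n::finite itself \<Rightarrow> real" where
  "unit_ball_volume _ \<equiv> measure lebesgue (ball (0::real^'n) 1)"

lemma unit_ball_volume_pos: "0 < unit_ball_volume TYPE('n::finite)"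
  using content_ball_pos[of 1 "0::real^'n"] by simp

lemma emeasure_lebesgue_ball_eq:
  fixes z :: "real^'n"
  assumes "0 \<le> \<rho>"
  shows "emeasure lebesgue (ball z \<rho>) = ennreal (\<rho> ^ CARD('n) * unit_ball_volume TYPE('n))"
  using emeasure_lebesgue_ball_conv_unit_ball[OF assms, of z] assms
    emeasure_lebesgue_ball_finite[of "0::real^'n" 1]
  by (simp add: emeasure_eq_ennreal_measure ennreal_mult)

text \<open>The dilate is centred at the corner of the cube. With radius \<open>4 * n * s\<close>,
  for dimension \<open>n\<close> and side \<open>s\<close>, points off it keep distance at least
  \<open>3 * n * s\<close> from the cube, more than twice the distance of any two points of the
  cube, as the smoothness condition requires.\<close>

definition sball :: "(real^'n) \<times> real \<Rightarrow> (real^'n) set" where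
  "sball q = ball (fst q) (4 * real CARD('n) * snd q)"

lemma sball_sets [measurable, simp]: "sball q \<in> sets lebesgue"
  by (simp add: sball_def)

lemma cube_subset_sball: "cube q \<subseteq> sball q"
proof
  fix x assume x: "x \<in> cube q"
  then have s: "0 < snd q" using cube_empty[of q] by (cases "0 < snd q") auto
  have "norm (x - fst q) < CARD('a) * snd q"
    using cube_norm_diff_le[OF x corner_in_cube[OF s]] .
  also have "\<dots> \<le> 4 * CARD('a) * snd q" using s by simp
  finally show "x \<in> sball q" by (simp add: sball_def dist_norm norm_minus_commute)
qed

text \<open>Halving the side halves the radius, and the shift of the corner is less than a quarter
  of the larger radius.\<close>

lemma sball_mono:
  fixes p q :: "(real^'n) \<times> real"
  assumes "cube p \<subseteq> cube q" "0 < snd p" "2 * snd p \<le> snd q"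
  shows "sball p \<subseteq> sball q"
proof
  fix y assume y: "y \<in> sball p"
  have q: "0 < snd q" using assms by simp
  have "norm (fst p - fst q) < real CARD('n) * snd q"
    using assms corner_in_cube[of p] corner_in_cube[OF q] by (intro cube_norm_diff_le) auto
  moreover have "norm (y - fst p) < 4 * real CARD('n) * snd p"
    using y by (simp add: sball_def dist_norm norm_minus_commute)
  moreover have "4 * real CARD('n) * snd p \<le> 2 * real CARD('n) * snd q"
    using assms(3) by (simp add: mult.left_commute)
  moreover have "norm (y - fst q) \<le> norm (y - fst p) + norm (fst p - fst q)"
    by (metis diff_add_cancel add_diff_eq norm_triangle_ineq)
  moreover have "0 < real CARD('n) * snd q" using q by simp
  ultimately have "norm (y - fst q) < 4 * real CARD('n) * snd q" by linarith
  then show "y \<in> sball q" by (simp add: sball_def dist_norm norm_minus_commute)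
qed

lemma dist_off_sball:
  fixes q :: "(real^'n) \<times> real"
  assumes "x \<in> cube q" "y \<notin> sball q"
  shows "3 / 4 * norm (y - fst q) \<le> norm (x - y)" "4 * real CARD('n) * snd q \<le> norm (y - fst q)"
proof -
  have s: "0 < snd q" using assms cube_empty[of q] by (cases "0 < snd q") auto
  have x: "norm (x - fst q) < real CARD('n) * snd q"
    by (rule cube_norm_diff_le[OF assms(1) corner_in_cube[OF s]])
  show y: "4 * real CARD('n) * snd q \<le> norm (y - fst q)"
    using assms(2) by (simp add: sball_def dist_norm norm_minus_commute)
  have "norm (y - fst q) \<le> norm (x - y) + norm (x - fst q)"
    by (metis norm_triangle_ineq diff_add_cancel add_diff_eq norm_minus_commute)
  with x y show "3 / 4 * norm (y - fst q) \<le> norm (x - y)" by linarith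
qed

text \<open>Dyadic annuli around the corner, starting at the radius \<open>R\<close> of
  \<open>sball q\<close>. If \<open>y\<close> has distance between \<open>2^j R\<close> and
  \<open>2^(j+1) R\<close> from the corner, then its distance from \<open>x\<close> is at least
  \<open>3/4\<close> of \<open>2^j R\<close>, which explains the constants \<open>3\<close> and
  \<open>8\<close>.\<close>

lemma kernel_annuli:
  fixes q :: "(real^'n) \<times> real"
  assumes "x \<in> cube q" "y \<notin> sball q" "0 \<le> \<theta>"
  shows "ennreal (norm (x - y) powr (-\<theta>))
    \<le> (\<Sum>j. ennreal ((3 * real CARD('n) * snd q * 2 ^ j) powr (-\<theta>))
        * indicator (ball (fst q) (8 * real CARD('n) * snd q * 2 ^ j)) y)"
proof -
  have s: "0 < snd q" using assms cube_empty[of q] by (cases "0 < snd q") auto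
  define R where "R = 4 * real CARD('n) * snd q"
  have R: "0 < R" using s by (simp add: R_def)
  define d where "d = norm (y - fst q)"
  have d: "R \<le> d" "3 / 4 * d \<le> norm (x - y)"
    using dist_off_sball[OF assms(1,2)] by (auto simp: R_def d_def)
  define m where "m = (LEAST m. d / R < 2 ^ m)"
  have m: "d / R < 2 ^ m" unfolding m_def by (rule LeastI_ex) (rule real_arch_pow, simp)
  \<comment> \<open>As \<open>y\<close> is off \<open>sball q\<close>, \<open>d \<ge> R\<close>; so
    the annulus containing \<open>y\<close> has index \<open>m - 1\<close>.\<close>
  then have "m \<noteq> 0" using d R by (cases m) (auto simp: field_simps)
  then obtain j where j: "m = Suc j" by (metis not0_implies_Suc)
  then have "\<not> d / R < 2 ^ j" unfolding m_def by (metis lessI not_less_Least)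
  then have lo: "R * 2 ^ j \<le> d" using R by (simp add: field_simps)
  have hi: "d < 2 * R * 2 ^ j" using m R unfolding j by (simp add: field_simps)
  have "norm (x - y) powr (-\<theta>) \<le> (3 * real CARD('n) * snd q * 2 ^ j) powr (-\<theta>)"
  proof (rule powr_mono2')
    show "3 * real CARD('n) * snd q * 2 ^ j \<le> norm (x - y)"
      using lo d(2) by (simp add: R_def)
  qed (use s assms in auto)
  then have "ennreal (norm (x - y) powr (-\<theta>)) \<le> ennreal ((3 * real CARD('n) * snd q * 2 ^ j) powr (-\<theta>))
        * indicator (ball (fst q) (8 * real CARD('n) * snd q * 2 ^ j)) y"
    using hi by (simp add: ennreal_leI d_def R_def dist_norm norm_minus_commute indicator_def)
  also have "\<dots> \<le> (\<Sum>j. ennreal ((3 * real CARD('n) * snd q * 2 ^ j) powr (-\<theta>))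
        * indicator (ball (fst q) (8 * real CARD('n) * snd q * 2 ^ j)) y)"
    using sum_le_suminf[of "\<lambda>j. ennreal ((3 * real CARD('n) * snd q * 2 ^ j) powr (-\<theta>))
        * indicator (ball (fst q) (8 * real CARD('n) * snd q * 2 ^ j)) y" "{j}"]
    by (simp only: sum.insert sum.empty finite.intros empty_iff not_False_eq_True add_0_right if_False
        summableI zero_le simp_thms)
  finally show ?thesis .
qed

lemma nn_integral_kernel_annuli:
  fixes q :: "(real^'n) \<times> real"
  assumes [measurable]: "h \<in> borel_measurable lebesgue"
    and h: "\<And>y. y \<in> sball q \<Longrightarrow> h y = 0" and x: "x \<in> cube q" and \<theta>: "0 \<le> \<theta>"
  shows "(\<integral>\<^sup>+y. ennreal (norm (x - y) powr (-\<theta>)) * h y \<partial>lebesgue)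
    \<le> (\<Sum>j. ennreal ((3 * real CARD('n) * snd q * 2 ^ j) powr (-\<theta>))
        * (\<integral>\<^sup>+y\<in>ball (fst q) (8 * real CARD('n) * snd q * 2 ^ j). h y \<partial>lebesgue))"
proof -
  have "(\<integral>\<^sup>+y. ennreal (norm (x - y) powr (-\<theta>)) * h y \<partial>lebesgue)
      \<le> (\<integral>\<^sup>+y. (\<Sum>j. ennreal ((3 * real CARD('n) * snd q * 2 ^ j) powr (-\<theta>))
        * (h y * indicator (ball (fst q) (8 * real CARD('n) * snd q * 2 ^ j)) y)) \<partial>lebesgue)"
  proof (rule nn_integral_mono)
    fix y
    show "ennreal (norm (x - y) powr (-\<theta>)) * h y
      \<le> (\<Sum>j. ennreal ((3 * real CARD('n) * snd q * 2 ^ j) powr (-\<theta>))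
        * (h y * indicator (ball (fst q) (8 * real CARD('n) * snd q * 2 ^ j)) y))"
    proof (cases "y \<in> sball q")
      case False
      have "ennreal (norm (x - y) powr (-\<theta>)) * h y
        \<le> (\<Sum>j. ennreal ((3 * real CARD('n) * snd q * 2 ^ j) powr (-\<theta>))
          * indicator (ball (fst q) (8 * real CARD('n) * snd q * 2 ^ j)) y) * h y"
        by (intro mult_right_mono kernel_annuli[OF x False \<theta>]) simp
      also have "\<dots> = (\<Sum>j. ennreal ((3 * real CARD('n) * snd q * 2 ^ j) powr (-\<theta>))
          * indicator (ball (fst q) (8 * real CARD('n) * snd q * 2 ^ j)) y * h y)"
        by (rule ennreal_suminf_multc[symmetric])
      finally show ?thesis by (simp only: mult_ac)
    qed (simp add: h)
  qed
  also have "\<dots> = (\<Sum>j. ennreal ((3 * real CARD('n) * snd q * 2 ^ j) powr (-\<theta>))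
        * (\<integral>\<^sup>+y\<in>ball (fst q) (8 * real CARD('n) * snd q * 2 ^ j). h y \<partial>lebesgue))"
    by (subst nn_integral_suminf) (auto simp: nn_integral_cmult)
  finally show ?thesis .
qed

lemma two_power_powr: "(2 ^ j :: real) powr a = (2 powr a) ^ j"
  by (simp add: powr_power powr_powr mult.commute flip: powr_realpow)

text \<open>Size of the kernel difference on the \<open>j\<close>-th annulus times the volume of the
  ball, up to the unit volume. What remains is geometric in \<open>j\<close>, and
  \<open>8 / 3\<close> is the ratio of the two radii.\<close>

lemma annulus_const:
  fixes n :: nat and s :: real
  assumes "0 < n" "0 < s"
  shows "(3 * real n * s * 2 ^ j) powr (-(real n + \<delta>)) * (8 * real n * s * 2 ^ j) ^ n
    = (8 / 3) ^ n * (3 * real n * s) powr (-\<delta>) * (2 powr (-\<delta>)) ^ j"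
proof -
  define Z where "Z = 3 * real n * s * 2 ^ j"
  have Z: "0 < Z" using assms by (simp add: Z_def)
  have eq: "8 * real n * s * 2 ^ j = 8 / 3 * Z" by (simp add: Z_def)
  have "Z powr (-(real n + \<delta>)) * (8 / 3 * Z) ^ n = (8 / 3) ^ n * (Z powr (-(real n + \<delta>)) * Z powr real n)"
    using Z by (simp only: power_mult_distrib powr_realpow mult_ac)
  also have "Z powr (-(real n + \<delta>)) * Z powr real n = Z powr (-\<delta>)"
    by (simp flip: powr_add)
  also have "Z powr (-\<delta>) = (3 * real n * s) powr (-\<delta>) * (2 ^ j) powr (-\<delta>)"
    unfolding Z_def using assms by (simp add: powr_mult)
  finally show ?thesis unfolding eq Z_def by (simp add: mult.assoc two_power_powr)
qed

lemma suminf_geometric_ennreal: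
  assumes "0 \<le> a" "0 \<le> r" "r < 1"
  shows "(\<Sum>j. ennreal (a * r ^ j)) = ennreal (a / (1 - r))"
proof -
  have "(\<lambda>j. a * r ^ j) sums (a * (1 / (1 - r)))"
    using assms by (intro sums_mult geometric_sums) auto
  then show ?thesis using assms by (subst suminf_ennreal2) (auto simp: sums_iff)
qed

text \<open>Each ball around an annulus contains the whole cube, in particular \<open>x'\<close>, so
  its average of \<open>h\<close> is at most the maximal function at \<open>x'\<close>. The gain
  \<open>\<delta> > 0\<close> makes the sum over the annuli geometric.\<close>

lemma kernel_tail_maximal:
  fixes q :: "(real^'n) \<times> real"
  assumes [measurable]: "h \<in> borel_measurable lebesgue"
    and h: "\<And>y. y \<in> sball q \<Longrightarrow> h y = 0" and x: "x \<in> cube q" "x' \<in> cube q" and \<delta>: "0 < \<delta>"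
  shows "(\<integral>\<^sup>+y. ennreal (norm (x - y) powr (-(real CARD('n) + \<delta>))) * h y \<partial>lebesgue)
    \<le> ennreal ((8 / 3) ^ CARD('n) * unit_ball_volume TYPE('n) * (3 * real CARD('n) * snd q) powr (-\<delta>) / (1 - 2 powr (-\<delta>)))
      * maximal_op h x'"
proof -
  let ?n = "CARD('n)" and ?N = "real CARD('n)" and ?u = "unit_ball_volume TYPE('n)"
  let ?a = "(8 / 3) ^ ?n * ?u * (3 * ?N * snd q) powr (-\<delta>)"
  have s: "0 < snd q" using x cube_empty[of q] by (cases "0 < snd q") auto
  have u: "0 < ?u" by (rule unit_ball_volume_pos)
  have "(\<integral>\<^sup>+y. ennreal (norm (x - y) powr (-(?N + \<delta>))) * h y \<partial>lebesgue)
    \<le> (\<Sum>j. ennreal ((3 * ?N * snd q * 2 ^ j) powr (-(?N + \<delta>)))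
        * (\<integral>\<^sup>+y\<in>ball (fst q) (8 * ?N * snd q * 2 ^ j). h y \<partial>lebesgue))"
    using \<delta> by (intro nn_integral_kernel_annuli h x) auto
  also have "\<dots> \<le> (\<Sum>j. ennreal (?a * (2 powr (-\<delta>)) ^ j) * maximal_op h x')"
  proof (intro suminf_le summableI)
    fix j
    have "sball q \<subseteq> ball (fst q) (8 * ?N * snd q * 2 ^ j)"
      unfolding sball_def
    proof (rule subset_ball)
      have "1 \<le> (2::real) ^ j" by simp
      then have "1 \<le> 2 * (2::real) ^ j" by linarith
      then have "4 * ?N * snd q * 1 \<le> 4 * ?N * snd q * (2 * 2 ^ j)"
        using s by (intro mult_left_mono) auto
      then show "4 * ?N * snd q \<le> 8 * ?N * snd q * 2 ^ j" by simp
    qed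
    then have "x' \<in> ball (fst q) (8 * ?N * snd q * 2 ^ j)" using x cube_subset_sball by blast
    then have "(\<integral>\<^sup>+y\<in>ball (fst q) (8 * ?N * snd q * 2 ^ j). h y \<partial>lebesgue)
        \<le> ennreal ((8 * ?N * snd q * 2 ^ j) ^ ?n * ?u) * maximal_op h x'"
      using nn_integral_ball_le_maximal_op[of "8 * ?N * snd q * 2 ^ j" x' "fst q" h] s
      by (simp add: emeasure_lebesgue_ball_eq)
    then have "ennreal ((3 * ?N * snd q * 2 ^ j) powr (-(?N + \<delta>)))
          * (\<integral>\<^sup>+y\<in>ball (fst q) (8 * ?N * snd q * 2 ^ j). h y \<partial>lebesgue)
        \<le> ennreal ((3 * ?N * snd q * 2 ^ j) powr (-(?N + \<delta>)))
          * (ennreal ((8 * ?N * snd q * 2 ^ j) ^ ?n * ?u) * maximal_op h x')"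
      by (rule mult_left_mono) simp
    also have "\<dots> = ennreal ((3 * ?N * snd q * 2 ^ j) powr (-(?N + \<delta>)) * (8 * ?N * snd q * 2 ^ j) ^ ?n * ?u)
        * maximal_op h x'"
      using s u by (simp add: ennreal_mult mult.assoc)
    also have "(3 * ?N * snd q * 2 ^ j) powr (-(?N + \<delta>)) * (8 * ?N * snd q * 2 ^ j) ^ ?n * ?u
        = ?a * (2 powr (-\<delta>)) ^ j"
      using annulus_const[of ?n "snd q" j \<delta>] s by simp
    finally show "ennreal ((3 * ?N * snd q * 2 ^ j) powr (-(?N + \<delta>)))
          * (\<integral>\<^sup>+y\<in>ball (fst q) (8 * ?N * snd q * 2 ^ j). h y \<partial>lebesgue)
        \<le> ennreal (?a * (2 powr (-\<delta>)) ^ j) * maximal_op h x'" .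
  qed
  also have "\<dots> = (\<Sum>j. ennreal (?a * (2 powr (-\<delta>)) ^ j)) * maximal_op h x'" by simp
  also have "(\<Sum>j. ennreal (?a * (2 powr (-\<delta>)) ^ j)) = ennreal (?a / (1 - 2 powr (-\<delta>)))"
    using u \<delta> powr_less_mono[of "-\<delta>" 0 2] by (intro suminf_geometric_ennreal) auto
  finally show ?thesis .
qed

text \<open>Jensen's inequality up to a factor \<open>2\<close>, from the pointwise bound
  \<open>h \<le> l + l^(1-r) h^r\<close>. Taking the level \<open>l\<close> to be the power mean of
  \<open>h\<close> over \<open>B\<close> balances the two terms.\<close>

lemma nn_integral_le_power_mean:
  assumes [measurable]: "h \<in> borel_measurable M" "B \<in> sets M"
    and r: "1 < r" and B: "emeasure M B \<noteq> 0" "emeasure M B \<noteq> top"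
  shows "(\<integral>\<^sup>+y\<in>B. h y \<partial>M) \<le> 2 * emeasure M B * ennreal_pow ((\<integral>\<^sup>+y\<in>B. ennreal_pow (h y) r \<partial>M) / emeasure M B) (1 / r)"
proof -
  obtain b where b: "emeasure M B = ennreal b" "0 < b"
    using B by (cases "emeasure M B") (auto simp: less_le)
  let ?X = "\<integral>\<^sup>+y\<in>B. ennreal_pow (h y) r \<partial>M"
  have le: "(\<integral>\<^sup>+y\<in>B. h y \<partial>M) \<le> ennreal l * ennreal b + ennreal (l powr (1 - r)) * ?X" if l: "0 < l" for l
  proof -
    have pt: "h y \<le> ennreal l + ennreal (l powr (1 - r)) * ennreal_pow (h y) r" for y
    proof (cases "h y")
      case (real v)
      have "v \<le> l + l powr (1 - r) * v powr r"
      proof (cases "v \<le> l")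
        case False
        have "v = v powr (1 - r) * v powr r" using False l by (simp flip: powr_add)
        also have "\<dots> \<le> l powr (1 - r) * v powr r"
          using False l r by (intro mult_right_mono powr_mono2') auto
        finally show ?thesis using l by simp
      qed (use l in \<open>simp add: add_increasing2\<close>)
      then have "ennreal v \<le> ennreal (l + l powr (1 - r) * v powr r)" by (rule ennreal_leI)
      then show ?thesis using real l by (simp add: ennreal_pow_ennreal flip: ennreal_mult)
    qed (use l in \<open>simp add: ennreal_mult_top\<close>)
    have "(\<integral>\<^sup>+y\<in>B. h y \<partial>M) \<le> (\<integral>\<^sup>+y. ennreal l * indicator B y + ennreal (l powr (1 - r)) * (ennreal_pow (h y) r * indicator B y) \<partial>M)"
      using pt by (intro nn_integral_mono) (auto simp: indicator_def)
    also have "\<dots> = ennreal l * ennreal b + ennreal (l powr (1 - r)) * ?X"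
      by (subst nn_integral_add) (auto simp: nn_integral_cmult nn_integral_cmult_indicator b)
    finally show ?thesis .
  qed
  show ?thesis
  proof (cases ?X)
    case top
    then show ?thesis using b B by (simp add: ennreal_top_divide ennreal_mult_top)
  next
    case (real X)
    show ?thesis
    proof (cases "X = 0")
      case True
      have "(\<integral>\<^sup>+y\<in>B. h y \<partial>M) \<le> 0"
      proof (rule ennreal_le_epsilon)
        \<comment> \<open>Here the power mean is \<open>0\<close>, which is no admissible level;
          arbitrarily small levels \<open>l = e / b\<close> are used instead.\<close>
        fix e :: real assume "0 < e"
        then show "(\<integral>\<^sup>+y\<in>B. h y \<partial>M) \<le> 0 + ennreal e"
          using le[of "e / b"] b True real by (simp flip: ennreal_mult)
      qed
      then show ?thesis by simp
    next
      case False
      define l where "l = (X / b) powr (1 / r)"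
      have l: "0 < l" using False real b by (simp add: l_def)
      have "X / b = l powr r" using r False real b by (simp add: l_def powr_powr)
      then have "l powr (1 - r) * X = l * b"
        using l b by (simp add: field_simps powr_diff)
      then have "(\<integral>\<^sup>+y\<in>B. h y \<partial>M) \<le> ennreal (2 * b * l)"
        using le[OF l] real l b by (simp flip: ennreal_mult ennreal_plus)
          (simp add: mult_2 mult.commute algebra_simps)
      also have "\<dots> = 2 * emeasure M B * ennreal_pow (?X / emeasure M B) (1 / r)"
        using real b l by (simp add: divide_ennreal ennreal_pow_ennreal ennreal_mult l_def)
      finally show ?thesis .
    qed
  qed
qed

text \<open>Only the size of the kernel enters. On each ball the \<open>L^1\<close> norm is at most
  \<open>2\<close> times the \<open>L^2\<close> norm times the root of the volume, so the
  \<open>j\<close>-th term decays like the radius to the power \<open>-n/2\<close>. The bound tends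
  to \<open>0\<close> as the side grows, which the exhaustion of space relies on.\<close>

lemma kernel_tail_L2:
  fixes q :: "(real^'n) \<times> real"
  assumes [measurable]: "h \<in> borel_measurable lebesgue"
    and h: "\<And>y. y \<in> sball q \<Longrightarrow> h y = 0" and x: "x \<in> cube q"
    and X: "(\<integral>\<^sup>+y. ennreal_pow (h y) 2 \<partial>lebesgue) \<le> ennreal X" "0 \<le> X"
  shows "(\<integral>\<^sup>+y. ennreal (norm (x - y) powr (-real CARD('n))) * h y \<partial>lebesgue)
    \<le> ennreal (2 * sqrt X * sqrt ((8 / 3) ^ CARD('n) * unit_ball_volume TYPE('n))
       * (3 * real CARD('n) * snd q) powr (-(real CARD('n) / 2)) / (1 - 2 powr (-(real CARD('n) / 2))))"
proof -
  let ?n = "CARD('n)" and ?N = "real CARD('n)" and ?u = "unit_ball_volume TYPE('n)"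
  let ?a = "2 * sqrt X * sqrt ((8 / 3) ^ ?n * ?u) * (3 * ?N * snd q) powr (-(?N / 2))"
  have s: "0 < snd q" using x cube_empty[of q] by (cases "0 < snd q") auto
  have u: "0 < ?u" by (rule unit_ball_volume_pos)
  have "(\<integral>\<^sup>+y. ennreal (norm (x - y) powr (-?N)) * h y \<partial>lebesgue)
    \<le> (\<Sum>j. ennreal ((3 * ?N * snd q * 2 ^ j) powr (-?N))
        * (\<integral>\<^sup>+y\<in>ball (fst q) (8 * ?N * snd q * 2 ^ j). h y \<partial>lebesgue))"
    by (intro nn_integral_kernel_annuli h x) auto
  also have "\<dots> \<le> (\<Sum>j. ennreal (?a * (2 powr (-(?N / 2))) ^ j))"
  proof (intro suminf_le summableI)
    fix j
    let ?B = "ball (fst q) (8 * ?N * snd q * 2 ^ j)"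
    define Z where "Z = 3 * ?N * snd q * 2 ^ j"
    have Z: "0 < Z" using s by (simp add: Z_def)
    define b where "b = (8 / 3 * Z) ^ ?n * ?u"
    have b: "0 < b" "emeasure lebesgue ?B = ennreal b"
    proof -
      have "8 * ?N * snd q * 2 ^ j = 8 / 3 * Z" by (simp add: Z_def)
      then show "emeasure lebesgue ?B = ennreal b"
        using Z by (simp add: emeasure_lebesgue_ball_eq b_def del: times_divide_eq_left)
    qed (use Z u in \<open>simp add: b_def\<close>)
    have "(\<integral>\<^sup>+y\<in>?B. h y \<partial>lebesgue)
        \<le> 2 * emeasure lebesgue ?B * ennreal_pow ((\<integral>\<^sup>+y\<in>?B. ennreal_pow (h y) 2 \<partial>lebesgue) / emeasure lebesgue ?B) (1 / 2)"
      using b by (intro nn_integral_le_power_mean) auto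
    also have "\<dots> \<le> 2 * emeasure lebesgue ?B * ennreal_pow (ennreal X / emeasure lebesgue ?B) (1 / 2)"
      using X(1) by (intro mult_left_mono ennreal_pow_mono divide_right_mono_ennreal)
        (auto intro!: order_trans[OF nn_integral_mono X(1)] simp: indicator_def)
    also have "\<dots> = ennreal (2 * b * (X / b) powr (1 / 2))"
      using b X by (simp add: divide_ennreal ennreal_pow_ennreal ennreal_mult)
    also have "2 * b * (X / b) powr (1 / 2) = 2 * sqrt X * sqrt b"
      using b X by (simp add: powr_half_sqrt real_sqrt_divide field_simps)
    finally have "ennreal (Z powr (-?N)) * (\<integral>\<^sup>+y\<in>?B. h y \<partial>lebesgue) \<le> ennreal (Z powr (-?N)) * ennreal (2 * sqrt X * sqrt b)"
      by (rule mult_left_mono) simp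
    also have "\<dots> = ennreal (2 * sqrt X * (Z powr (-?N) * sqrt b))"
      using X b by (simp add: mult_ac flip: ennreal_mult)
    also have "Z powr (-?N) * sqrt b = sqrt ((8 / 3) ^ ?n * ?u) * Z powr (-(?N / 2))"
    proof -
      have "b = ((8 / 3) ^ ?n * ?u) * Z powr ?N"
        using Z unfolding b_def power_mult_distrib by (simp add: powr_realpow)
      then have "sqrt b = sqrt ((8 / 3) ^ ?n * ?u) * Z powr (?N / 2)"
        using Z by (simp add: real_sqrt_mult powr_powr flip: powr_half_sqrt)
      then show ?thesis by (simp add: mult_ac flip: powr_add)
    qed
    also have "Z powr (-(?N / 2)) = (3 * ?N * snd q) powr (-(?N / 2)) * (2 ^ j) powr (-(?N / 2))"
      unfolding Z_def using s by (simp add: powr_mult)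
    also have "(2 ^ j :: real) powr (-(?N / 2)) = (2 powr (-(?N / 2))) ^ j"
      by (rule two_power_powr)
    finally show "ennreal ((3 * ?N * snd q * 2 ^ j) powr (-?N)) * (\<integral>\<^sup>+y\<in>?B. h y \<partial>lebesgue)
        \<le> ennreal (?a * (2 powr (-(?N / 2))) ^ j)"
      by (simp add: Z_def mult.assoc)
  qed
  also have "\<dots> = ennreal (?a / (1 - 2 powr (-(?N / 2))))"
    using u X powr_less_mono[of "-(?N / 2)" 0 2] by (intro suminf_geometric_ennreal) auto
  finally show ?thesis .
qed

section \<open>Calderon--Zygmund operators\<close>

lemma Lp_norm_less_top_iff: "Lp_norm p f < \<infinity> \<longleftrightarrow> (\<integral>\<^sup>+x. ennreal (cmod (f x) powr p) \<partial>lebesgue) < \<infinity>"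
  by (simp add: Lp_norm_def less_top[symmetric])

lemma Lp_iff: "f \<in> Lp p \<longleftrightarrow> f \<in> borel_measurable lebesgue \<and> (\<integral>\<^sup>+x. ennreal (cmod (f x) powr p) \<partial>lebesgue) < \<infinity>"
  unfolding Lp_def using Lp_norm_less_top_iff by blast

lemma Lp_measurable: "f \<in> Lp p \<Longrightarrow> f \<in> borel_measurable lebesgue"
  by (simp add: Lp_iff)

lemma Lp_dominated:
  assumes "f \<in> Lp p" "0 \<le> p" "g \<in> borel_measurable lebesgue" "\<And>x. cmod (g x) \<le> cmod (f x)"
  shows "g \<in> Lp p"
proof -
  have "(\<integral>\<^sup>+x. ennreal (cmod (g x) powr p) \<partial>lebesgue) \<le> (\<integral>\<^sup>+x. ennreal (cmod (f x) powr p) \<partial>lebesgue)"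
    using assms by (intro nn_integral_mono ennreal_leI powr_mono2) auto
  with assms show ?thesis by (auto simp: Lp_iff)
qed

definition restr :: "'a set \<Rightarrow> ('a \<Rightarrow> complex) \<Rightarrow> 'a \<Rightarrow> complex" where
  "restr A f x = (if x \<in> A then f x else 0)"

lemma restr_measurable [measurable]:
  assumes [measurable]: "f \<in> borel_measurable M" "A \<in> sets M"
  shows "restr A f \<in> borel_measurable M"
  unfolding restr_def[abs_def] by measurable

lemma restr_Lp: "f \<in> Lp p \<Longrightarrow> 0 \<le> p \<Longrightarrow> A \<in> sets lebesgue \<Longrightarrow> restr A f \<in> Lp p"
  by (rule Lp_dominated[of f]) (auto simp: Lp_iff restr_def)

text \<open>For \<open>r \<le> 2\<close> one has \<open>t powr r \<le> 1 + t powr 2\<close>, and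
  both terms are integrable on a set of finite measure.\<close>

lemma restr_Lp_le:
  assumes f: "f \<in> Lp 2" and r: "0 < r" "r \<le> 2" and A: "A \<in> sets lebesgue" "emeasure lebesgue A < top"
  shows "restr A f \<in> Lp r"
proof -
  have [measurable]: "f \<in> borel_measurable lebesgue" "A \<in> sets lebesgue" using f A by (auto simp: Lp_iff)
  have "(\<integral>\<^sup>+x. ennreal (cmod (restr A f x) powr r) \<partial>lebesgue)
      \<le> (\<integral>\<^sup>+x. indicator A x + ennreal (cmod (f x) powr 2) \<partial>lebesgue)"
  proof (rule nn_integral_mono)
    fix x
    have "cmod (f x) powr r \<le> 1 + cmod (f x) powr 2"
    proof (cases "cmod (f x) \<le> 1")
      case True
      then have "cmod (f x) powr r \<le> 1" using r by (intro powr_le1) auto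
      then show ?thesis by (simp add: add_increasing2)
    next
      case False
      then have "cmod (f x) powr r \<le> cmod (f x) powr 2" using r by (intro powr_mono) auto
      then show ?thesis by simp
    qed
    then have "ennreal (cmod (f x) powr r) \<le> ennreal (1 + cmod (f x) powr 2)" by (rule ennreal_leI)
    also have "\<dots> = 1 + ennreal (cmod (f x) powr 2)" by (simp add: ennreal_plus)
    finally show "ennreal (cmod (restr A f x) powr r) \<le> indicator A x + ennreal (cmod (f x) powr 2)"
      by (simp add: restr_def)
  qed
  also have "\<dots> = emeasure lebesgue A + (\<integral>\<^sup>+x. ennreal (cmod (f x) powr 2) \<partial>lebesgue)"
    by (subst nn_integral_add) auto
  also have "\<dots> < top" using f A by (simp add: Lp_iff)
  finally show ?thesis by (simp add: Lp_iff)
qed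

lemma norm_powr_measurable:
  "(\<lambda>y::real^'n. ennreal (norm (x - y) powr a)) \<in> borel_measurable lebesgue"
proof -
  have "(\<lambda>y::real^'n. ennreal (norm (x - y) powr a)) \<in> borel_measurable lborel" by measurable
  then show ?thesis by (rule measurable_completion)
qed

locale cz_operator =
  fixes T :: "((real^'n) \<Rightarrow> complex) \<Rightarrow> (real^'n) \<Rightarrow> complex" and c \<delta> :: real
    and K :: "(real^'n) \<Rightarrow> (real^'n) \<Rightarrow> complex"
  assumes linear: "\<And>f g a b. f \<in> Lp 2 \<Longrightarrow> g \<in> Lp 2 \<Longrightarrow>
      T (\<lambda>x. a * f x + b * g x) = (\<lambda>x. a * T f x + b * T g x)"
    and delta: "0 < \<delta>" and kernel: "cz_kernel c \<delta> K"
    and repr: "\<And>f x. f \<in> Lp 2 \<Longrightarrow> x \<notin> closure {y. f y \<noteq> 0} \<Longrightarrow> T f x = (\<integral>y. K x y * f y \<partial>lebesgue)"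
begin

lemma kernel_size: "x \<noteq> y \<Longrightarrow> cmod (K x y) \<le> \<bar>c\<bar> * norm (x - y) powr (-real CARD('n))"
proof -
  assume xy: "x \<noteq> y"
  then have "cmod (K x y) \<le> c / norm (x - y) ^ CARD('n)" using kernel by (simp add: cz_kernel_def)
  also have "\<dots> \<le> \<bar>c\<bar> / norm (x - y) ^ CARD('n)" by (intro divide_right_mono) auto
  also have "\<dots> = \<bar>c\<bar> * norm (x - y) powr (-real CARD('n))"
    using xy by (simp add: powr_minus_divide powr_realpow)
  finally show ?thesis .
qed

lemma kernel_smooth:
  assumes "norm (x - x') < norm (x - y) / 2"
  shows "cmod (K x y - K x' y) \<le> \<bar>c\<bar> * norm (x - x') powr \<delta> * norm (x - y) powr (-(real CARD('n) + \<delta>))"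
    and "cmod (K y x - K y x') \<le> \<bar>c\<bar> * norm (x - x') powr \<delta> * norm (x - y) powr (-(real CARD('n) + \<delta>))"
proof -
  have *: "cmod (K x y - K x' y) + cmod (K y x - K y x')
      \<le> c * (norm (x - x') powr \<delta> / norm (x - y) powr (real CARD('n) + \<delta>))"
    using kernel assms unfolding cz_kernel_def by blast
  also have "\<dots> \<le> \<bar>c\<bar> * (norm (x - x') powr \<delta> / norm (x - y) powr (real CARD('n) + \<delta>))"
    by (intro mult_right_mono) auto
  also have "\<dots> = \<bar>c\<bar> * norm (x - x') powr \<delta> * norm (x - y) powr (-(real CARD('n) + \<delta>))"
    unfolding powr_minus_divide by simp
  finally have "cmod (K x y - K x' y) + cmod (K y x - K y x')
      \<le> \<bar>c\<bar> * norm (x - x') powr \<delta> * norm (x - y) powr (-(real CARD('n) + \<delta>))" .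
  then show "cmod (K x y - K x' y) \<le> \<bar>c\<bar> * norm (x - x') powr \<delta> * norm (x - y) powr (-(real CARD('n) + \<delta>))"
    and "cmod (K y x - K y x') \<le> \<bar>c\<bar> * norm (x - x') powr \<delta> * norm (x - y) powr (-(real CARD('n) + \<delta>))"
    using norm_ge_zero[of "K x y - K x' y"] norm_ge_zero[of "K y x - K y x'"] by linarith+
qed

text \<open>\<open>cz_kernel\<close> does not mention measurability. Smoothness in the second
  variable makes \<open>K x\<close> continuous off the diagonal, and the measurability of the
  integrands is derived from that.\<close>

lemma kernel_continuous: "continuous_on (-{x}) (K x)"
proof (intro continuous_at_imp_continuous_on ballI)
  fix y assume "y \<in> -{x}"
  then have "y \<noteq> x" by simp
  show "isCont (K x) y"
  proof -
    have "((\<lambda>y'. K x y' - K x y) \<longlongrightarrow> 0) (at y)"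
    proof (rule Lim_null_comparison)
      have "\<forall>\<^sub>F y' in at y. dist y' y < norm (y - x) / 2"
        using \<open>y \<noteq> x\<close> unfolding eventually_at by (intro exI[of _ "norm (y - x) / 2"]) auto
      then show "\<forall>\<^sub>F y' in at y. cmod (K x y' - K x y)
          \<le> \<bar>c\<bar> * norm (y - y') powr \<delta> * norm (y - x) powr (-(real CARD('n) + \<delta>))"
      proof eventually_elim
        case (elim y')
        then have "cmod (K x y - K x y') \<le> \<bar>c\<bar> * norm (y - y') powr \<delta> * norm (y - x) powr (-(real CARD('n) + \<delta>))"
          by (intro kernel_smooth) (simp add: dist_norm norm_minus_commute)
        then show ?case by (simp add: norm_minus_commute)
      qed
      have "((\<lambda>y'. norm (y - y') powr \<delta>) \<longlongrightarrow> 0) (at y)"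
        using delta by (intro tendsto_zero_powrI tendsto_const) (auto intro!: tendsto_eq_intros)
      then show "((\<lambda>y'. \<bar>c\<bar> * norm (y - y') powr \<delta> * norm (y - x) powr (-(real CARD('n) + \<delta>))) \<longlongrightarrow> 0) (at y)"
        using tendsto_mult_right_zero[OF tendsto_mult_left_zero] by (auto intro!: tendsto_mult_left_zero tendsto_mult_right_zero)
    qed
    then show ?thesis unfolding isCont_def by (simp add: LIM_zero_iff)
  qed
qed

lemma kernel_mult_measurable:
  assumes [measurable]: "g \<in> borel_measurable lebesgue" and "g x = 0"
  shows "(\<lambda>y. K x y * g y) \<in> borel_measurable lebesgue"
proof -
  \<comment> \<open>The value \<open>K x x\<close> is unrestricted and is replaced by
    \<open>0\<close>; the product does not change because \<open>g x = 0\<close>.\<close>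
  have "(\<lambda>y. if y \<in> -{x} then K x y else 0) \<in> borel_measurable borel"
    by (intro borel_measurable_continuous_on_if kernel_continuous continuous_on_const) auto
  then have [measurable]: "(\<lambda>y. if y \<in> -{x} then K x y else 0) \<in> borel_measurable lebesgue"
    by (rule measurable_completion[unfolded sets_lborel, OF _] | simp add: measurable_completion)+
  have "(\<lambda>y. (if y \<in> -{x} then K x y else 0) * g y) \<in> borel_measurable lebesgue" by measurable
  moreover have "(\<lambda>y. (if y \<in> -{x} then K x y else 0) * g y) = (\<lambda>y. K x y * g y)"
    using assms(2) by auto
  ultimately show ?thesis by simp
qed

lemma outside_support:
  assumes "\<And>y. y \<in> sball q \<Longrightarrow> g y = 0" "x \<in> cube q"
  shows "x \<notin> closure {y. g y \<noteq> 0}" "g x = 0"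
proof -
  have x: "x \<in> sball q" using assms(2) cube_subset_sball by blast
  show "g x = 0" using x assms by blast
  have "closure {y. g y \<noteq> 0} \<subseteq> - sball q"
    using assms(1) by (intro closure_minimal) (auto simp: sball_def)
  with x show "x \<notin> closure {y. g y \<noteq> 0}" by blast
qed

lemma nn_integral_kernel_le:
  assumes [measurable]: "g \<in> borel_measurable lebesgue"
    and g: "\<And>y. y \<in> sball q \<Longrightarrow> g y = 0" and x: "x \<in> cube q"
    and X: "(\<integral>\<^sup>+y. ennreal (cmod (g y) powr 2) \<partial>lebesgue) \<le> ennreal X" "0 \<le> X"
  shows "(\<integral>\<^sup>+y. ennreal (cmod (K x y * g y)) \<partial>lebesgue) \<le> ennreal (\<bar>c\<bar> * (2 * sqrt X * sqrt ((8 / 3) ^ CARD('n) * unit_ball_volume TYPE('n))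
       * (3 * real CARD('n) * snd q) powr (-(real CARD('n) / 2)) / (1 - 2 powr (-(real CARD('n) / 2)))))"
proof -
  have "(\<integral>\<^sup>+y. ennreal (cmod (K x y * g y)) \<partial>lebesgue)
      \<le> (\<integral>\<^sup>+y. ennreal \<bar>c\<bar> * (ennreal (norm (x - y) powr (-real CARD('n))) * ennreal (cmod (g y))) \<partial>lebesgue)"
  proof (rule nn_integral_mono)
    fix y
    show "ennreal (cmod (K x y * g y)) \<le> ennreal \<bar>c\<bar> * (ennreal (norm (x - y) powr (-real CARD('n))) * ennreal (cmod (g y)))"
    proof (cases "x = y")
      case True
      then have "g y = 0" using g x cube_subset_sball by blast
      then show ?thesis by simp
    next
      case False
      from mult_right_mono[OF kernel_size[OF this], of "cmod (g y)"]
      show ?thesis by (simp add: norm_mult mult.assoc ennreal_leI flip: ennreal_mult)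
    qed
  qed
  also have "\<dots> = ennreal \<bar>c\<bar> * (\<integral>\<^sup>+y. ennreal (norm (x - y) powr (-real CARD('n))) * ennreal (cmod (g y)) \<partial>lebesgue)"
    by (intro nn_integral_cmult borel_measurable_times_ennreal norm_powr_measurable) measurable
  also have "\<dots> \<le> ennreal \<bar>c\<bar> * ennreal (2 * sqrt X * sqrt ((8 / 3) ^ CARD('n) * unit_ball_volume TYPE('n))
       * (3 * real CARD('n) * snd q) powr (-(real CARD('n) / 2)) / (1 - 2 powr (-(real CARD('n) / 2))))"
    using X g by (intro mult_left_mono kernel_tail_L2 x) (auto simp: ennreal_pow_ennreal)
  finally show ?thesis by (simp only: ennreal_mult' abs_ge_zero)
qed

lemma L2_bound:
  assumes "g \<in> Lp 2"
  obtains X where "0 \<le> X" "(\<integral>\<^sup>+y. ennreal (cmod (g y) powr 2) \<partial>lebesgue) = ennreal X"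
  using assms by (cases "\<integral>\<^sup>+y. ennreal (cmod (g y) powr 2) \<partial>lebesgue") (auto simp: Lp_iff)

lemma kernel_integrable:
  assumes g: "g \<in> Lp 2" "\<And>y. y \<in> sball q \<Longrightarrow> g y = 0" and x: "x \<in> cube q"
  shows "integrable lebesgue (\<lambda>y. K x y * g y)"
proof (rule integrableI_bounded)
  have [measurable]: "g \<in> borel_measurable lebesgue" using g by (rule_tac Lp_measurable)
  show "(\<lambda>y. K x y * g y) \<in> borel_measurable lebesgue"
    using outside_support(2)[OF g(2) x] by (intro kernel_mult_measurable) auto
  obtain X where "0 \<le> X" "(\<integral>\<^sup>+y. ennreal (cmod (g y) powr 2) \<partial>lebesgue) = ennreal X"
    using L2_bound[OF g(1)] .
  then show "(\<integral>\<^sup>+y. ennreal (norm (K x y * g y)) \<partial>lebesgue) < \<infinity>"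
    by (intro le_less_trans[OF nn_integral_kernel_le[OF _ g(2) x, where X = X]]) auto
qed

lemma T_tail_le:
  assumes g: "g \<in> Lp 2" "\<And>y. y \<in> sball q \<Longrightarrow> g y = 0" and x: "x \<in> cube q"
    and X: "(\<integral>\<^sup>+y. ennreal (cmod (g y) powr 2) \<partial>lebesgue) \<le> ennreal X" "0 \<le> X"
  shows "ennreal (cmod (T g x)) \<le> ennreal (\<bar>c\<bar> * (2 * sqrt X * sqrt ((8 / 3) ^ CARD('n) * unit_ball_volume TYPE('n))
       * (3 * real CARD('n) * snd q) powr (-(real CARD('n) / 2)) / (1 - 2 powr (-(real CARD('n) / 2)))))"
proof -
  have [measurable]: "g \<in> borel_measurable lebesgue" using g by (rule_tac Lp_measurable)
  have "T g x = (\<integral>y. K x y * g y \<partial>lebesgue)"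
    using outside_support(1)[OF g(2) x] by (intro repr g) auto
  then have "ennreal (cmod (T g x)) \<le> (\<integral>\<^sup>+y. ennreal (cmod (K x y * g y)) \<partial>lebesgue)"
    using kernel_integrable[OF g x] by (simp add: integral_norm_bound_ennreal)
  also note nn_integral_kernel_le[OF _ g(2) x X]
  finally show ?thesis by simp
qed

definition osc_const :: real where
  "osc_const = \<bar>c\<bar> * real CARD('n) powr \<delta> * ((8 / 3) ^ CARD('n) * unit_ball_volume TYPE('n)
     * (3 * real CARD('n)) powr (-\<delta>) / (1 - 2 powr (-\<delta>)))"

lemma osc_const_nonneg: "0 \<le> osc_const"
  unfolding osc_const_def using delta powr_less_mono[of "-\<delta>" 0 2] unit_ball_volume_pos[where 'n='n]
  by (intro mult_nonneg_nonneg divide_nonneg_nonneg) auto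

text \<open>Off \<open>sball q\<close> the smoothness condition applies to the pair
  \<open>x\<close>, \<open>x'\<close> and gives at most a multiple of \<open>side^\<delta>\<close>
  times the tail kernel. The tail estimate returns \<open>side^(-\<delta>)\<close>, so the constant
  does not depend on the cube.\<close>

lemma T_osc_le:
  assumes g: "g \<in> Lp 2" "\<And>y. y \<in> sball q \<Longrightarrow> g y = 0" and x: "x \<in> cube q" "x' \<in> cube q"
  shows "ennreal (cmod (T g x - T g x')) \<le> ennreal osc_const * maximal_op (\<lambda>y. ennreal (cmod (g y))) x'"
proof -
  let ?N = "real CARD('n)"
  have s: "0 < snd q" using x cube_empty[of q] by (cases "0 < snd q") auto
  have [measurable]: "g \<in> borel_measurable lebesgue" using g by (rule_tac Lp_measurable)
  have T: "T g z = (\<integral>y. K z y * g y \<partial>lebesgue)" if "z \<in> cube q" for z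
    using outside_support(1)[OF g(2) that] by (intro repr g) auto
  note int = kernel_integrable[OF g x(1)] kernel_integrable[OF g x(2)]
  have "T g x - T g x' = (\<integral>y. K x y * g y - K x' y * g y \<partial>lebesgue)"
    using int by (simp add: T x)
  then have "ennreal (cmod (T g x - T g x')) \<le> (\<integral>\<^sup>+y. ennreal (cmod (K x y * g y - K x' y * g y)) \<partial>lebesgue)"
    using integral_norm_bound_ennreal[OF Bochner_Integration.integrable_diff[OF int]] by simp
  also have "\<dots> \<le> (\<integral>\<^sup>+y. ennreal (\<bar>c\<bar> * (?N * snd q) powr \<delta>)
      * (ennreal (norm (x - y) powr (-(?N + \<delta>))) * ennreal (cmod (g y))) \<partial>lebesgue)"
  proof (rule nn_integral_mono)
    fix y
    show "ennreal (cmod (K x y * g y - K x' y * g y)) \<le> ennreal (\<bar>c\<bar> * (?N * snd q) powr \<delta>)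
      * (ennreal (norm (x - y) powr (-(?N + \<delta>))) * ennreal (cmod (g y)))"
    proof (cases "y \<in> sball q")
      case False
      have d: "norm (x - x') < ?N * snd q" by (rule cube_norm_diff_le[OF x])
      have "3 * (?N * snd q) \<le> norm (x - y)"
        using dist_off_sball[OF x(1) False] by linarith
      moreover have "0 < ?N * snd q" using s by simp
      ultimately have "norm (x - x') < norm (x - y) / 2" using d by linarith
      then have "cmod (K x y - K x' y) \<le> \<bar>c\<bar> * norm (x - x') powr \<delta> * norm (x - y) powr (-(?N + \<delta>))"
        by (rule kernel_smooth)
      also have "\<dots> \<le> \<bar>c\<bar> * (?N * snd q) powr \<delta> * norm (x - y) powr (-(?N + \<delta>))"
        using d delta by (intro mult_right_mono mult_left_mono powr_mono2) auto
      finally have "cmod (K x y - K x' y) * cmod (g y)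
          \<le> \<bar>c\<bar> * (?N * snd q) powr \<delta> * norm (x - y) powr (-(?N + \<delta>)) * cmod (g y)"
        by (rule mult_right_mono) simp
      then show ?thesis
        by (simp add: mult.assoc ennreal_leI flip: norm_mult ennreal_mult left_diff_distrib)
    qed (simp add: g)
  qed
  also have "\<dots> = ennreal (\<bar>c\<bar> * (?N * snd q) powr \<delta>)
      * (\<integral>\<^sup>+y. ennreal (norm (x - y) powr (-(?N + \<delta>))) * ennreal (cmod (g y)) \<partial>lebesgue)"
    by (intro nn_integral_cmult borel_measurable_times_ennreal norm_powr_measurable) measurable
  also have "\<dots> \<le> ennreal (\<bar>c\<bar> * (?N * snd q) powr \<delta>)
      * (ennreal ((8 / 3) ^ CARD('n) * unit_ball_volume TYPE('n) * (3 * ?N * snd q) powr (-\<delta>) / (1 - 2 powr (-\<delta>)))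
      * maximal_op (\<lambda>y. ennreal (cmod (g y))) x')"
    using g delta by (intro mult_left_mono kernel_tail_maximal x) auto
  also have "\<dots> = ennreal (\<bar>c\<bar> * (?N * snd q) powr \<delta>
      * ((8 / 3) ^ CARD('n) * unit_ball_volume TYPE('n) * (3 * ?N * snd q) powr (-\<delta>) / (1 - 2 powr (-\<delta>))))
      * maximal_op (\<lambda>y. ennreal (cmod (g y))) x'"
    by (simp only: ennreal_mult' mult.assoc abs_ge_zero powr_ge_zero)
  also have "\<bar>c\<bar> * (?N * snd q) powr \<delta>
      * ((8 / 3) ^ CARD('n) * unit_ball_volume TYPE('n) * (3 * ?N * snd q) powr (-\<delta>) / (1 - 2 powr (-\<delta>))) = osc_const"
  proof -
    have "(?N * snd q) powr \<delta> = ?N powr \<delta> * snd q powr \<delta>"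
      "(3 * ?N * snd q) powr (-\<delta>) = (3 * ?N) powr (-\<delta>) * snd q powr (-\<delta>)"
      using s by (simp_all add: powr_mult)
    moreover have "snd q powr \<delta> * snd q powr (-\<delta>) = 1" using s by (simp flip: powr_add)
    ultimately show ?thesis by (simp add: osc_const_def mult_ac)
  qed
  finally show ?thesis .
qed

end

section \<open>Maximal modulations\<close>

lemma maximal_op_mono: "(\<And>y. g y \<le> h y) \<Longrightarrow> maximal_op g x \<le> maximal_op h x"
  unfolding maximal_op_def
  by (intro SUP_mono') (auto intro!: divide_right_mono_ennreal nn_integral_mono mult_right_mono)

definition sball_ratio :: "'n::finite itself \<Rightarrow> real" where
  "sball_ratio _ = (4 * real CARD('n)) ^ CARD('n) * unit_ball_volume TYPE('n)"

lemma sball_ratio_pos: "0 < sball_ratio TYPE('n::finite)"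
  unfolding sball_ratio_def using unit_ball_volume_pos[where 'n='n] by simp

lemma emeasure_sball:
  fixes q :: "(real^'n) \<times> real"
  assumes "0 \<le> snd q"
  shows "emeasure lebesgue (sball q) = ennreal (sball_ratio TYPE('n)) * emeasure lebesgue (cube q)"
proof -
  have "(4 * real CARD('n) * snd q) ^ CARD('n) * unit_ball_volume TYPE('n) = sball_ratio TYPE('n) * snd q ^ CARD('n)"
    by (simp add: sball_ratio_def power_mult_distrib)
  then show ?thesis
    using assms sball_ratio_pos[where 'n='n] emeasure_lebesgue_ball_eq[of "4 * real CARD('n) * snd q" "fst q"]
    by (simp add: emeasure_cube sball_def ennreal_mult)
qed

locale maximally_modulated = cz_operator T c \<delta> K
  for T :: "((real^'n) \<Rightarrow> complex) \<Rightarrow> (real^'n) \<Rightarrow> complex" and c \<delta> :: real and K +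
  fixes I :: "'i set" and \<phi> :: "'i \<Rightarrow> (real^'n) \<Rightarrow> real"
  assumes phase: "\<And>\<alpha>. \<alpha> \<in> I \<Longrightarrow> \<phi> \<alpha> \<in> borel_measurable lebesgue"
begin

abbreviation Tm :: "((real^'n) \<Rightarrow> complex) \<Rightarrow> (real^'n) \<Rightarrow> ennreal" where
  "Tm \<equiv> max_modulated T I \<phi>"

definition modulate :: "'i \<Rightarrow> ((real^'n) \<Rightarrow> complex) \<Rightarrow> (real^'n) \<Rightarrow> complex" where
  "modulate \<alpha> f = (\<lambda>y. exp (2 * pi * \<i> * \<phi> \<alpha> y) * f y)"

lemma Tm_eq: "Tm f x = (SUP \<alpha>\<in>I. ennreal (cmod (T (modulate \<alpha> f) x)))"
  by (simp add: max_modulated_def modulate_def)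

text \<open>The phases are real, so bounds for \<open>T g\<close> that depend on
  \<open>cmod g\<close> alone hold for all modulations at once and pass to the supremum over
  \<open>I\<close>.\<close>

lemma cmod_modulate [simp]: "cmod (modulate \<alpha> f y) = cmod (f y)"
  by (simp add: modulate_def norm_mult norm_exp_eq_Re)

lemma modulate_Lp: "\<alpha> \<in> I \<Longrightarrow> f \<in> Lp 2 \<Longrightarrow> modulate \<alpha> f \<in> Lp 2"
proof (rule Lp_dominated[of f])
  assume "\<alpha> \<in> I" "f \<in> Lp 2"
  note [measurable] = phase[OF this(1)] Lp_measurable[OF this(2)]
  show "modulate \<alpha> f \<in> borel_measurable lebesgue" unfolding modulate_def by measurable
qed auto

lemma modulate_linear: "modulate \<alpha> (\<lambda>y. a * f y + b * g y) = (\<lambda>y. a * modulate \<alpha> f y + b * modulate \<alpha> g y)"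
  by (simp add: modulate_def algebra_simps)

text \<open>Linearity inside the supremum; the coefficients \<open>1\<close> and \<open>-1\<close>
  yield subadditivity for sums and for differences.\<close>

lemma Tm_linear_le:
  assumes "f \<in> Lp 2" "g \<in> Lp 2" "cmod a \<le> 1" "cmod b \<le> 1"
  shows "Tm (\<lambda>y. a * f y + b * g y) x \<le> Tm f x + Tm g x"
  unfolding Tm_eq[of "\<lambda>y. a * f y + b * g y"]
proof (rule SUP_least)
  fix \<alpha> assume \<alpha>: "\<alpha> \<in> I"
  have "T (modulate \<alpha> (\<lambda>y. a * f y + b * g y)) x = a * T (modulate \<alpha> f) x + b * T (modulate \<alpha> g) x"
    unfolding modulate_linear using modulate_Lp[OF \<alpha>] assms by (simp add: linear)
  also have "cmod \<dots> \<le> cmod (T (modulate \<alpha> f) x) + cmod (T (modulate \<alpha> g) x)"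
    by (rule order_trans[OF norm_triangle_ineq])
       (use assms in \<open>auto simp: norm_mult intro!: add_mono mult_left_le_one_le\<close>)
  finally have "ennreal (cmod (T (modulate \<alpha> (\<lambda>y. a * f y + b * g y)) x))
      \<le> ennreal (cmod (T (modulate \<alpha> f) x)) + ennreal (cmod (T (modulate \<alpha> g) x))"
    by (simp add: ennreal_leI flip: ennreal_plus)
  also have "\<dots> \<le> Tm f x + Tm g x"
    unfolding Tm_eq using \<alpha> by (intro add_mono SUP_upper)
  finally show "ennreal (cmod (T (modulate \<alpha> (\<lambda>y. a * f y + b * g y)) x)) \<le> Tm f x + Tm g x" .
qed

lemma Tm_add_le: "f \<in> Lp 2 \<Longrightarrow> g \<in> Lp 2 \<Longrightarrow> Tm (\<lambda>y. f y + g y) x \<le> Tm f x + Tm g x"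
  using Tm_linear_le[of f g 1 1 x] by simp

lemma Tm_diff_le: "f \<in> Lp 2 \<Longrightarrow> g \<in> Lp 2 \<Longrightarrow> Tm (\<lambda>y. f y - g y) x \<le> Tm f x + Tm g x"
  using Tm_linear_le[of f g 1 "-1" x] by simp

lemma Tm_osc_le:
  assumes g: "g \<in> Lp 2" "\<And>y. y \<in> sball q \<Longrightarrow> g y = 0" and x: "x \<in> cube q" "x' \<in> cube q"
  shows "Tm g x \<le> Tm g x' + ennreal osc_const * maximal_op (\<lambda>y. ennreal (cmod (g y))) x'"
  unfolding Tm_eq[of g x]
proof (rule SUP_least)
  fix \<alpha> assume \<alpha>: "\<alpha> \<in> I"
  have z: "modulate \<alpha> g y = 0" if "y \<in> sball q" for y using g(2)[OF that] by (simp add: modulate_def)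
  have "cmod (T (modulate \<alpha> g) x) \<le> cmod (T (modulate \<alpha> g) x') + cmod (T (modulate \<alpha> g) x - T (modulate \<alpha> g) x')"
    by (metis add.commute diff_add_cancel norm_triangle_ineq)
  then have "ennreal (cmod (T (modulate \<alpha> g) x))
      \<le> ennreal (cmod (T (modulate \<alpha> g) x')) + ennreal (cmod (T (modulate \<alpha> g) x - T (modulate \<alpha> g) x'))"
    by (simp add: ennreal_leI flip: ennreal_plus)
  also have "\<dots> \<le> Tm g x' + ennreal osc_const * maximal_op (\<lambda>y. ennreal (cmod (modulate \<alpha> g y))) x'"
    unfolding Tm_eq by (intro add_mono SUP_upper \<alpha> T_osc_le[where q = q] modulate_Lp g(1) z x) auto
  finally show "ennreal (cmod (T (modulate \<alpha> g) x)) \<le> Tm g x' + ennreal osc_const * maximal_op (\<lambda>y. ennreal (cmod (g y))) x'"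
    by simp
qed

lemma Tm_tail_le:
  assumes g: "g \<in> Lp 2" "\<And>y. y \<in> sball q \<Longrightarrow> g y = 0" and x: "x \<in> cube q"
    and X: "(\<integral>\<^sup>+y. ennreal (cmod (g y) powr 2) \<partial>lebesgue) \<le> ennreal X" "0 \<le> X"
  shows "Tm g x \<le> ennreal (\<bar>c\<bar> * (2 * sqrt X * sqrt ((8 / 3) ^ CARD('n) * unit_ball_volume TYPE('n))
       * (3 * real CARD('n) * snd q) powr (-(real CARD('n) / 2)) / (1 - 2 powr (-(real CARD('n) / 2)))))"
  unfolding Tm_eq
proof (rule SUP_least)
  fix \<alpha> assume \<alpha>: "\<alpha> \<in> I"
  have z: "modulate \<alpha> g y = 0" if "y \<in> sball q" for y using g(2)[OF that] by (simp add: modulate_def)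
  show "ennreal (cmod (T (modulate \<alpha> g) x)) \<le> ennreal (\<bar>c\<bar> * (2 * sqrt X * sqrt ((8 / 3) ^ CARD('n) * unit_ball_volume TYPE('n))
       * (3 * real CARD('n) * snd q) powr (-(real CARD('n) / 2)) / (1 - 2 powr (-(real CARD('n) / 2)))))"
    using X by (intro T_tail_le modulate_Lp \<alpha> g z x) auto
qed

end

section \<open>Exceptional sets and the stopping tree\<close>

locale weak_type_modulated = maximally_modulated T c \<delta> K I \<phi>
  for T :: "((real^'n) \<Rightarrow> complex) \<Rightarrow> (real^'n) \<Rightarrow> complex" and c \<delta> :: real and K
    and I :: "'i set" and \<phi> :: "'i \<Rightarrow> (real^'n) \<Rightarrow> real" +
  fixes r B :: real
  assumes r: "1 < r" "r \<le> 2" and B: "0 \<le> B"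
    and weak_type: "\<And>f. f \<in> Lp 2 \<Longrightarrow> f \<in> Lp r \<Longrightarrow> weak_Lp_norm r (Tm f) \<le> ennreal B * Lp_norm r f"
begin

definition avg :: "((real^'n) \<Rightarrow> complex) \<Rightarrow> (real^'n) \<times> real \<Rightarrow> ennreal" where
  "avg f q = ennreal_pow ((\<integral>\<^sup>+y\<in>sball q. ennreal (cmod (f y) powr r) \<partial>lebesgue) / emeasure lebesgue (sball q)) (1 / r)"

lemma local_Lp:
  assumes "f \<in> Lp 2"
  shows "restr (sball q) f \<in> Lp 2" "restr (sball q) f \<in> Lp r"
proof -
  show "restr (sball q) f \<in> Lp 2" by (rule restr_Lp[OF assms]) auto
  show "restr (sball q) f \<in> Lp r"
    using r emeasure_lebesgue_ball_finite by (intro restr_Lp_le[OF assms]) (auto simp: sball_def less_top)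
qed

lemma nn_integral_restr:
  "(\<integral>\<^sup>+y. ennreal (cmod (restr (sball q) f y) powr r) \<partial>lebesgue) = (\<integral>\<^sup>+y\<in>sball q. ennreal (cmod (f y) powr r) \<partial>lebesgue)"
  using r by (intro nn_integral_cong) (auto simp: restr_def indicator_def)

lemma avg_finite:
  assumes f: "f \<in> Lp 2" and q: "0 < snd q"
  obtains a where "avg f q = ennreal a" "0 \<le> a"
    "(\<integral>\<^sup>+y\<in>sball q. ennreal (cmod (f y) powr r) \<partial>lebesgue) = ennreal (a powr r * (sball_ratio TYPE('n) * snd q ^ CARD('n)))"
proof -
  let ?s = "sball_ratio TYPE('n) * snd q ^ CARD('n)"
  have s: "0 < ?s" using sball_ratio_pos[where 'n='n] q by simp
  have m: "emeasure lebesgue (sball q) = ennreal ?s"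
    using q sball_ratio_pos[where 'n='n] by (simp add: emeasure_sball emeasure_cube ennreal_mult)
  obtain X where X: "(\<integral>\<^sup>+y\<in>sball q. ennreal (cmod (f y) powr r) \<partial>lebesgue) = ennreal X" "0 \<le> X"
    using local_Lp(2)[OF f, of q] unfolding Lp_iff nn_integral_restr
    by (cases "\<integral>\<^sup>+y\<in>sball q. ennreal (cmod (f y) powr r) \<partial>lebesgue") auto
  show thesis
  proof
    show "avg f q = ennreal ((X / ?s) powr (1 / r))"
      unfolding avg_def X m using s X by (simp add: divide_ennreal ennreal_pow_ennreal)
    show "(\<integral>\<^sup>+y\<in>sball q. ennreal (cmod (f y) powr r) \<partial>lebesgue) = ennreal (((X / ?s) powr (1 / r)) powr r * ?s)"
    proof -
      have "((X / ?s) powr (1 / r)) powr r = X / ?s" using s X r by (simp add: powr_powr)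
      moreover have "X / ?s * ?s = X" using s by (metis less_irrefl nonzero_eq_divide_eq)
      ultimately show ?thesis by (simp only: X(1))
    qed
  qed simp
qed

text \<open>The weak type bound for the local piece at height \<open>A * avg f q\<close>. Its
  \<open>L^r\<close> norm is \<open>avg f q\<close> times the volume of \<open>sball q\<close> to
  the power \<open>1 / r\<close>, so the average cancels.\<close>

lemma outer_measure_Tm_le:
  assumes f: "f \<in> Lp 2" and q: "0 < snd q" and A: "0 < A"
  shows "outer_measure_of lebesgue {x. ennreal A * avg f q < Tm (restr (sball q) f) x}
    \<le> ennreal ((B / A) powr r * (sball_ratio TYPE('n) * snd q ^ CARD('n)))"
proof -
  let ?s = "sball_ratio TYPE('n) * snd q ^ CARD('n)" and ?f = "restr (sball q) f"
  let ?o = "\<lambda>t. outer_measure_of lebesgue {x. ennreal t < Tm ?f x}"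
  have s: "0 < ?s" using sball_ratio_pos[where 'n='n] q by simp
  obtain a where a: "avg f q = ennreal a" "0 \<le> a"
    "(\<integral>\<^sup>+y\<in>sball q. ennreal (cmod (f y) powr r) \<partial>lebesgue) = ennreal (a powr r * ?s)"
    using avg_finite[OF f q] by blast
  have norm: "Lp_norm r ?f = ennreal (a * ?s powr (1 / r))"
    unfolding Lp_norm_def nn_integral_restr a(3) using a s r
    by (simp add: ennreal_pow_ennreal powr_mult powr_powr)
  have weak: "ennreal t * ennreal_pow (?o t) (1 / r) \<le> ennreal (B * (a * ?s powr (1 / r)))" if "0 < t" for t
  proof -
    have "ennreal t * ennreal_pow (?o t) (1 / r) \<le> weak_Lp_norm r (Tm ?f)"
      unfolding weak_Lp_norm_def using that by (intro SUP_upper) auto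
    also have "\<dots> \<le> ennreal B * Lp_norm r ?f" by (intro weak_type local_Lp f)
    also have "\<dots> = ennreal (B * (a * ?s powr (1 / r)))" using B a unfolding norm by (simp add: ennreal_mult)
    finally show ?thesis .
  qed
  show ?thesis
  proof (cases "a = 0")
    case True
    \<comment> \<open>If the average vanishes, the relevant height is \<open>0\<close>, which the
      weak norm does not test. The positive heights \<open>1 / Suc n\<close> give sets of outer
      measure \<open>0\<close>, and these exhaust the set where the operator is positive.\<close>
    have null: "\<exists>Z\<in>null_sets lebesgue. {x. ennreal (1 / Suc n) < Tm ?f x} \<subseteq> Z" for n
    proof -
      have "ennreal (1 / Suc n) * ennreal_pow (?o (1 / Suc n)) (1 / r) \<le> 0"
        using weak[of "1 / Suc n"] True by simp
      then have "ennreal_pow (?o (1 / Suc n)) (1 / r) = 0" by simp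
      then have o: "?o (1 / Suc n) = 0"
        using r by (cases "?o (1 / Suc n)") (auto simp: ennreal_pow_ennreal)
      obtain Z where "Z \<in> sets lebesgue" "{x. ennreal (1 / Suc n) < Tm ?f x} \<subseteq> Z" "?o (1 / Suc n) = emeasure lebesgue Z"
        using outer_measure_of_attain[of "{x. ennreal (1 / Suc n) < Tm ?f x}" lebesgue] by auto
      with o show ?thesis by (auto simp: null_sets_def)
    qed
    then obtain Z where Z: "\<And>n. Z n \<in> null_sets lebesgue" "\<And>n. {x. ennreal (1 / Suc n) < Tm ?f x} \<subseteq> Z n"
      by metis
    have "{x. ennreal A * avg f q < Tm ?f x} \<subseteq> (\<Union>n. Z n)"
    proof
      fix x assume "x \<in> {x. ennreal A * avg f q < Tm ?f x}"
      then have "0 < Tm ?f x" using a True by simp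
      then obtain y where y: "0 < y" "y < Tm ?f x" using dense by blast
      then obtain e where e: "0 < e" "ennreal e < Tm ?f x"
        by (cases y) auto
      obtain n where "1 / Suc n < e" using e(1) nat_approx_posE by blast
      then have "ennreal (1 / Suc n) < Tm ?f x" using e by (meson ennreal_leI less_imp_le le_less_trans)
      then show "x \<in> (\<Union>n. Z n)" using Z(2)[of n] by auto
    qed
    then have "outer_measure_of lebesgue {x. ennreal A * avg f q < Tm ?f x} \<le> outer_measure_of lebesgue (\<Union>n. Z n)"
      by (rule outer_measure_of_mono)
    also have "\<dots> = 0"
    proof -
      have "(\<Union>n. Z n) \<in> null_sets lebesgue" by (intro null_sets_UN Z(1))
      then show ?thesis by (simp add: null_setsD1 null_setsD2)
    qed
    finally show ?thesis by simp
  next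
    case False
    then have a0: "0 < a" using a by simp
    define t where "t = A * a"
    have t: "0 < t" using A a0 by (simp add: t_def)
    have eq: "ennreal A * avg f q = ennreal t" using a A by (simp add: t_def ennreal_mult)
    have "?o t \<noteq> top" using weak[OF t] t by (auto simp: ennreal_mult_top top_unique)
    then obtain m where m: "?o t = ennreal m" "0 \<le> m" by (cases "?o t") auto
    have "t * m powr (1 / r) \<le> B * (a * ?s powr (1 / r))"
      using weak[OF t] t m B a s by (simp add: ennreal_pow_ennreal ennreal_le_iff2 flip: ennreal_mult)
        (smt (verit) mult_nonneg_nonneg powr_ge_zero)
    then have "m powr (1 / r) \<le> B / A * ?s powr (1 / r)"
      using A a0 by (simp add: t_def field_simps)
    then have "(m powr (1 / r)) powr r \<le> (B / A * ?s powr (1 / r)) powr r"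
      using r by (intro powr_mono2) auto
    moreover have "(m powr (1 / r)) powr r = m" using m r by (simp add: powr_powr)
    moreover have "(b * y powr (1 / r)) powr r = b powr r * y" if "0 \<le> b" "0 < y" for b y :: real
      using that r by (simp add: powr_mult powr_powr)
    then have "(B / A * ?s powr (1 / r)) powr r = (B / A) powr r * ?s"
      using s B A by (metis divide_nonneg_pos)
    ultimately have "m \<le> (B / A) powr r * ?s" by (simp only:)
    then show ?thesis unfolding eq m by (rule ennreal_leI)
  qed
qed

text \<open>Weak type \<open>(1,1)\<close> at height \<open>A * avg f q\<close>; the
  \<open>L^1\<close> norm of the local piece is bounded through its \<open>L^r\<close> average,
  which costs the factor \<open>2\<close>.\<close>

lemma emeasure_maximal_le:
  assumes f: "f \<in> Lp 2" and q: "0 < snd q" and A: "0 < A"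
  shows "emeasure lebesgue {x. ennreal A * avg f q < maximal_op (\<lambda>y. ennreal (cmod (restr (sball q) f y))) x}
    \<le> ennreal (2 * 5 ^ CARD('n) / A * (sball_ratio TYPE('n) * snd q ^ CARD('n)))"
proof -
  let ?s = "sball_ratio TYPE('n) * snd q ^ CARD('n)" and ?f = "restr (sball q) f"
  let ?M = "maximal_op (\<lambda>y. ennreal (cmod (?f y)))"
  have [measurable]: "f \<in> borel_measurable lebesgue" using f by (rule Lp_measurable)
  have s: "0 < ?s" using sball_ratio_pos[where 'n='n] q by simp
  obtain a where a: "avg f q = ennreal a" "0 \<le> a"
    using avg_finite[OF f q] by blast
  have m: "emeasure lebesgue (sball q) = ennreal ?s"
    using q sball_ratio_pos[where 'n='n] by (simp add: emeasure_sball emeasure_cube ennreal_mult)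
  have "(\<integral>\<^sup>+y. ennreal (cmod (?f y)) \<partial>lebesgue) = (\<integral>\<^sup>+y\<in>sball q. ennreal (cmod (f y)) \<partial>lebesgue)"
    by (intro nn_integral_cong) (auto simp: restr_def indicator_def)
  also have "\<dots> \<le> 2 * emeasure lebesgue (sball q) * avg f q"
  proof -
    have "emeasure lebesgue (sball q) \<noteq> 0" "emeasure lebesgue (sball q) \<noteq> top"
      unfolding m using s by (metis ennreal_eq_0_iff not_le) simp
    then show ?thesis
      using nn_integral_le_power_mean[of "\<lambda>y. ennreal (cmod (f y))" lebesgue "sball q" r] r
      unfolding avg_def by (simp add: ennreal_pow_ennreal)
  qed
  also have "\<dots> = ennreal (2 * ?s * a)" using a s by (simp add: m ennreal_mult)
  finally have int: "(\<integral>\<^sup>+y. ennreal (cmod (?f y)) \<partial>lebesgue) \<le> ennreal (2 * ?s * a)" .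
  show ?thesis
  proof (cases "a = 0")
    case True
    have "?M x \<le> 0" for x
    proof (rule maximal_op_leI)
      fix z \<rho>
      have "(\<integral>\<^sup>+y\<in>ball z \<rho>. ennreal (cmod (?f y)) \<partial>lebesgue) \<le> (\<integral>\<^sup>+y. ennreal (cmod (?f y)) \<partial>lebesgue)"
        by (intro nn_integral_mono) (auto simp: indicator_def)
      then show "(\<integral>\<^sup>+y\<in>ball z \<rho>. ennreal (cmod (?f y)) \<partial>lebesgue) \<le> 0 * emeasure lebesgue (ball z \<rho>)"
        using int True by simp
    qed
    then have "{x. ennreal A * avg f q < ?M x} = {}" using a True by auto
    then show ?thesis by simp
  next
    case False
    then have a0: "0 < a" using a by simp
    define t where "t = A * a"
    have t: "0 < t" using A a0 by (simp add: t_def)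
    have eq: "ennreal A * avg f q = ennreal t" using a A by (simp add: t_def ennreal_mult)
    have "ennreal t * emeasure lebesgue {x. ennreal t < ?M x} \<le> 5 ^ CARD('n) * (\<integral>\<^sup>+y. ennreal (cmod (?f y)) \<partial>lebesgue)"
      using t by (intro maximal_op_weak_type) auto
    also have "\<dots> \<le> 5 ^ CARD('n) * ennreal (2 * ?s * a)"
      by (intro mult_left_mono int) simp
    also have "\<dots> = ennreal t * ennreal (2 * 5 ^ CARD('n) / A * ?s)"
    proof -
      have "t * (2 * 5 ^ CARD('n) / A * ?s) = 5 ^ CARD('n) * (2 * ?s * a)"
        using A by (simp add: t_def)
      moreover have "(5 ^ CARD('n) :: ennreal) = ennreal (5 ^ CARD('n))"
        by (simp flip: ennreal_power)
      ultimately show ?thesis using t s A a by (simp only: ennreal_mult[symmetric]) (simp flip: ennreal_mult')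
    qed
    finally show ?thesis unfolding eq using t by (subst (asm) ennreal_mult_le_mult_iff) auto
  qed
qed

text \<open>Large enough that each of the two parts of the exceptional set has outer measure at most
  \<open>2^(-n-4)\<close> of the cube, for dimension \<open>n\<close>. The summand \<open>B\<close>
  keeps \<open>B / threshold\<close> below \<open>1\<close>, and the \<open>1\<close> makes the
  threshold positive.\<close>

definition threshold :: real where
  "threshold = 1 + B + (B + 2 * 5 ^ CARD('n)) * sball_ratio TYPE('n) * 2 ^ (CARD('n) + 4)"

lemma threshold_pos: "0 < threshold"
  unfolding threshold_def using B sball_ratio_pos[where 'n='n] by (intro add_pos_nonneg) auto

text \<open>Outside this set both the operator on the local piece and the maximal function of the
  piece are controlled by the average. The second control absorbs the error in the oscillation
  estimate.\<close>

definition exceptional :: "((real^'n) \<Rightarrow> complex) \<Rightarrow> (real^'n) \<times> real \<Rightarrow> (real^'n) set" where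
  "exceptional f q = {x. ennreal threshold * avg f q < Tm (restr (sball q) f) x}
     \<union> {x. ennreal threshold * avg f q < maximal_op (\<lambda>y. ennreal (cmod (restr (sball q) f y))) x}"

text \<open>The part from \<open>Tm\<close> may be non-measurable and is replaced by a measurable
  hull of the same outer measure; outer regularity then encloses everything in an open set. Hull,
  maximal part and enclosure contribute \<open>e = |Q| / 2^(n+4)\<close> each, and
  \<open>2^(n+2) * 3 e\<close> is \<open>3/4\<close> of the volume of the cube.\<close>

lemma exceptional_open_cover:
  assumes f: "f \<in> Lp 2" and q: "0 < snd q"
  shows "\<exists>U. open U \<and> exceptional f q \<subseteq> U
    \<and> 2 ^ (CARD('n) + 2) * emeasure lebesgue U \<le> emeasure lebesgue (cube q)"
proof -
  let ?n = "CARD('n)"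
  define \<kappa> where "\<kappa> = sball_ratio TYPE('n)"
  define v where "v = snd q ^ ?n"
  define e where "e = v / 2 ^ (?n + 4)"
  have pos: "0 < \<kappa>" "0 < v" "0 < e" using sball_ratio_pos[where 'n='n] q by (auto simp: \<kappa>_def v_def e_def)
  have threshold: "B \<le> threshold" "B * \<kappa> * 2 ^ (?n + 4) \<le> threshold" "2 * 5 ^ ?n * \<kappa> * 2 ^ (?n + 4) \<le> threshold"
  proof -
    have "0 \<le> B * \<kappa> * 2 ^ (?n + 4)" "0 \<le> 2 * 5 ^ ?n * \<kappa> * 2 ^ (?n + 4)" using B pos by auto
    moreover have "threshold = 1 + B + B * \<kappa> * 2 ^ (?n + 4) + 2 * 5 ^ ?n * \<kappa> * 2 ^ (?n + 4)"
      by (simp only: threshold_def \<kappa>_def distrib_right add.assoc)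
    ultimately show "B \<le> threshold" "B * \<kappa> * 2 ^ (?n + 4) \<le> threshold" "2 * 5 ^ ?n * \<kappa> * 2 ^ (?n + 4) \<le> threshold"
      using B by linarith+
  qed
  have small1: "(B / threshold) powr r * (\<kappa> * v) \<le> e"
  proof -
    have "(B / threshold) powr r \<le> B / threshold"
      using powr_mono'[of 1 r "B / threshold"] r B threshold threshold_pos by simp
    then have "(B / threshold) powr r * (\<kappa> * v) \<le> B / threshold * (\<kappa> * v)"
      using pos by (intro mult_right_mono) auto
    also have "\<dots> \<le> e"
      using mult_right_mono[OF threshold(2), of v] pos threshold_pos by (simp add: e_def field_simps)
    finally show ?thesis .
  qed
  have small2: "2 * 5 ^ ?n / threshold * (\<kappa> * v) \<le> e"
    using mult_right_mono[OF threshold(3), of v] pos threshold_pos by (simp add: e_def field_simps)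
  let ?E1 = "{x. ennreal threshold * avg f q < Tm (restr (sball q) f) x}"
  let ?E2 = "{x. ennreal threshold * avg f q < maximal_op (\<lambda>y. ennreal (cmod (restr (sball q) f y))) x}"
  have "outer_measure_of lebesgue ?E1 \<le> ennreal e"
    using outer_measure_Tm_le[OF f q threshold_pos] small1
    by (auto simp: \<kappa>_def v_def intro: order_trans ennreal_leI)
  moreover obtain H where H: "H \<in> sets lebesgue" "?E1 \<subseteq> H" "outer_measure_of lebesgue ?E1 = emeasure lebesgue H"
    using outer_measure_of_attain[of ?E1 lebesgue] by auto
  ultimately have e1: "emeasure lebesgue H \<le> ennreal e" by simp
  have E2: "?E2 \<in> sets lebesgue" by (intro sets_completionI_sets) (auto intro: borel_open open_maximal_op_greater)
  have e2: "emeasure lebesgue ?E2 \<le> ennreal e"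
    using emeasure_maximal_le[OF f q threshold_pos] small2
    by (auto simp: \<kappa>_def v_def intro: order_trans ennreal_leI)
  have HE: "H \<union> ?E2 \<in> sets lebesgue" using H E2 by auto
  from sets_lebesgue_outer_open[OF this pos(3)] obtain U where
    U: "open U" "H \<union> ?E2 \<subseteq> U" "emeasure lebesgue (U - (H \<union> ?E2)) < ennreal e" .
  have Us: "U \<in> sets lebesgue" using U(1) by (simp add: borel_open sets_completionI_sets)
  have "emeasure lebesgue U = emeasure lebesgue ((H \<union> ?E2) \<union> (U - (H \<union> ?E2)))"
    using U(2) by (intro arg_cong[where f = "emeasure lebesgue"]) blast
  also have "\<dots> \<le> emeasure lebesgue (H \<union> ?E2) + emeasure lebesgue (U - (H \<union> ?E2))"
    using HE Us by (intro emeasure_subadditive) auto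
  also have "\<dots> \<le> (emeasure lebesgue H + emeasure lebesgue ?E2) + ennreal e"
    using H(1) E2 U(3) by (intro add_mono emeasure_subadditive) auto
  also have "\<dots> \<le> (ennreal e + ennreal e) + ennreal e"
    by (intro add_mono e1 e2 order_refl)
  also have "\<dots> = ennreal (3 * e)" using pos by (simp flip: ennreal_plus)
  finally have "2 ^ (?n + 2) * emeasure lebesgue U \<le> 2 ^ (?n + 2) * ennreal (3 * e)"
    by (rule mult_left_mono) simp
  also have "\<dots> = ennreal (2 ^ (?n + 2) * (3 * e))"
  proof -
    have "(2 ^ (?n + 2) :: ennreal) = ennreal (2 ^ (?n + 2))" by (simp add: ennreal_power[symmetric] del: power_Suc)
    then show ?thesis using pos by (simp only:) (rule ennreal_mult[symmetric], auto)
  qed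
  also have "\<dots> \<le> ennreal v" using pos by (intro ennreal_leI) (simp add: e_def power_add)
  also have "ennreal v = emeasure lebesgue (cube q)" using q by (simp add: emeasure_cube v_def)
  finally show ?thesis using U H(2) unfolding exceptional_def by (intro exI[of _ U]) blast
qed

text \<open>The choice is made for all labels at once, empty cubes included, since
  \<open>sparse_tree\<close> quantifies over every label. \<open>U q\<close> fills at most a quarter
  of \<open>q\<close> and half of each child of \<open>q\<close>, so that every nonempty child has a
  point outside both its own \<open>U\<close> and that of its parent.\<close>

lemma sparse_selection:
  assumes f: "f \<in> Lp 2"
  obtains U :: "(real^'n) \<times> real \<Rightarrow> (real^'n) set" and kid :: "(real^'n) \<times> real \<Rightarrow> nat \<Rightarrow> (real^'n) \<times> real"
  where
    "\<And>q. 0 < snd q \<Longrightarrow> exceptional f q \<subseteq> U q"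
    "\<And>q. U q \<in> sets lebesgue"
    "\<And>q. 0 < snd q \<Longrightarrow> 4 * emeasure lebesgue (U q \<inter> cube q) \<le> emeasure lebesgue (cube q)"
    "\<And>q i. 0 < snd (kid q i) \<Longrightarrow> 2 * snd (kid q i) \<le> snd q"
    "\<And>q i. 0 < snd (kid q i) \<Longrightarrow> 2 * emeasure lebesgue (U q \<inter> cube (kid q i)) \<le> emeasure lebesgue (cube (kid q i))"
    "\<And>q. U q \<inter> cube q \<subseteq> (\<Union>i. cube (kid q i))"
    "sparse_tree lebesgue cube kid"
proof -
  let ?n = "CARD('n)"
  have "\<forall>q. \<exists>U. open U \<and> (0 < snd q \<longrightarrow> exceptional f q \<subseteq> U
    \<and> 2 ^ (?n + 2) * emeasure lebesgue U \<le> emeasure lebesgue (cube q))"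
    using exceptional_open_cover[OF f] by (metis open_empty)
  then obtain U where U: "\<And>q. open (U q)" "\<And>q. 0 < snd q \<Longrightarrow> exceptional f q \<subseteq> U q"
    "\<And>q. 0 < snd q \<Longrightarrow> 2 ^ (?n + 2) * emeasure lebesgue (U q) \<le> emeasure lebesgue (cube q)"
    by metis
  have Us [measurable, simp]: "U q \<in> sets lebesgue" for q
    using U(1)[of q] by (simp add: borel_open sets_completionI_sets)
  have small: "2 ^ (?n + 2) * emeasure lebesgue (U q \<inter> cube q) \<le> emeasure lebesgue (cube q)" if "0 < snd q" for q
    by (rule order_trans[OF mult_left_mono U(3)[OF that]]) (auto intro!: emeasure_mono)
  let ?P = "\<lambda>q kid. (\<forall>i. snd (kid i) = 0 \<or> 0 < snd (kid i) \<and> 2 * snd (kid i) \<le> snd q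
      \<and> 2 * emeasure lebesgue (U q \<inter> cube (kid i)) \<le> emeasure lebesgue (cube (kid i)))
    \<and> (\<forall>i. cube (kid i) \<subseteq> cube q) \<and> disjoint_family (\<lambda>i. cube (kid i))
    \<and> U q \<inter> cube q \<subseteq> (\<Union>i. cube (kid i))
    \<and> 2 * emeasure lebesgue (\<Union>i. cube (kid i)) \<le> emeasure lebesgue (cube q)"
  have "\<exists>kid :: nat \<Rightarrow> (real^'n) \<times> real. ?P q kid" for q
  proof (cases "0 < snd q")
    case True
    obtain kid :: "nat \<Rightarrow> (real^'n) \<times> real" where "?P q kid"
      by (rule calderon_zygmund_selection[OF True U(1) small[OF True]]) blast
    then show ?thesis by blast
  next
    case False
    then have "cube q = {}" by (intro cube_empty) simp
    then show ?thesis
      by (intro exI[of _ "\<lambda>_. (0, 0)"]) (simp add: cube_empty disjoint_family_on_def)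
  qed
  then obtain kid :: "(real^'n) \<times> real \<Rightarrow> nat \<Rightarrow> (real^'n) \<times> real" where kid: "\<And>q. ?P q (kid q)"
    by metis
  show thesis
  proof (rule that)
    show "sparse_tree lebesgue cube kid"
    proof
      fix q :: "(real^'n) \<times> real"
      show "emeasure lebesgue (cube q) < \<infinity>" using emeasure_cube_finite by simp
    qed (use kid in auto)
    fix q :: "(real^'n) \<times> real" assume q: "0 < snd q"
    have "4 * emeasure lebesgue (U q \<inter> cube q) \<le> 2 ^ (?n + 2) * emeasure lebesgue (U q \<inter> cube q)"
    proof (rule mult_right_mono)
      have "(1::ennreal) * 4 \<le> 2 ^ ?n * 4" by (intro mult_right_mono one_le_power) auto
      then show "(4::ennreal) \<le> 2 ^ (?n + 2)" by (simp add: power_add mult.commute)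
    qed simp
    also note small[OF q]
    finally show "4 * emeasure lebesgue (U q \<inter> cube q) \<le> emeasure lebesgue (cube q)" .
  next
    fix q i assume k: "0 < snd (kid q i)"
    with kid[of q] have "0 < snd (kid q i) \<and> 2 * snd (kid q i) \<le> snd q
      \<and> 2 * emeasure lebesgue (U q \<inter> cube (kid q i)) \<le> emeasure lebesgue (cube (kid q i))"
      by (metis less_irrefl)
    then show "2 * snd (kid q i) \<le> snd q"
      "2 * emeasure lebesgue (U q \<inter> cube (kid q i)) \<le> emeasure lebesgue (cube (kid q i))" by auto
  qed (use U kid in auto)
qed

section \<open>Comparison of a cube with its child\<close>

definition dom_const :: real where
  "dom_const = (1 + osc_const) * threshold"

lemma dom_const_nonneg: "0 \<le> dom_const"
  unfolding dom_const_def using osc_const_nonneg threshold_pos by simp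

lemma good_point_le:
  assumes "x \<notin> exceptional f q"
  shows "Tm (restr (sball q) f) x \<le> ennreal threshold * avg f q"
    "maximal_op (\<lambda>y. ennreal (cmod (restr (sball q) f y))) x \<le> ennreal threshold * avg f q"
  using assms by (auto simp: exceptional_def not_less)

lemma threshold_avg_le: "ennreal threshold * avg f q \<le> ennreal dom_const * avg f q"
  unfolding dom_const_def using osc_const_nonneg threshold_pos
  by (intro mult_right_mono ennreal_leI) (auto simp: algebra_simps)

text \<open>The difference \<open>g\<close> of the two local pieces vanishes on
  \<open>sball p\<close>, so on the smaller cube \<open>Tm g\<close> can be moved from
  \<open>x\<close> to \<open>x'\<close> at the cost of a maximal function. At \<open>x'\<close>,
  which is good for both cubes, sublinearity and the averages control every term.\<close>

lemma Tm_kid_le: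
  assumes f: "f \<in> Lp 2" and sub: "sball p \<subseteq> sball q"
    and x: "x \<in> cube p" "x' \<in> cube p" "x' \<notin> exceptional f q" "x' \<notin> exceptional f p"
  shows "Tm (restr (sball q) f) x
    \<le> ennreal dom_const * avg f q + ennreal dom_const * avg f p + Tm (restr (sball p) f) x"
proof -
  let ?fq = "restr (sball q) f" and ?fp = "restr (sball p) f"
  define g where "g y = ?fq y - ?fp y" for y
  have L: "?fq \<in> Lp 2" "?fp \<in> Lp 2" by (rule local_Lp[OF f])+
  have gcmod: "cmod (g y) \<le> cmod (?fq y)" for y using sub by (auto simp: g_def restr_def)
  have "g \<in> Lp 2"
    using Lp_measurable[OF L(1)] Lp_measurable[OF L(2)] gcmod
    by (intro Lp_dominated[OF L(1)]) (auto simp: g_def[abs_def])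
  moreover have "g y = 0" if "y \<in> sball p" for y using that sub by (auto simp: g_def restr_def)
  ultimately have "Tm g x \<le> Tm g x' + ennreal osc_const * maximal_op (\<lambda>y. ennreal (cmod (g y))) x'"
    using x by (intro Tm_osc_le[where q = p]) auto
  also have "\<dots> \<le> (Tm ?fq x' + Tm ?fp x') + ennreal osc_const * maximal_op (\<lambda>y. ennreal (cmod (?fq y))) x'"
    unfolding g_def[abs_def] using gcmod L
    by (intro add_mono Tm_diff_le mult_left_mono maximal_op_mono) (auto simp: g_def)
  also have "\<dots> \<le> (ennreal threshold * avg f q + ennreal threshold * avg f p) + ennreal osc_const * (ennreal threshold * avg f q)"
    by (intro add_mono mult_left_mono good_point_le x) auto
  also have "\<dots> = ennreal dom_const * avg f q + ennreal threshold * avg f p"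
    unfolding dom_const_def using osc_const_nonneg threshold_pos
    by (simp add: ennreal_mult ennreal_plus distrib_right mult.assoc add_ac)
  also have "\<dots> \<le> ennreal dom_const * avg f q + ennreal dom_const * avg f p"
    by (intro add_left_mono threshold_avg_le)
  finally have "Tm g x \<le> ennreal dom_const * avg f q + ennreal dom_const * avg f p" .
  moreover have "Tm ?fq x \<le> Tm g x + Tm ?fp x"
  proof -
    have "Tm (\<lambda>y. g y + ?fp y) x \<le> Tm g x + Tm ?fp x"
      using \<open>g \<in> Lp 2\<close> L(2) by (rule Tm_add_le)
    moreover have "(\<lambda>y. g y + ?fp y) = ?fq" by (simp add: g_def)
    ultimately show ?thesis by simp
  qed
  ultimately show ?thesis by (meson add_right_mono order_trans)
qed

end

section \<open>The weighted estimate on one cube\<close>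

lemma iterate_maximal_measurable [measurable]:
  "w \<in> borel_measurable lebesgue \<Longrightarrow> (maximal_op ^^ j) w \<in> borel_measurable lebesgue"
  by (cases j) auto

lemma nn_integral_sball_le_maximal_op:
  fixes q :: "(real^'n) \<times> real"
  assumes "x \<in> sball q"
  shows "(\<integral>\<^sup>+y\<in>sball q. g y \<partial>lebesgue)
    \<le> ennreal (sball_ratio TYPE('n)) * emeasure lebesgue (cube q) * maximal_op g x"
proof -
  have "0 < 4 * real CARD('n) * snd q"
    using assms unfolding sball_def by (metis ball_eq_empty empty_iff not_le)
  then have "0 < snd q" by (simp add: zero_less_mult_iff)
  then show ?thesis
    using nn_integral_ball_le_maximal_op[of "4 * real CARD('n) * snd q" x "fst q" g] assms emeasure_sball[of q]
    by (simp add: sball_def)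
qed

context weak_type_modulated
begin

definition loc_const :: "real \<Rightarrow> nat \<Rightarrow> real" where
  "loc_const p k = 2 powr p * sparse_const p k * (dom_const powr p * sball_ratio TYPE('n) ^ (k + 1)
     * (2 * 5 ^ CARD('n) * (p / r / (p / r - 1) * 2 powr (p / r - 1))))"

text \<open>The average \<open>D\<close> of \<open>w\<close> over \<open>sball q\<close> is at most
  \<open>maximal_op w\<close> at each point there. Hence the constant \<open>D^(r/p)\<close> can be
  drawn into the average of \<open>|f|^r\<close> and replaced by a function; raising to the power
  \<open>p / r\<close> recovers \<open>D\<close> times the \<open>p\<close>-th power of
  \<open>avg f q\<close>.\<close>

lemma avg_powr_weight_le:
  assumes f: "f \<in> Lp 2" and [measurable]: "w \<in> borel_measurable lebesgue"
    and p: "0 < p" and q: "0 < snd q" and x: "x \<in> cube q"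
  shows "ennreal_pow (avg f q) p * (\<integral>\<^sup>+y\<in>sball q. w y \<partial>lebesgue)
    \<le> emeasure lebesgue (sball q)
      * ennreal_pow (maximal_op (\<lambda>y. ennreal (cmod (f y) powr r) * ennreal_pow (maximal_op w y) (r / p)) x) (p / r)"
proof -
  let ?m = "emeasure lebesgue (sball q)"
  have [measurable]: "f \<in> borel_measurable lebesgue" using f by (rule Lp_measurable)
  have m: "?m \<noteq> 0" "?m \<noteq> top"
    using q unfolding sball_def by (auto intro!: emeasure_lebesgue_ball_pos simp: emeasure_lebesgue_ball_finite)
  define b where "b = (\<integral>\<^sup>+y\<in>sball q. ennreal (cmod (f y) powr r) \<partial>lebesgue) / ?m"
  define D where "D = (\<integral>\<^sup>+y\<in>sball q. w y \<partial>lebesgue) / ?m"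
  have D: "D \<le> maximal_op w y" if "y \<in> sball q" for y
    unfolding D_def using m that q nn_integral_ball_le_maximal_op[of "4 * real CARD('n) * snd q" y "fst q" w]
    by (simp add: ennreal_divide_le_iff sball_def mult.commute)
  have "b * ennreal_pow D (r / p) = (\<integral>\<^sup>+y\<in>sball q. ennreal (cmod (f y) powr r) * ennreal_pow D (r / p) \<partial>lebesgue) / ?m"
  proof -
    have "(\<integral>\<^sup>+y\<in>sball q. ennreal (cmod (f y) powr r) * ennreal_pow D (r / p) \<partial>lebesgue)
        = (\<integral>\<^sup>+y. ennreal_pow D (r / p) * (ennreal (cmod (f y) powr r) * indicator (sball q) y) \<partial>lebesgue)"
      by (simp add: mult_ac)
    also have "\<dots> = ennreal_pow D (r / p) * (\<integral>\<^sup>+y\<in>sball q. ennreal (cmod (f y) powr r) \<partial>lebesgue)"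
      by (rule nn_integral_cmult) measurable
    finally show ?thesis by (simp add: b_def ennreal_times_divide mult.commute)
  qed
  also have "\<dots> \<le> maximal_op (\<lambda>y. ennreal (cmod (f y) powr r) * ennreal_pow (maximal_op w y) (r / p)) x" (is "_ \<le> ?MH")
  proof -
    have "(\<integral>\<^sup>+y\<in>sball q. ennreal (cmod (f y) powr r) * ennreal_pow D (r / p) \<partial>lebesgue)
        \<le> (\<integral>\<^sup>+y\<in>sball q. ennreal (cmod (f y) powr r) * ennreal_pow (maximal_op w y) (r / p) \<partial>lebesgue)"
      using D p r by (intro nn_integral_mono) (auto simp: indicator_def intro!: mult_left_mono ennreal_pow_mono)
    also have "\<dots> \<le> ?m * ?MH"
      unfolding sball_def using q x cube_subset_sball[of q]
      by (intro nn_integral_ball_le_maximal_op) (auto simp: sball_def)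
    finally show ?thesis using m by (simp add: ennreal_divide_le_iff mult.commute)
  qed
  finally have "ennreal_pow (b * ennreal_pow D (r / p)) (p / r) \<le> ennreal_pow ?MH (p / r)"
    using p r by (intro ennreal_pow_mono) auto
  moreover have "ennreal_pow (b * ennreal_pow D (r / p)) (p / r) = ennreal_pow (avg f q) p * D"
    using p r by (simp add: ennreal_pow_mult ennreal_pow_pow avg_def b_def)
  moreover have "(\<integral>\<^sup>+y\<in>sball q. w y \<partial>lebesgue) = ?m * D"
    using m by (simp add: D_def ennreal_times_divide ennreal_mult_divide_eq mult.commute[of ?m])
  ultimately have "?m * (ennreal_pow (avg f q) p * D) \<le> ?m * ennreal_pow ?MH (p / r)"
    by (intro mult_left_mono) auto
  then show ?thesis unfolding \<open>(\<integral>\<^sup>+y\<in>sball q. w y \<partial>lebesgue) = ?m * D\<close> by (simp add: mult_ac)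
qed

text \<open>The abstract tree estimate applied to the stopping tree, with the local operator as
  \<open>h\<close>. Since \<open>p / r > 1\<close>, the strong type bound for the maximal operator
  turns the integral of \<open>G\<close> into the right-hand side.\<close>

lemma local_estimate:
  assumes f: "f \<in> Lp 2" and [measurable]: "w \<in> borel_measurable lebesgue"
    and p: "r < p" "p - 1 < real k" and q: "0 < snd q"
  obtains g Z where "g \<in> borel_measurable lebesgue" "Z \<in> null_sets lebesgue"
    "\<And>x. x \<in> cube q - Z \<Longrightarrow> ennreal_pow (Tm (restr (sball q) f) x) p \<le> g x"
    "(\<integral>\<^sup>+x. g x * w x \<partial>lebesgue) \<le> ennreal (loc_const p k)
      * (\<integral>\<^sup>+x. ennreal (cmod (f x) powr p) * (maximal_op ^^ (k + 1)) w x \<partial>lebesgue)"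
proof -
  let ?v = "(maximal_op ^^ (k + 1)) w" and ?\<kappa> = "sball_ratio TYPE('n)"
  \<comment> \<open>The exponent is arranged so that \<open>H^(p/r)\<close> equals
    \<open>|f|^p\<close> times the iterated maximal function.\<close>
  define H where "H = (\<lambda>y. ennreal (cmod (f y) powr r) * ennreal_pow (?v y) (r / p))"
  define G where "G = (\<lambda>x. ennreal (dom_const powr p * ?\<kappa> ^ (k + 1)) * ennreal_pow (maximal_op H x) (p / r))"
  \<comment> \<open>The tree consists of cubes while \<open>maximal_op\<close> averages over balls;
    each passage from a cube to its \<open>sball\<close> costs one factor
    \<open>?\<kappa>\<close>.\<close>
  define W where "W = (\<lambda>j x. ennreal (?\<kappa> ^ j) * (maximal_op ^^ j) w x)"
  let ?a = "\<lambda>q. ennreal dom_const * avg f q"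
  have p1: "1 < p" using p r by simp
  have \<kappa>: "0 < ?\<kappa>" by (rule sball_ratio_pos)
  have [measurable]: "f \<in> borel_measurable lebesgue" using f by (rule Lp_measurable)
  have [measurable]: "H \<in> borel_measurable lebesgue" unfolding H_def by measurable
  have Gm [measurable]: "G \<in> borel_measurable lebesgue" unfolding G_def by measurable
  have Wm [measurable]: "W j \<in> borel_measurable lebesgue" for j unfolding W_def by measurable
  obtain U kid where
    U: "\<And>q. 0 < snd q \<Longrightarrow> exceptional f q \<subseteq> U q"
      "\<And>q. U q \<in> sets lebesgue"
      "\<And>q. 0 < snd q \<Longrightarrow> 4 * emeasure lebesgue (U q \<inter> cube q) \<le> emeasure lebesgue (cube q)"
    and kid: "\<And>q i. 0 < snd (kid q i) \<Longrightarrow> 2 * snd (kid q i) \<le> snd q"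
      "\<And>q i. 0 < snd (kid q i) \<Longrightarrow> 2 * emeasure lebesgue (U q \<inter> cube (kid q i)) \<le> emeasure lebesgue (cube (kid q i))"
      "\<And>q. U q \<inter> cube q \<subseteq> (\<Union>i. cube (kid q i))"
    and tree: "sparse_tree lebesgue cube kid"
    using sparse_selection[OF f] by blast
  interpret sparse_tree lebesgue cube kid by (rule tree)
  have pos: "0 < snd q" if "x \<in> cube q" for x and q :: "(real^'n) \<times> real"
    using that cube_empty[of q] by (cases "0 < snd q") auto
  have sball_half: "(\<integral>\<^sup>+y\<in>cube q. g y \<partial>lebesgue) \<le> (\<integral>\<^sup>+y\<in>sball q. g y \<partial>lebesgue)"
    for g and q :: "(real^'n) \<times> real"
    using cube_subset_sball[of q] by (intro nn_integral_mono) (auto simp: indicator_def)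
  have Wint: "(\<integral>\<^sup>+y\<in>cube q. W j y \<partial>lebesgue) = ennreal (?\<kappa> ^ j) * (\<integral>\<^sup>+y\<in>cube q. (maximal_op ^^ j) w y \<partial>lebesgue)"
    for j q by (subst nn_integral_cmult[symmetric]) (auto simp: W_def mult_ac)
  have W: "(\<integral>\<^sup>+y\<in>cube q. W j y \<partial>lebesgue) \<le> emeasure lebesgue (cube q) * W (Suc j) x" if x: "x \<in> cube q" for j q x
  proof -
    have "(\<integral>\<^sup>+y\<in>cube q. W j y \<partial>lebesgue) \<le> ennreal (?\<kappa> ^ j) * (ennreal ?\<kappa> * emeasure lebesgue (cube q) * maximal_op ((maximal_op ^^ j) w) x)"
      unfolding Wint using x cube_subset_sball[of q]
      by (intro mult_left_mono order_trans[OF sball_half] nn_integral_sball_le_maximal_op) auto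
    also have "\<dots> = emeasure lebesgue (cube q) * W (Suc j) x"
      using \<kappa> by (simp add: W_def ennreal_mult mult_ac)
    finally show ?thesis .
  qed
  have G: "ennreal_pow (?a q) p * (\<integral>\<^sup>+y\<in>cube q. W k y \<partial>lebesgue) \<le> emeasure lebesgue (cube q) * G x" if x: "x \<in> cube q" for q x
  proof -
    have "ennreal_pow (?a q) p * (\<integral>\<^sup>+y\<in>cube q. W k y \<partial>lebesgue)
        \<le> ennreal (dom_const powr p) * ennreal_pow (avg f q) p
          * (ennreal (?\<kappa> ^ k) * (\<integral>\<^sup>+y\<in>sball q. (maximal_op ^^ k) w y \<partial>lebesgue))"
      unfolding Wint using p1 dom_const_nonneg
      by (simp add: ennreal_pow_mult ennreal_pow_ennreal mult_left_mono sball_half)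
    also have "\<dots> = ennreal (dom_const powr p) * ennreal (?\<kappa> ^ k)
        * (ennreal_pow (avg f q) p * (\<integral>\<^sup>+y\<in>sball q. (maximal_op ^^ k) w y \<partial>lebesgue))"
      by (simp add: mult_ac)
    also have "\<dots> \<le> ennreal (dom_const powr p) * ennreal (?\<kappa> ^ k)
        * (emeasure lebesgue (sball q) * ennreal_pow (maximal_op H x) (p / r))"
      unfolding H_def using p1 avg_powr_weight_le[OF f _ _ pos[OF x] x, of "(maximal_op ^^ k) w" p]
      by (intro mult_left_mono) auto
    also have "\<dots> = emeasure lebesgue (cube q) * G x"
      using \<kappa> pos[OF x] by (simp add: G_def emeasure_sball ennreal_mult mult_ac)
    finally show ?thesis .
  qed
  have leaf: "Tm (restr (sball q) f) x \<le> ?a q" if x: "x \<in> cube q" "\<And>i. x \<notin> cube (kid q i)" for q x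
  proof -
    have "x \<notin> U q" using x kid(3)[of q] by blast
    then have "x \<notin> exceptional f q" using U(1)[OF pos[OF x(1)]] by blast
    then show ?thesis using good_point_le(1) threshold_avg_le order_trans by blast
  qed
  have step: "Tm (restr (sball q) f) x \<le> ?a q + ?a (kid q i) + Tm (restr (sball (kid q i)) f) x"
    if x: "x \<in> cube (kid q i)" for q i x
  proof -
    let ?p = "kid q i"
    have k0: "0 < snd ?p" by (rule pos[OF x])
    have q0: "0 < snd q" using kid_subset[of q i] x pos by blast
    \<comment> \<open>The two open sets fill at most \<open>1/2\<close> and \<open>1/4\<close> of
      the child, which is less than the whole.\<close>
    have "\<exists>x'\<in>cube ?p. x' \<notin> U q \<and> x' \<notin> U ?p"
    proof (rule ccontr)
      assume "\<not> ?thesis"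
      then have sub: "cube ?p \<subseteq> (U q \<inter> cube ?p) \<union> (U ?p \<inter> cube ?p)" by blast
      obtain m where m: "emeasure lebesgue (cube ?p) = ennreal m" "0 < m"
        using k0 by (simp add: emeasure_cube)
      have "emeasure lebesgue (cube ?p) \<le> emeasure lebesgue ((U q \<inter> cube ?p) \<union> (U ?p \<inter> cube ?p))"
        using sub U(2) by (intro emeasure_mono) auto
      also have "\<dots> \<le> emeasure lebesgue (U q \<inter> cube ?p) + emeasure lebesgue (U ?p \<inter> cube ?p)"
        using U(2) by (intro emeasure_subadditive) auto
      finally have "4 * emeasure lebesgue (cube ?p)
          \<le> 4 * (emeasure lebesgue (U q \<inter> cube ?p) + emeasure lebesgue (U ?p \<inter> cube ?p))"
        by (rule mult_left_mono) simp
      also have "\<dots> = 2 * (2 * emeasure lebesgue (U q \<inter> cube ?p)) + 4 * emeasure lebesgue (U ?p \<inter> cube ?p)"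
        by (simp add: distrib_left flip: mult.assoc)
      also have "\<dots> \<le> 2 * emeasure lebesgue (cube ?p) + emeasure lebesgue (cube ?p)"
        by (intro add_mono mult_left_mono kid(2) U(3) k0) auto
      also have "2 * emeasure lebesgue (cube ?p) + emeasure lebesgue (cube ?p) = ennreal (2 * m + m)"
        unfolding m using m(2) by (subst ennreal_plus) (auto simp: ennreal_mult)
      also have "4 * emeasure lebesgue (cube ?p) = ennreal (4 * m)"
        using m by (simp add: ennreal_mult)
      finally have "4 * m \<le> 2 * m + m" using m(2) by (simp add: ennreal_le_iff del: ennreal_plus)
      then show False using m(2) by simp
    qed
    then obtain x' where x': "x' \<in> cube ?p" "x' \<notin> U q" "x' \<notin> U ?p" by blast
    have sub: "sball ?p \<subseteq> sball q"
      by (rule sball_mono[OF kid_subset k0 kid(1)[OF k0]])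
    have ne: "x' \<notin> exceptional f q" "x' \<notin> exceptional f ?p"
      using x' U(1)[OF q0] U(1)[OF k0] by blast+
    show ?thesis by (rule Tm_kid_le[OF f sub x x'(1) ne])
  qed
  have "(\<integral>\<^sup>+x\<in>cube q. G x \<partial>lebesgue) \<le> (\<integral>\<^sup>+x. G x \<partial>lebesgue)"
    by (intro nn_integral_mono) (auto simp: indicator_def)
  also have "\<dots> = ennreal (dom_const powr p * ?\<kappa> ^ (k + 1)) * (\<integral>\<^sup>+x. ennreal_pow (maximal_op H x) (p / r) \<partial>lebesgue)"
    unfolding G_def by (rule nn_integral_cmult) measurable
  also have "\<dots> \<le> ennreal (dom_const powr p * ?\<kappa> ^ (k + 1))
      * (ennreal (2 * 5 ^ CARD('n) * (p / r / (p / r - 1) * 2 powr (p / r - 1)))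
      * (\<integral>\<^sup>+x. ennreal_pow (H x) (p / r) \<partial>lebesgue))"
    using p r by (intro mult_left_mono maximal_op_strong_type) auto
  also have "(\<integral>\<^sup>+x. ennreal_pow (H x) (p / r) \<partial>lebesgue) = (\<integral>\<^sup>+x. ennreal (cmod (f x) powr p) * ?v x \<partial>lebesgue)"
    using p1 r by (intro nn_integral_cong) (simp add: H_def ennreal_pow_mult ennreal_pow_pow ennreal_pow_ennreal powr_powr)
  finally have "ennreal (2 powr p * sparse_const p k) * (\<integral>\<^sup>+x\<in>cube q. G x \<partial>lebesgue)
      \<le> ennreal (2 powr p * sparse_const p k) * (ennreal (dom_const powr p * ?\<kappa> ^ (k + 1))
      * (ennreal (2 * 5 ^ CARD('n) * (p / r / (p / r - 1) * 2 powr (p / r - 1)))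
      * (\<integral>\<^sup>+x. ennreal (cmod (f x) powr p) * ?v x \<partial>lebesgue)))"
    by (rule mult_left_mono) simp
  also have "\<dots> = ennreal (loc_const p k) * (\<integral>\<^sup>+x. ennreal (cmod (f x) powr p) * ?v x \<partial>lebesgue)"
  proof -
    have "0 \<le> 2 powr p * sparse_const p k" by (simp add: sparse_const_def)
    moreover have "0 \<le> dom_const powr p * ?\<kappa> ^ (k + 1)" using \<kappa> by simp
    moreover have "0 \<le> 2 * 5 ^ CARD('n) * (p / r / (p / r - 1) * 2 powr (p / r - 1))"
      using p r by (intro mult_nonneg_nonneg divide_nonneg_nonneg) auto
    moreover have "ennreal (a * (b * d)) = ennreal a * (ennreal b * ennreal d)" if "0 \<le> a" "0 \<le> b" "0 \<le> d" for a b d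
      using that by (simp add: ennreal_mult)
    ultimately have "ennreal (loc_const p k) = ennreal (2 powr p * sparse_const p k)
      * (ennreal (dom_const powr p * ?\<kappa> ^ (k + 1))
      * ennreal (2 * 5 ^ CARD('n) * (p / r / (p / r - 1) * 2 powr (p / r - 1))))"
      unfolding loc_const_def by blast
    then show ?thesis by (simp only: mult.assoc)
  qed
  finally have bound: "ennreal (2 powr p * sparse_const p k) * (\<integral>\<^sup>+x\<in>cube q. G x \<partial>lebesgue)
      \<le> ennreal (loc_const p k) * (\<integral>\<^sup>+x. ennreal (cmod (f x) powr p) * ?v x \<partial>lebesgue)" .
  show thesis
  proof (rule dominated_integral_le[where W = W and G = G and a = ?a and p = p and k = k and q = q
        and h = "\<lambda>q. Tm (restr (sball q) f)", OF p1 p(2) Wm Gm W G leaf step])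
    fix g Z
    assume g: "g \<in> borel_measurable lebesgue" "Z \<in> null_sets lebesgue"
      "\<And>x. x \<in> cube q - Z \<Longrightarrow> ennreal_pow (Tm (restr (sball q) f) x) p \<le> g x"
      and int: "(\<integral>\<^sup>+x. g x * W 0 x \<partial>lebesgue)
        \<le> ennreal (2 powr p * sparse_const p k) * (\<integral>\<^sup>+x\<in>cube q. G x \<partial>lebesgue)"
    have le: "(\<integral>\<^sup>+x. g x * w x \<partial>lebesgue)
        \<le> ennreal (loc_const p k) * (\<integral>\<^sup>+x. ennreal (cmod (f x) powr p) * ?v x \<partial>lebesgue)"
      using order_trans[OF int bound] by (simp add: W_def)
    show thesis by (rule that[OF g(1,2) _ le]) (rule g(3))
  qed
qed

end

section \<open>Exhausting the space\<close>

lemma weight_measurable: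
  fixes w :: "real^'n \<Rightarrow> real"
  assumes "weight w"
  shows "w \<in> borel_measurable lebesgue"
proof -
  have "(\<lambda>x. indicator (cball 0 (real n)) x *\<^sub>R w x) \<in> borel_measurable lebesgue" for n
    using assms compact_cball[of "0::real^'n" "real n"] unfolding weight_def set_integrable_def by blast
  moreover have "(\<lambda>n. indicator (cball 0 (real n)) x *\<^sub>R w x) \<longlonglongrightarrow> w x" for x
  proof (rule tendsto_eventually)
    obtain N where "norm x \<le> real N" using real_arch_simple by blast
    then show "\<forall>\<^sub>F n in sequentially. indicator (cball 0 (real n)) x *\<^sub>R w x = w x"
      unfolding eventually_sequentially by (intro exI[of _ N]) auto
  qed
  ultimately show ?thesis
    by (rule borel_measurable_LIMSEQ_metric)
qed

lemma weight_finite_on_bounded: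
  fixes w :: "real^'n \<Rightarrow> real"
  assumes "weight w" "bounded A" "A \<in> sets lebesgue"
  shows "(\<integral>\<^sup>+x\<in>A. ennreal (w x) \<partial>lebesgue) < top"
proof -
  obtain \<rho> where "\<forall>x\<in>A. norm x \<le> \<rho>" using assms(2) unfolding bounded_iff by blast
  then have \<rho>: "A \<subseteq> cball 0 \<rho>" by auto
  have "integrable lebesgue (\<lambda>x. indicator (cball 0 \<rho>) x *\<^sub>R w x)"
    using assms(1) compact_cball[of "0::real^'n" \<rho>] unfolding weight_def set_integrable_def by blast
  then have "(\<integral>\<^sup>+x. ennreal (norm (indicator (cball 0 \<rho>) x *\<^sub>R w x)) \<partial>lebesgue) < \<infinity>"
    by (simp add: integrable_iff_bounded)
  moreover have "(\<integral>\<^sup>+x\<in>A. ennreal (w x) \<partial>lebesgue)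
      \<le> (\<integral>\<^sup>+x. ennreal (norm (indicator (cball 0 \<rho>) x *\<^sub>R w x)) \<partial>lebesgue)"
    using \<rho> assms(1) by (intro nn_integral_mono) (auto simp: indicator_def weight_def)
  ultimately show ?thesis by (simp add: le_less_trans)
qed

definition big_cube :: "nat \<Rightarrow> (real^'n) \<times> real" where
  "big_cube j = ((\<chi> i. - (2 ^ j)), 2 * 2 ^ j)"

lemma mem_big_cube: "x \<in> cube (big_cube j) \<longleftrightarrow> (\<forall>i. - (2 ^ j) \<le> x $ i \<and> x $ i < 2 ^ j)"
  by (simp add: big_cube_def cube_def)

lemma big_cube_mono: "i \<le> j \<Longrightarrow> cube (big_cube i) \<subseteq> cube (big_cube j)"
proof
  fix x :: "real^'n" assume "i \<le> j" "x \<in> cube (big_cube i)"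
  moreover have "(2::real) ^ i \<le> 2 ^ j" using \<open>i \<le> j\<close> by simp
  ultimately show "x \<in> cube (big_cube j)" unfolding mem_big_cube by (smt (verit))
qed

lemma big_cube_exhausts:
  fixes x :: "real^'n"
  obtains j where "x \<in> cube (big_cube j)"
proof -
  obtain j where j: "norm x < 2 ^ j" using real_arch_pow[of 2] by auto
  have "\<bar>x $ i\<bar> < 2 ^ j" for i using component_le_norm_cart[of x i] j by linarith
  then have "x \<in> cube (big_cube j)" unfolding mem_big_cube by (smt (verit))
  then show thesis by (rule that)
qed

lemma bounded_cube: "bounded (cube q)"
proof (cases "0 < snd q")
  case True
  then show ?thesis
    using cube_norm_diff_le[OF _ corner_in_cube[OF True]]
    by (intro boundedI[where B = "CARD('a) * snd q + norm (fst q)"])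
      (smt (verit) norm_triangle_ineq2)
qed (simp add: cube_empty)

context weak_type_modulated
begin

text \<open>On the \<open>j\<close>-th big cube \<open>f\<close> is split at the boundary of the
  dilate: the local estimate handles the inner part with a constant free of \<open>j\<close>, and
  the outer part is at most \<open>e j\<close> there, with \<open>e\<close> tending to
  \<open>0\<close>.\<close>

lemma global_estimate:
  assumes f: "f \<in> Lp 2" and w: "weight w" and p: "r < p" "p - 1 < real k"
  shows "upper_nn_integral lebesgue (\<lambda>x. ennreal_pow (Tm f x) p * ennreal (w x))
    \<le> ennreal (2 powr p * loc_const p k)
      * (\<integral>\<^sup>+x. ennreal (cmod (f x) powr p) * (maximal_op ^^ (k + 1)) (\<lambda>y. ennreal (w y)) x \<partial>lebesgue)"
proof -
  let ?N = "real CARD('n)"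
  let ?\<Phi> = "\<integral>\<^sup>+x. ennreal (cmod (f x) powr p) * (maximal_op ^^ (k + 1)) (\<lambda>y. ennreal (w y)) x \<partial>lebesgue"
  let ?Q = "\<lambda>j. cube (big_cube j) :: (real^'n) set"
  have p0: "0 < p" using p r by simp
  have [measurable]: "f \<in> borel_measurable lebesgue" using f by (rule Lp_measurable)
  have [measurable]: "w \<in> borel_measurable lebesgue" using w by (rule weight_measurable)
  obtain X where X: "0 \<le> X" "(\<integral>\<^sup>+y. ennreal (cmod (f y) powr 2) \<partial>lebesgue) = ennreal X"
    using L2_bound[OF f] .
  \<comment> \<open>The \<open>L^2\<close> tail bound for side \<open>2 * 2 ^ j\<close>; it decays
    geometrically in \<open>j\<close>.\<close>
  define e where "e j = \<bar>c\<bar> * (2 * sqrt X * sqrt ((8 / 3) ^ CARD('n) * unit_ball_volume TYPE('n))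
       * (3 * ?N * (2 * 2 ^ j)) powr (-(?N / 2)) / (1 - 2 powr (-(?N / 2))))" for j :: nat
  have e_lim: "e \<longlonglongrightarrow> 0"
  proof -
    define a where "a = -(?N / 2)"
    have "2 powr a < 2 powr (0::real)" by (intro powr_less_mono) (auto simp: a_def)
    then have "(\<lambda>j. \<bar>c\<bar> * (2 * sqrt X * sqrt ((8 / 3) ^ CARD('n) * unit_ball_volume TYPE('n))
        * ((6 * ?N) powr a * (2 powr a) ^ j) / (1 - 2 powr a))) \<longlonglongrightarrow>
      \<bar>c\<bar> * (2 * sqrt X * sqrt ((8 / 3) ^ CARD('n) * unit_ball_volume TYPE('n))
        * ((6 * ?N) powr a * 0) / (1 - 2 powr a))"
      by (intro tendsto_intros LIMSEQ_realpow_zero) auto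
    moreover have "(3 * ?N * (2 * 2 ^ j)) powr a = (6 * ?N) powr a * (2 powr a) ^ j" for j :: nat
    proof -
      have "3 * ?N * (2 * 2 ^ j) = 6 * ?N * 2 ^ j" by simp
      then show ?thesis by (simp only: powr_mult two_power_powr)
    qed
    ultimately show ?thesis by (simp add: e_def[abs_def] flip: a_def)
  qed
  have e_nonneg: "0 \<le> e j" for j
    unfolding e_def using X unit_ball_volume_pos[where 'n='n] powr_less_mono[of "-(?N / 2)" 0 2]
    by (intro mult_nonneg_nonneg divide_nonneg_nonneg) auto
  define P where "P j g Z \<longleftrightarrow> g \<in> borel_measurable lebesgue \<and> Z \<in> null_sets lebesgue
    \<and> (\<forall>x\<in>?Q j - Z. ennreal_pow (Tm (restr (sball (big_cube j)) f) x) p \<le> g x)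
    \<and> (\<integral>\<^sup>+x. g x * ennreal (w x) \<partial>lebesgue) \<le> ennreal (loc_const p k) * ?\<Phi>" for j g Z
  have "\<exists>g Z. P j g Z" for j
  proof -
    have wm: "(\<lambda>x. ennreal (w x)) \<in> borel_measurable lebesgue" by measurable
    have s: "0 < snd (big_cube j :: (real^'n) \<times> real)" by (simp add: big_cube_def)
    show ?thesis unfolding P_def by (rule local_estimate[OF f wm p s]) blast
  qed
  then obtain g Z where gZ: "\<And>j. P j (g j) (Z j)" by metis
  have [measurable]: "g j \<in> borel_measurable lebesgue" for j using gZ[of j] unfolding P_def by blast
  have Z: "Z j \<in> null_sets lebesgue" for j using gZ[of j] unfolding P_def by blast
  have g: "ennreal_pow (Tm (restr (sball (big_cube j)) f) x) p \<le> g j x" if "x \<in> ?Q j" "x \<notin> Z j" for j x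
    using gZ[of j] that unfolding P_def by blast
  have int: "(\<integral>\<^sup>+x. g j x * ennreal (w x) \<partial>lebesgue) \<le> ennreal (loc_const p k) * ?\<Phi>" for j
    using gZ[of j] unfolding P_def by blast
  define N where "N = (\<Union>j. Z j)"
  have N: "N \<in> null_sets lebesgue" unfolding N_def using Z by (intro null_sets_UN)
  then have [measurable]: "N \<in> sets lebesgue" by (rule null_setsD2)
  define b where "b j x = ennreal (2 powr p) * (g j x + ennreal (e j powr p))" for j x
  have [measurable]: "b j \<in> borel_measurable lebesgue" for j unfolding b_def[abs_def] by measurable
  have Tm_le: "ennreal_pow (Tm f x) p \<le> b j x" if "x \<in> ?Q j" "x \<notin> N" for x j
  proof -
    let ?f = "restr (sball (big_cube j)) f" and ?h = "restr (- sball (big_cube j)) f"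
    have L: "?f \<in> Lp 2" "?h \<in> Lp 2" by (auto intro!: restr_Lp[OF f] simp: Compl_in_sets_lebesgue)
    have "Tm ?h x \<le> ennreal (e j)"
    proof -
      have "(\<integral>\<^sup>+y. ennreal (cmod (?h y) powr 2) \<partial>lebesgue) \<le> ennreal X"
        unfolding X(2)[symmetric] by (intro nn_integral_mono) (auto simp: restr_def)
      moreover have "?h y = 0" if "y \<in> sball (big_cube j)" for y
        using that by (simp add: restr_def)
      moreover have "e j = \<bar>c\<bar> * (2 * sqrt X * sqrt ((8 / 3) ^ CARD('n) * unit_ball_volume TYPE('n))
          * (3 * ?N * snd (big_cube j :: (real^'n) \<times> real)) powr (-(?N / 2)) / (1 - 2 powr (-(?N / 2))))"
        by (simp only: e_def big_cube_def snd_conv)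
      ultimately show ?thesis
        using Tm_tail_le[OF L(2) _ that(1) _ X(1)] by simp
    qed
    moreover have "Tm f x \<le> Tm ?f x + Tm ?h x"
    proof -
      have "(\<lambda>y. ?f y + ?h y) = f" by (auto simp: restr_def)
      then show ?thesis using Tm_add_le[OF L, of x] by simp
    qed
    ultimately have "Tm f x \<le> Tm ?f x + ennreal (e j)" by (meson add_left_mono order_trans)
    then have "ennreal_pow (Tm f x) p \<le> ennreal_pow (Tm ?f x + ennreal (e j)) p"
      using p0 by (rule ennreal_pow_mono)
    also have "\<dots> \<le> ennreal (2 powr p) * (ennreal_pow (Tm ?f x) p + ennreal_pow (ennreal (e j)) p)"
      using p0 by (rule ennreal_pow_add_le)
    also have "\<dots> \<le> b j x"
      unfolding b_def using g[of x j] that e_nonneg[of j] N_def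
      by (intro mult_left_mono add_mono) (auto simp: ennreal_pow_ennreal)
    finally show ?thesis .
  qed
  \<comment> \<open>The upper integral asks for one majorant valid everywhere. The infimum keeps the
    bounds of all \<open>j\<close> available at once, and the value \<open>top\<close> on the null
    set \<open>N\<close> secures the domination there without affecting integrals.\<close>
  define G where "G x = (if x \<in> N then top else (INF j. if x \<in> ?Q j then b j x else top))" for x
  have [measurable]: "G \<in> borel_measurable lebesgue" unfolding G_def[abs_def] by measurable
  define h where "h x = G x * ennreal (w x)" for x
  have [measurable]: "h \<in> borel_measurable lebesgue" unfolding h_def[abs_def] by measurable
  have "ennreal_pow (Tm f x) p \<le> G x" for x
  proof (cases "x \<in> N")
    case False
    then have "ennreal_pow (Tm f x) p \<le> (if x \<in> ?Q j then b j x else top)" for j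
      using Tm_le by simp
    then have "ennreal_pow (Tm f x) p \<le> (INF j. if x \<in> ?Q j then b j x else top)"
      by (rule INF_greatest)
    then show ?thesis using False by (simp only: G_def if_False)
  qed (simp add: G_def)
  then have "upper_nn_integral lebesgue (\<lambda>x. ennreal_pow (Tm f x) p * ennreal (w x)) \<le> (\<integral>\<^sup>+x. h x \<partial>lebesgue)"
    unfolding upper_nn_integral_def by (intro INF_lower) (auto simp: h_def intro!: mult_right_mono)
  also have "\<dots> \<le> (\<integral>\<^sup>+x. (SUP i. h x * indicator (?Q i) x) \<partial>lebesgue)"
  proof (rule nn_integral_mono)
    fix x :: "real^'n"
    obtain i where "x \<in> ?Q i" by (rule big_cube_exhausts)
    then show "h x \<le> (SUP i. h x * indicator (?Q i) x)" by (intro SUP_upper2[of i]) auto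
  qed
  also have "\<dots> = (SUP i. \<integral>\<^sup>+x\<in>?Q i. h x \<partial>lebesgue)"
  proof (rule nn_integral_monotone_convergence_SUP)
    show "incseq (\<lambda>i x. h x * indicator (?Q i) x)"
      using big_cube_mono by (auto simp: incseq_def le_fun_def indicator_def)
  qed measurable
  also have "\<dots> \<le> ennreal (2 powr p * loc_const p k) * ?\<Phi>"
  proof (rule SUP_least)
    fix i
    obtain m where m: "(\<integral>\<^sup>+x\<in>?Q i. ennreal (w x) \<partial>lebesgue) = ennreal m" "0 \<le> m"
      using weight_finite_on_bounded[OF w bounded_cube[of "big_cube i"]]
      by (cases "\<integral>\<^sup>+x\<in>?Q i. ennreal (w x) \<partial>lebesgue") auto
    \<comment> \<open>The inner cube \<open>?Q i\<close> stays fixed while \<open>j\<close> grows.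
      Its \<open>w\<close>-mass \<open>m\<close> is finite by local integrability, so the error term
      tends to \<open>0\<close> with \<open>e j\<close>.\<close>
    have le: "(\<integral>\<^sup>+x\<in>?Q i. h x \<partial>lebesgue)
        \<le> ennreal (2 powr p * loc_const p k) * ?\<Phi> + ennreal (2 powr p * e j powr p * m)" if "i \<le> j" for j
    proof -
      have "(\<integral>\<^sup>+x\<in>?Q i. h x \<partial>lebesgue)
          \<le> (\<integral>\<^sup>+x. ennreal (2 powr p) * (g j x * ennreal (w x))
            + ennreal (2 powr p * e j powr p) * (ennreal (w x) * indicator (?Q i) x) \<partial>lebesgue)"
      proof (rule nn_integral_mono_AE)
        show "AE x in lebesgue. h x * indicator (?Q i) x
          \<le> ennreal (2 powr p) * (g j x * ennreal (w x))
            + ennreal (2 powr p * e j powr p) * (ennreal (w x) * indicator (?Q i) x)"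
          using AE_not_in[OF N]
        proof eventually_elim
          case (elim x)
          show ?case
          proof (cases "x \<in> ?Q i")
            case True
            from True have "x \<in> ?Q j" using big_cube_mono[OF that] by blast
            have "(INF j. if x \<in> ?Q j then b j x else top) \<le> (if x \<in> ?Q j then b j x else top)"
              by (rule INF_lower) simp
            then have "G x \<le> b j x" using elim \<open>x \<in> ?Q j\<close> by (simp only: G_def if_False if_True)
            then have "h x \<le> b j x * ennreal (w x)" unfolding h_def by (rule mult_right_mono) simp
            also have "\<dots> = ennreal (2 powr p) * (g j x * ennreal (w x)) + ennreal (2 powr p * e j powr p) * ennreal (w x)"
              by (simp add: b_def distrib_left distrib_right ennreal_mult mult.assoc)
            finally show ?thesis using True by simp
          qed simp
        qed
      qed
      also have "\<dots> = ennreal (2 powr p) * (\<integral>\<^sup>+x. g j x * ennreal (w x) \<partial>lebesgue)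
          + ennreal (2 powr p * e j powr p) * ennreal m"
        unfolding m(1)[symmetric] by (subst nn_integral_add) (auto simp: nn_integral_cmult)
      also have "\<dots> \<le> ennreal (2 powr p) * (ennreal (loc_const p k) * ?\<Phi>) + ennreal (2 powr p * e j powr p) * ennreal m"
        by (intro add_right_mono mult_left_mono int) simp
      also have "\<dots> = ennreal (2 powr p * loc_const p k) * ?\<Phi> + ennreal (2 powr p * e j powr p * m)"
        using m by (simp add: ennreal_mult' mult.assoc)
      finally show ?thesis .
    qed
    show "(\<integral>\<^sup>+x\<in>?Q i. h x \<partial>lebesgue) \<le> ennreal (2 powr p * loc_const p k) * ?\<Phi>"
    proof (rule ennreal_le_epsilon)
      fix d :: real assume d: "0 < d"
      have "(\<lambda>j. 2 powr p * e j powr p * m) \<longlonglongrightarrow> 2 powr p * 0 powr p * m"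
        using p0 e_nonneg by (intro tendsto_intros tendsto_powr' e_lim) auto
      then have "\<forall>\<^sub>F j in sequentially. 2 powr p * e j powr p * m < d"
        using p0 d by (intro order_tendstoD(2)) auto
      then obtain j where j: "i \<le> j" "2 powr p * e j powr p * m < d"
        unfolding eventually_sequentially by (metis nat_le_linear order_refl)
      show "(\<integral>\<^sup>+x\<in>?Q i. h x \<partial>lebesgue) \<le> ennreal (2 powr p * loc_const p k) * ?\<Phi> + ennreal d"
        using j by (intro order_trans[OF le[OF j(1)]] add_left_mono ennreal_leI) auto
    qed
  qed
  finally show ?thesis .
qed

end

theorem theorem1p2:
  fixes T :: "((real^'n) \<Rightarrow> complex) \<Rightarrow> (real^'n) \<Rightarrow> complex"
    and I :: "'i set" and \<phi> :: "'i \<Rightarrow> (real^'n) \<Rightarrow> real"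
    and \<psi> :: "real \<Rightarrow> real" and r\<^sub>0 p :: real
  assumes "calderon_zygmund T"
    and "\<And>\<alpha>. \<alpha> \<in> I \<Longrightarrow> \<phi> \<alpha> \<in> borel_measurable lebesgue"
    and "1 < r\<^sub>0"
    and "\<exists>c::real. \<forall>r f. 1 < r \<longrightarrow> r \<le> r\<^sub>0 \<longrightarrow> f \<in> Lp 2 \<longrightarrow> f \<in> Lp r \<longrightarrow>
           weak_Lp_norm r (max_modulated T I \<phi> f) \<le> ennreal (c * \<psi> r) * Lp_norm r f"
    and "1 < p"
  shows "\<exists>C::ennreal. C < \<infinity> \<and> (\<forall>f w. f \<in> Lp 2 \<longrightarrow> weight w \<longrightarrow>
           upper_nn_integral lebesgue
             (\<lambda>x. ennreal_pow (max_modulated T I \<phi> f x) p * ennreal (w x))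
           \<le> C * (\<integral>\<^sup>+x. ennreal (cmod (f x) powr p)
                     * (maximal_op ^^ (nat \<lfloor>p\<rfloor> + 1)) (\<lambda>y. ennreal (w y)) x \<partial>lebesgue))"
proof -
  obtain c \<delta> K where cz: "0 < \<delta>" "cz_kernel c \<delta> K"
    "\<And>f x. f \<in> Lp 2 \<Longrightarrow> x \<notin> closure {y. f y \<noteq> 0} \<Longrightarrow> T f x = (\<integral>y. K x y * f y \<partial>lebesgue)"
    using assms(1) unfolding calderon_zygmund_def by blast
  obtain c' where c': "\<And>r f. 1 < r \<Longrightarrow> r \<le> r\<^sub>0 \<Longrightarrow> f \<in> Lp 2 \<Longrightarrow> f \<in> Lp r \<Longrightarrow>
      weak_Lp_norm r (max_modulated T I \<phi> f) \<le> ennreal (c' * \<psi> r) * Lp_norm r f"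
    using assms(4) by blast
  \<comment> \<open>The midpoint between \<open>1\<close> and the smallest of the three upper
    bounds.\<close>
  define r where "r = (1 + min p (min r\<^sub>0 2)) / 2"
  have r_bounds: "1 < r" "r < p" "r \<le> r\<^sub>0" "r \<le> 2" using assms(3,5) by (auto simp: r_def min_def)
  interpret weak_type_modulated T c \<delta> K I \<phi> r "max 0 (c' * \<psi> r)"
  proof
    show "T (\<lambda>x. a * f x + b * g x) = (\<lambda>x. a * T f x + b * T g x)" if "f \<in> Lp 2" "g \<in> Lp 2" for f g a b
      using assms(1) that unfolding calderon_zygmund_def by blast
    \<comment> \<open>The product \<open>c' * \<psi> r\<close> might be negative;
      \<open>ennreal\<close> sends it to \<open>0\<close> in that case, so the maximum gives the
      same bound.\<close>
    show "weak_Lp_norm r (max_modulated T I \<phi> f) \<le> ennreal (max 0 (c' * \<psi> r)) * Lp_norm r f"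
      if "f \<in> Lp 2" "f \<in> Lp r" for f
      using c'[OF r_bounds(1,3) that] by (simp add: ennreal_max_0 max.commute)
  qed (use cz r_bounds assms(2) in auto)
  \<comment> \<open>This strict inequality is what makes the series of Hoelder weights
    converge.\<close>
  have k: "p - 1 < real (nat \<lfloor>p\<rfloor>)"
    using assms(5) by linarith
  show ?thesis
    using global_estimate[OF _ _ r_bounds(2) k]
    by (intro exI[of _ "ennreal (2 powr p * loc_const p (nat \<lfloor>p\<rfloor>))"]) simp
qed

end
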